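(* Let $N=1$ and let $\Omega\subsetneq\mathbb R$ be the union of $n\in\mathbb N$ non-empty disjoint bounded open intervals $\{I_k:k=1,\dots,n\}$. For $s\in(0,1)$ and $p\in[1,\infty)$ such that $sp<1$, it holds that $$\mathfrak h_{s,p}(\Omega)\ge\frac{\mathfrak h_{s,p}(\mathbb R\setminus\{0\})}{n^{sp}}.\qquad(\ast)$$ Moreover, if $p=1$ and $\Omega$ is equivalent to an interval, then $(\ast)$ holds as an equality if and only if all the $I_k$'s have the same measure. On the other hand, for $s\in(0,1)$ and $p\in[1,\infty)$ such that $sp<1$, it holds that $$\mathfrak h_{s,p}((-R,R)\setminus\mathbb Z)\le\frac{R^{1-sp}}{\lfloor R\rfloor}\,\frac{4^{1-sp}}{sp}$$ for any $R\ge1$, with $\mathfrak h_{s,p}(\mathbb R\setminus\mathbb Z)=0$ in the limit case $R=\infty$.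
   Context: For a non-empty open set $\Omega\subsetneq\mathbb R$ and $x\in\Omega$, $d_\Omega(x)=\inf_{y\in\partial\Omega}|x-y|$. $C^\infty_0(\Omega)$ is the set of smooth real functions on $\mathbb R$ with compact support contained in $\Omega$. For $s\in(0,1)$, $p\in[1,\infty)$, $$[u]^p_{W^{s,p}(\mathbb R)}=\int_{\mathbb R}\int_{\mathbb R}\frac{|u(x)-u(y)|^p}{|x-y|^{1+sp}}\,dx\,dy,$$ $$\mathfrak h_{s,p}(\Omega)=\inf_{u\in C^\infty_0(\Omega)}\Big\{[u]^p_{W^{s,p}(\mathbb R)}:\int_\Omega\frac{|u|^p}{d_\Omega^{sp}}\,dx=1\Big\}\in[0,\infty).$$ "$\Omega$ is equivalent to an interval" means that $\Omega$ coincides with an interval up to a Lebesgue-null set. The intervals $I_k$ need not be at positive distance from each other. $\lfloor R\rfloor$ is the integer part of $R$ (largest integer not exceeding $R$). $\mathbb N=\{1,2,\dots\}$. *)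

theory Defs
  imports "HOL-Analysis.Analysis"
begin

text \<open>The functions in \<open>C\<^sub>0\<^sup>\<infinity>(\<Omega>)\<close> are defined on the whole line. Smoothness is required of
  every iterated derivative, so the junk value of \<^const>\<open>deriv\<close> at a point of
  non-differentiability never matters.\<close>

definition test_functions :: "real set \<Rightarrow> (real \<Rightarrow> real) set" where
  "test_functions \<Omega> =
     {u. (\<forall>k. (deriv ^^ k) u differentiable_on UNIV) \<and>
         compact (closure {x. u x \<noteq> 0}) \<and> closure {x. u x \<noteq> 0} \<subseteq> \<Omega>}"

text \<open>The quotient vanishes on the (null) diagonal, by division by zero.\<close>

definition gagliardo :: "real \<Rightarrow> real \<Rightarrow> (real \<Rightarrow> real) \<Rightarrow> ennreal" where
  "gagliardo s p u =
     (\<integral>\<^sup>+y. (\<integral>\<^sup>+x. ennreal (\<bar>u x - u y\<bar> powr p / \<bar>x - y\<bar> powr (1 + s * p)) \<partial>lborel) \<partial>lborel)"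

text \<open>For \<open>x\<close> in a non-empty open set \<open>\<Omega> \<noteq> UNIV\<close>, the frontier is non-empty, so
  \<^term>\<open>infdist x (frontier \<Omega>)\<close> is the infimum of the distances from \<open>x\<close> to boundary points
  (\<^const>\<open>infdist\<close> takes a default value only for the empty set). It is positive on \<open>\<Omega>\<close>.\<close>

definition hardy_const :: "real \<Rightarrow> real \<Rightarrow> real set \<Rightarrow> ennreal" where
  "hardy_const s p \<Omega> =
     Inf {gagliardo s p u | u. u \<in> test_functions \<Omega> \<and>
       (\<integral>\<^sup>+x\<in>\<Omega>. ennreal (\<bar>u x\<bar> powr p / infdist x (frontier \<Omega>) powr (s * p)) \<partial>lborel) = 1}"

definition equivalent_to_interval :: "real set \<Rightarrow> bool" where
  "equivalent_to_interval \<Omega> \<longleftrightarrow> (\<exists>J. is_interval J \<and> sym_diff \<Omega> J \<in> null_sets lebesgue)"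

end

theory Submission
  imports Defs "HOL-Probability.Distribution_Functions"
begin

text \<open>
  Write \<open>q = s p\<close>, so that \<open>0 < q < 1\<close>, and call a \<^emph>\<open>weight\<close> the integral of
  \<open>dist (\<sqdot>, \<partial>\<Omega>) powr - q\<close> over a set.

  \<^bold>\<open>Lower bound.\<close> A point of a union of \<open>n\<close> intervals that is closer than \<open>t\<close> to the boundary lies
  within \<open>t\<close> of one of \<open>2 n\<close> one-sided ends, so such points have measure at most \<open>2 n t\<close>. Hence the
  weight of a set of measure \<open>m\<close> is at most \<open>n powr q\<close> times the integral of \<open>\<bar>x\<bar> powr - q\<close> over the
  centred interval of length \<open>m\<close> (\<open>bathtub_powr\<close>). Applied to all superlevel sets of a test function
  \<open>u\<close>, this compares the Hardy term of \<open>u\<close> with that of its symmetric decreasing rearrangement with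
  respect to the origin. Rearrangement does not increase the seminorm (\<open>gagliardo_rearr_le\<close>): a layer
  decomposition in the distance of the two points, in the size of the jump and in the level reduces
  this to a one-dimensional Riesz inequality for pairs of sets (\<open>riesz_centered\<close>). The rearranged
  function is no test function of the punctured line, but the Hardy inequality extends to it by cutoff
  near a finite set and mollification, which costs nothing because \<open>q < 1\<close> (\<open>hardy_const_le\<close>).

  \<^bold>\<open>Upper bounds.\<close> The same extension allows indicator functions of intervals as competitors. Both the
  seminorm and the Hardy term are explicit for them. This gives the bound for \<open>(-R, R) - \<int>\<close>, whose
  limit for \<open>R\<close> tending to infinity settles the complement of the integers, and for \<open>p = 1\<close> the optimal constant of the
  punctured line and of intervals cut into equal pieces.

  \<^bold>\<open>Equality for \<open>p = 1\<close>.\<close> By the coarea formula it is enough to look at sets. If equality holds, there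
  are sets \<open>E\<close> whose ratio of perimeter to weight is almost optimal. Their perimeter is then almost
  that of an interval of the same measure, and the exact deficit in the Riesz inequality
  (\<open>riesz_deficit\<close>) says that few pairs of points of \<open>E\<close> are further apart than the measure of \<open>E\<close>: up
  to a small part, \<open>E\<close> lies in an interval that is hardly longer (\<open>almost_interval\<close>). A compactness
  argument produces an interval of length \<open>h\<close> that carries the largest weight possible for its length
  (\<open>optimal_interval_exists\<close>). Strict concavity of \<open>v powr (1 - s)\<close> and the explicit weight of an
  interval inside one piece then force the interval to contain every piece, and every piece to have
  length \<open>h / n\<close> (\<open>optimal_interval_rigid\<close>).
\<close>

section \<open>Integrals of powers and the bathtub estimate\<close>

lemma nn_integral_powr_from_0:
  fixes a e :: real
  assumes "e > -1" "0 \<le> a"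
  shows "(\<integral>\<^sup>+x\<in>{0<..<a}. ennreal (x powr e) \<partial>lborel) = ennreal (a powr (e + 1) / (e + 1))"
proof -
  have "(\<integral>\<^sup>+x\<in>{0..a}. ennreal (x powr e) \<partial>lborel) = ennreal (a powr (e + 1) / (e + 1))"
    by (rule nn_integral_has_integral_lebesgue'[OF _ has_integral_powr_from_0[OF assms]]) simp
  moreover have "(\<integral>\<^sup>+x\<in>{0<..<a}. ennreal (x powr e) \<partial>lborel) = (\<integral>\<^sup>+x\<in>{0..a}. ennreal (x powr e) \<partial>lborel)"
  proof (rule nn_integral_cong_AE)
    show "AE x in lborel. ennreal (x powr e) * indicator {0<..<a} x = ennreal (x powr e) * indicator {0..a} x"
      using AE_lborel_singleton[of 0] AE_lborel_singleton[of a] by eventually_elim (auto simp: indicator_def)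
  qed
  ultimately show ?thesis by simp
qed

lemma nn_integral_powr_to_inf:
  fixes a e :: real
  assumes "e < -1" "0 < a"
  shows "(\<integral>\<^sup>+x\<in>{a<..}. ennreal (x powr e) \<partial>lborel) = ennreal (a powr (e + 1) / (- e - 1))"
proof -
  have "((\<lambda>x. x powr e) has_integral -(a powr (e+1)) / (e+1)) {a..}"
    using has_integral_powr_to_inf[of e a] assms by simp
  from nn_integral_has_integral_lebesgue'[OF _ this]
  have "(\<integral>\<^sup>+x\<in>{a..}. ennreal (x powr e) \<partial>lborel) = ennreal (-(a powr (e+1)) / (e+1))"
    by simp
  moreover have "(\<integral>\<^sup>+x\<in>{a<..}. ennreal (x powr e) \<partial>lborel) = (\<integral>\<^sup>+x\<in>{a..}. ennreal (x powr e) \<partial>lborel)"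
  proof (rule nn_integral_cong_AE)
    show "AE x in lborel. ennreal (x powr e) * indicator {a<..} x = ennreal (x powr e) * indicator {a..} x"
      using AE_lborel_singleton[of a] by eventually_elim (auto simp: indicator_def)
  qed
  moreover have "-(a powr (e+1)) / (e+1) = a powr (e + 1) / (- e - 1)"
    by (metis add_uminus_conv_diff minus_add_distrib minus_divide_left minus_divide_right)
  ultimately show ?thesis by simp
qed

text \<open>The weight is largest when \<open>E\<close> consists of the points nearest to the boundary. Since at most
  measure \<open>N t\<close> is available at distance below \<open>t\<close>, such an \<open>E\<close> extends to distance \<open>m / N\<close>, and
  its weight is the right-hand side.\<close>

lemma bathtub_powr:
  fixes d :: "real \<Rightarrow> real" and q N m :: real
  assumes q: "0 < q" "q < 1" and N: "0 < N" and m: "0 \<le> m"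
    and E[measurable]: "E \<in> sets borel" and d[measurable]: "d \<in> borel_measurable borel"
    and mE: "emeasure lborel E = ennreal m"
    and pos: "\<And>x. x \<in> E \<Longrightarrow> 0 < d x"
    and distr: "\<And>t. 0 < t \<Longrightarrow> emeasure lborel {x \<in> E. d x < t} \<le> ennreal (N * t)"
  shows "(\<integral>\<^sup>+x\<in>E. ennreal (1 / d x powr q) \<partial>lborel) \<le> ennreal (N powr q * m powr (1 - q) / (1 - q))"
proof (cases "m = 0")
  case True
  then have "AE x in lborel. x \<notin> E" using mE
    by (intro AE_not_in) (auto simp: null_sets_def)
  then have "(\<integral>\<^sup>+x\<in>E. ennreal (1 / d x powr q) \<partial>lborel) = 0"
    by (subst nn_integral_0_iff_AE) (auto elim!: eventually_mono)
  then show ?thesis by simp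
next
  case False
  then have m: "m > 0" using m by simp
  \<comment> \<open>the distance at which the extremal configuration is exhausted\<close>
  define T where "T = m / N"
  have T: "T > 0" using m N by (simp add: T_def)
  \<comment> \<open>write \<open>d powr - q\<close> as \<open>T powr - q\<close> plus an integral
    over \<open>t\<close> from \<open>d\<close> to \<open>T\<close>, so that Tonelli brings in
    the sets \<open>{d < t}\<close>\<close>
  have pt: "ennreal (1 / d x powr q) * indicator E x \<le>
     ennreal (T powr (-q)) * indicator E x +
     (\<integral>\<^sup>+t\<in>{0<..<T}. ennreal (q * t powr (-q-1)) * indicator {x\<in>E. d x < t} x \<partial>lborel)" for x
  proof (cases "x \<in> E")
    case True
    then have dx: "d x > 0" by (rule pos)
    have *: "1 / d x powr q = d x powr (-q)" by (simp add: powr_minus_divide)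
    show ?thesis
    proof (cases "d x < T")
      case False
      then have "d x powr (-q) \<le> T powr (-q)"
        using T q by (intro powr_mono2') auto
      then show ?thesis using True * by (auto intro!: add_increasing2 ennreal_leI)
    next
      case lt: True
      have fi: "((\<lambda>t. q * t powr (-q-1)) has_integral (- (T powr (-q)) - - (d x powr (-q)))) {d x..T}"
        using dx lt q
        by (intro fundamental_theorem_of_calculus)
           (auto simp: has_real_derivative_iff_has_vector_derivative[symmetric] intro!: derivative_eq_intros)
      have "ennreal (1 / d x powr q) = ennreal (T powr (-q)) + ennreal (d x powr (-q) - T powr (-q))"
        using dx lt T q by (subst ennreal_plus[symmetric]) (auto simp: * intro!: powr_mono2')
      also have "ennreal (d x powr (-q) - T powr (-q)) = (\<integral>\<^sup>+t\<in>{d x..T}. ennreal (q * t powr (-q-1)) \<partial>lborel)"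
        using nn_integral_has_integral_lebesgue'[OF _ fi] q by (simp add: algebra_simps)
      also have "\<dots> = (\<integral>\<^sup>+t\<in>{0<..<T}. ennreal (q * t powr (-q-1)) * indicator {x\<in>E. d x < t} x \<partial>lborel)"
      proof (rule nn_integral_cong_AE)
        show "AE t in lborel. ennreal (q * t powr (-q-1)) * indicator {d x..T} t =
           ennreal (q * t powr (-q-1)) * indicator {x\<in>E. d x < t} x * indicator {0<..<T} t"
          using AE_lborel_singleton[of "d x"] AE_lborel_singleton[of T]
          by eventually_elim (use True dx in \<open>auto simp: indicator_def\<close>)
      qed
      finally show ?thesis using True by simp
    qed
  qed simp
  have ms[measurable]: "Measurable.pred (borel \<Otimes>\<^sub>M borel) (\<lambda>z. snd z \<in> E \<and> d (snd z) < fst z)"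
    by measurable
  have "(\<integral>\<^sup>+x\<in>E. ennreal (1 / d x powr q) \<partial>lborel) \<le>
     (\<integral>\<^sup>+x. (ennreal (T powr (-q)) * indicator E x +
     (\<integral>\<^sup>+t\<in>{0<..<T}. ennreal (q * t powr (-q-1)) * indicator {x\<in>E. d x < t} x \<partial>lborel)) \<partial>lborel)"
    by (intro nn_integral_mono pt)
  also have "\<dots> = ennreal (T powr (-q)) * ennreal m +
     (\<integral>\<^sup>+x. (\<integral>\<^sup>+t\<in>{0<..<T}. ennreal (q * t powr (-q-1)) * indicator {x\<in>E. d x < t} x \<partial>lborel) \<partial>lborel)"
    by (subst nn_integral_add) (auto simp: nn_integral_cmult mE)
  also have "(\<integral>\<^sup>+x. (\<integral>\<^sup>+t\<in>{0<..<T}. ennreal (q * t powr (-q-1)) * indicator {x\<in>E. d x < t} x \<partial>lborel) \<partial>lborel)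
     = (\<integral>\<^sup>+t. (\<integral>\<^sup>+x. ennreal (q * t powr (-q-1)) * indicator {x\<in>E. d x < t} x * indicator {0<..<T} t \<partial>lborel) \<partial>lborel)"
    by (rule lborel_pair.Fubini') (simp add: indicator_def split_beta')
  also have "\<dots> = (\<integral>\<^sup>+t\<in>{0<..<T}. ennreal (q * t powr (-q-1)) * emeasure lborel {x\<in>E. d x < t} \<partial>lborel)"
    by (intro nn_integral_cong) (simp add: nn_integral_cmult nn_integral_multc mult.assoc)
  also have "\<dots> \<le> (\<integral>\<^sup>+t\<in>{0<..<T}. ennreal (q * N) * ennreal (t powr (-q)) \<partial>lborel)"
  proof (intro nn_integral_mono)
    fix t :: real
    show "ennreal (q * t powr (-q-1)) * emeasure lborel {x\<in>E. d x < t} * indicator {0<..<T} t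
       \<le> ennreal (q * N) * ennreal (t powr (-q)) * indicator {0<..<T} t"
    proof (cases "0 < t \<and> t < T")
      case True
      have "ennreal (q * t powr (-q-1)) * emeasure lborel {x\<in>E. d x < t} \<le> ennreal (q * t powr (-q-1)) * ennreal (N * t)"
        using True by (intro mult_left_mono distr) auto
      also have "\<dots> = ennreal (q * N * (t powr (-q-1) * t))"
        using True q N by (subst ennreal_mult[symmetric]) (auto simp: algebra_simps)
      also have "t powr (-q-1) * t = t powr (-q)"
        using True powr_mult_base[of t "-q-1"] by (simp add: algebra_simps)
      finally show ?thesis using True q N by (simp add: ennreal_mult)
    qed auto
  qed
  also have "\<dots> = ennreal (q * N) * ennreal (T powr (1-q) / (1-q))"
    using nn_integral_powr_from_0[of "-q" T] q T by (simp add: nn_integral_cmult mult.assoc)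
  also have "ennreal (T powr (-q)) * ennreal m + ennreal (q * N) * ennreal (T powr (1-q) / (1-q))
     = ennreal (T powr (-q) * m + q * N * (T powr (1-q) / (1-q)))"
    using q N m T by (simp add: ennreal_mult[symmetric] ennreal_plus[symmetric] del: ennreal_plus)
  also have "T powr (-q) * m + q * N * (T powr (1-q) / (1-q)) = N powr q * m powr (1 - q) / (1 - q)"
  proof -
    have A: "T powr (-q) * m = N * T powr (1-q)"
    proof -
      have "m = N * T" using N by (simp add: T_def)
      moreover have "T powr (-q) * T = T powr (1-q)" using T powr_mult_base[of T "-q"] by (simp add: algebra_simps)
      ultimately show ?thesis by (simp add: algebra_simps)
    qed
    have B: "N * T powr (1-q) = N powr q * m powr (1-q)"
    proof -
      have "N powr q * N powr (1-q) = N" using N by (simp add: powr_add[symmetric])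
      then have "N * T powr (1-q) = N powr q * (N powr (1-q) * T powr (1-q))"
        by (simp only: mult.assoc[symmetric])
      also have "N powr (1-q) * T powr (1-q) = m powr (1-q)"
        using N m by (simp add: T_def powr_divide)
      finally show ?thesis .
    qed
    have "N * T powr (1-q) + q * N * (T powr (1-q) / (1-q)) = (N * T powr (1-q)) * (1 + q / (1-q))"
      by (simp add: distrib_left mult.assoc mult.left_commute)
    also have "1 + q / (1-q) = 1 / (1-q)" using q by (simp add: field_simps)
    finally show ?thesis unfolding A B by simp
  qed
  finally show ?thesis by (simp add: add_left_mono)
qed

section \<open>A Riesz inequality for two sets on the line\<close>

definition pairs_closer :: "real \<Rightarrow> real set \<Rightarrow> real set \<Rightarrow> ennreal" where
  "pairs_closer r A B = (\<integral>\<^sup>+x. (\<integral>\<^sup>+y. indicator A x * indicator B y * indicator {-r<..<r} (x - y) \<partial>lborel) \<partial>lborel)"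

definition pairs_apart :: "real \<Rightarrow> real set \<Rightarrow> real set \<Rightarrow> ennreal" where
  "pairs_apart r A B = (\<integral>\<^sup>+x. (\<integral>\<^sup>+y. indicator A x * indicator B y * indicator (- {-r<..<r}) (x - y) \<partial>lborel) \<partial>lborel)"

definition centered :: "real \<Rightarrow> real set" where
  "centered m = {- (m / 2) <..< m / 2}"

lemma centered_borel[measurable]: "centered m \<in> sets borel"
  by (simp add: centered_def)

lemma emeasure_centered: "0 \<le> m \<Longrightarrow> emeasure lborel (centered m) = ennreal m"
  by (simp add: centered_def)

lemma pairs_closer_eq_emeasure:
  assumes [measurable]: "A \<in> sets borel" "B \<in> sets borel"
  shows "pairs_closer r A B = (\<integral>\<^sup>+x\<in>A. emeasure lborel (B \<inter> {x - r<..<x + r}) \<partial>lborel)"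
  unfolding pairs_closer_def
proof (intro nn_integral_cong)
  fix x :: real
  have "(\<integral>\<^sup>+y. indicator A x * indicator B y * indicator {-r<..<r} (x - y) \<partial>lborel)
     = (\<integral>\<^sup>+y. indicator A x * indicator (B \<inter> {x - r<..<x + r}) y \<partial>lborel)"
    by (intro nn_integral_cong) (auto simp: indicator_def)
  also have "\<dots> = indicator A x * emeasure lborel (B \<inter> {x - r<..<x + r})"
    by (simp add: nn_integral_cmult)
  finally show "(\<integral>\<^sup>+y. indicator A x * indicator B y * indicator {-r<..<r} (x - y) \<partial>lborel)
     = emeasure lborel (B \<inter> {x - r<..<x + r}) * indicator A x" by (simp add: mult.commute)
qed

lemma pairs_apart_eq_emeasure:
  assumes [measurable]: "A \<in> sets borel" "B \<in> sets borel"
  shows "pairs_apart r A B = (\<integral>\<^sup>+x\<in>A. emeasure lborel (B - {x - r<..<x + r}) \<partial>lborel)"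
  unfolding pairs_apart_def
proof (intro nn_integral_cong)
  fix x :: real
  have "(\<integral>\<^sup>+y. indicator A x * indicator B y * indicator (-{-r<..<r}) (x - y) \<partial>lborel)
     = (\<integral>\<^sup>+y. indicator A x * indicator (B - {x - r<..<x + r}) y \<partial>lborel)"
    by (intro nn_integral_cong) (auto simp: indicator_def)
  also have "\<dots> = indicator A x * emeasure lborel (B - {x - r<..<x + r})"
    by (simp add: nn_integral_cmult)
  finally show "(\<integral>\<^sup>+y. indicator A x * indicator B y * indicator (-{-r<..<r}) (x - y) \<partial>lborel)
     = emeasure lborel (B - {x - r<..<x + r}) * indicator A x" by (simp add: mult.commute)
qed

lemma measurable_slice[measurable]:
  assumes [measurable]: "B \<in> sets borel"
  shows "(\<lambda>x::real. emeasure lborel (B \<inter> {x - r<..<x + r})) \<in> borel_measurable borel"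
    and "(\<lambda>x::real. emeasure lborel (B - {x - r<..<x + r})) \<in> borel_measurable borel"
    and "(\<lambda>x::real. emeasure lborel (B \<inter> {x + r..})) \<in> borel_measurable borel"
    and "(\<lambda>x::real. emeasure lborel (B \<inter> {..x - r})) \<in> borel_measurable borel"
proof -
  have "(\<lambda>x. \<integral>\<^sup>+y. indicator B y * indicator {-r<..<r} (x - y) \<partial>lborel) \<in> borel_measurable borel"
    by measurable
  also have "(\<lambda>x. \<integral>\<^sup>+y. indicator B y * indicator {-r<..<r} (x - y) \<partial>lborel)
     = (\<lambda>x. \<integral>\<^sup>+y. indicator (B \<inter> {x - r<..<x + r}) y \<partial>lborel)"
    by (intro ext nn_integral_cong) (auto simp: indicator_def)
  finally show "(\<lambda>x::real. emeasure lborel (B \<inter> {x - r<..<x + r})) \<in> borel_measurable borel" by simp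
  have "(\<lambda>x. \<integral>\<^sup>+y. indicator B y * indicator (-{-r<..<r}) (x - y) \<partial>lborel) \<in> borel_measurable borel"
    by measurable
  also have "(\<lambda>x. \<integral>\<^sup>+y. indicator B y * indicator (-{-r<..<r}) (x - y) \<partial>lborel)
     = (\<lambda>x. \<integral>\<^sup>+y. indicator (B - {x - r<..<x + r}) y \<partial>lborel)"
    by (intro ext nn_integral_cong) (auto simp: indicator_def)
  finally show "(\<lambda>x::real. emeasure lborel (B - {x - r<..<x + r})) \<in> borel_measurable borel" by simp
  have "(\<lambda>x. \<integral>\<^sup>+y. indicator B y * indicator {..-r} (x - y) \<partial>lborel) \<in> borel_measurable borel"
    by measurable
  also have "(\<lambda>x. \<integral>\<^sup>+y. indicator B y * indicator {..-r} (x - y) \<partial>lborel)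
     = (\<lambda>x. \<integral>\<^sup>+y. indicator (B \<inter> {x + r..}) y \<partial>lborel)"
    by (intro ext nn_integral_cong) (auto simp: indicator_def)
  finally show "(\<lambda>x::real. emeasure lborel (B \<inter> {x + r..})) \<in> borel_measurable borel" by simp
  have "(\<lambda>x. \<integral>\<^sup>+y. indicator B y * indicator {r..} (x - y) \<partial>lborel) \<in> borel_measurable borel"
    by measurable
  also have "(\<lambda>x. \<integral>\<^sup>+y. indicator B y * indicator {r..} (x - y) \<partial>lborel)
     = (\<lambda>x. \<integral>\<^sup>+y. indicator (B \<inter> {..x - r}) y \<partial>lborel)"
    by (intro ext nn_integral_cong) (auto simp: indicator_def)
  finally show "(\<lambda>x::real. emeasure lborel (B \<inter> {..x - r})) \<in> borel_measurable borel" by simp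
qed

lemma pairs_closer_plus_apart:
  assumes [measurable]: "A \<in> sets borel" "B \<in> sets borel"
  shows "pairs_closer r A B + pairs_apart r A B = emeasure lborel A * emeasure lborel B"
proof -
  have "pairs_closer r A B + pairs_apart r A B = (\<integral>\<^sup>+x. emeasure lborel (B \<inter> {x - r<..<x + r}) * indicator A x +
        emeasure lborel (B - {x - r<..<x + r}) * indicator A x \<partial>lborel)"
    by (simp add: pairs_closer_eq_emeasure pairs_apart_eq_emeasure nn_integral_add)
  also have "\<dots> = (\<integral>\<^sup>+x. emeasure lborel B * indicator A x \<partial>lborel)"
  proof (intro nn_integral_cong)
    fix x :: real
    have "emeasure lborel (B \<inter> {x - r<..<x + r}) + emeasure lborel (B - {x - r<..<x + r}) = emeasure lborel B"
      by (subst plus_emeasure) (auto intro: arg_cong[where f="emeasure lborel"])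
    then show "emeasure lborel (B \<inter> {x - r<..<x + r}) * indicator A x +
        emeasure lborel (B - {x - r<..<x + r}) * indicator A x = emeasure lborel B * indicator A x"
      by (metis distrib_right)
  qed
  also have "\<dots> = emeasure lborel A * emeasure lborel B"
    by (subst nn_integral_cmult) (auto simp: mult.commute)
  finally show ?thesis .
qed

lemma pairs_closer_compl:
  assumes [measurable]: "A \<in> sets borel" "B \<in> sets borel" and r: "0 \<le> r"
  shows "pairs_closer r A (- B) + pairs_closer r A B = ennreal (2 * r) * emeasure lborel A"
proof -
  have "pairs_closer r A (-B) + pairs_closer r A B = (\<integral>\<^sup>+x. emeasure lborel (-B \<inter> {x - r<..<x + r}) * indicator A x +
        emeasure lborel (B \<inter> {x - r<..<x + r}) * indicator A x \<partial>lborel)"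
    by (simp add: pairs_closer_eq_emeasure nn_integral_add)
  also have "\<dots> = (\<integral>\<^sup>+x. ennreal (2 * r) * indicator A x \<partial>lborel)"
  proof (intro nn_integral_cong)
    fix x :: real
    have "emeasure lborel (-B \<inter> {x - r<..<x + r}) + emeasure lborel (B \<inter> {x - r<..<x + r}) = emeasure lborel {x - r<..<x + r}"
      by (subst plus_emeasure) (auto intro: arg_cong[where f="emeasure lborel"])
    also have "\<dots> = ennreal (2 * r)" using r by simp
    finally show "emeasure lborel (-B \<inter> {x - r<..<x + r}) * indicator A x +
        emeasure lborel (B \<inter> {x - r<..<x + r}) * indicator A x = ennreal (2 * r) * indicator A x"
      by (metis distrib_right)
  qed
  also have "\<dots> = ennreal (2 * r) * emeasure lborel A"
    by (simp add: nn_integral_cmult)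
  finally show ?thesis .
qed

lemma pairs_closer_compl_apart:
  assumes [measurable]: "A \<in> sets borel" "B \<in> sets borel" and r: "0 \<le> r"
    and mA: "emeasure lborel A < \<infinity>" and mB: "emeasure lborel B < \<infinity>"
  shows "pairs_closer r A (- B) + emeasure lborel A * emeasure lborel B
       = ennreal (2 * r) * emeasure lborel A + pairs_apart r A B"
  using pairs_closer_plus_apart[of A B r] pairs_closer_compl[of A B r] r
  by (simp add: add.assoc[symmetric]) (metis add.assoc add.commute assms(1) assms(2))

definition mass_below :: "real set \<Rightarrow> real \<Rightarrow> real" where
  "mass_below A x = measure lborel (A \<inter> {..x})"

lemma
  fixes A :: "real set"
  assumes A[measurable]: "A \<in> sets borel" and mA: "emeasure lborel A = ennreal a" and a: "0 \<le> a"
  shows mass_below_mono: "x \<le> y \<Longrightarrow> mass_below A x \<le> mass_below A y"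
    and mass_below_lipschitz: "x \<le> y \<Longrightarrow> mass_below A y - mass_below A x \<le> y - x"
    and mass_below_above: "measure lborel (A \<inter> {x<..}) = a - mass_below A x"
    and mass_below_le: "mass_below A x \<le> a"
    and isCont_mass_below: "isCont (mass_below A) x"
    and mass_below_at_top: "(mass_below A \<longlongrightarrow> a) at_top"
    and mass_below_at_bot: "(mass_below A \<longlongrightarrow> 0) at_bot"
proof -
  have fm: "S \<subseteq> A \<Longrightarrow> S \<in> sets borel \<Longrightarrow> S \<in> fmeasurable lborel" for S
    using mA le_less_trans[OF emeasure_mono[of S A lborel], of \<infinity>] by (auto simp: fmeasurable_def)
  have diff: "mass_below A y - mass_below A x = measure lborel (A \<inter> {x<..y})" if "x \<le> y" for x y
  proof -
    have "measure lborel (A \<inter> {..y}) = measure lborel (A \<inter> {..x}) + measure lborel (A \<inter> {x<..y})"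
      using that by (subst measure_Un_AE[symmetric]) (auto intro!: fm arg_cong[where f="measure lborel"])
    then show ?thesis by (simp add: mass_below_def)
  qed
  show "x \<le> y \<Longrightarrow> mass_below A x \<le> mass_below A y" using diff[of x y] by (smt (verit) measure_nonneg)
  have lip: "mass_below A y - mass_below A x \<le> y - x" if "x \<le> y" for x y
  proof -
    have "measure lborel (A \<inter> {x<..y}) \<le> measure lborel {x<..y}"
      using that by (intro measure_mono_fmeasurable) (auto intro!: fmeasurableI)
    then show ?thesis using diff[OF that] that by simp
  qed
  then show "x \<le> y \<Longrightarrow> mass_below A y - mass_below A x \<le> y - x" .
  have mAr: "measure lborel A = a" using mA a by (simp add: measure_def)
  show "measure lborel (A \<inter> {x<..}) = a - mass_below A x"
  proof -
    have "measure lborel A = measure lborel (A \<inter> {..x}) + measure lborel (A \<inter> {x<..})"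
      by (subst measure_Un_AE[symmetric]) (auto intro!: fm arg_cong[where f="measure lborel"])
    then show ?thesis using mAr by (simp add: mass_below_def)
  qed
  then show "mass_below A x \<le> a" by (smt (verit) measure_nonneg)
  have lip2: "\<bar>mass_below A y - mass_below A x\<bar> \<le> \<bar>y - x\<bar>" for x y
    using lip[of x y] lip[of y x] diff[of x y] diff[of y x]
    by (smt (verit) measure_nonneg)
  have "continuous_on UNIV (mass_below A)"
    by (rule continuous_on_iff[THEN iffD2]) (metis dist_real_def le_less_trans lip2)
  then show "isCont (mass_below A) x" by (simp add: continuous_on_eq_continuous_at)
  interpret fm: finite_measure "density lborel (indicator A)"
    by standard (simp add: emeasure_density mA)
  have fb: "finite_borel_measure (density lborel (indicator A))"
    by standard simp
  have cdf: "cdf (density lborel (indicator A)) = mass_below A"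
  proof
    fix x
    have "(\<integral>\<^sup>+ t. indicator A t * indicator {..x} t \<partial>lborel) = (\<integral>\<^sup>+ t. indicator (A \<inter> {..x}) t \<partial>lborel)"
      by (intro nn_integral_cong) (auto simp: indicator_def)
    then show "cdf (density lborel (indicator A)) x = mass_below A x"
      by (simp add: cdf_def mass_below_def measure_def emeasure_density)
  qed
  have "measure (density lborel (indicator A)) UNIV = a"
    using a by (simp add: measure_def emeasure_density mA)
  then show "(mass_below A \<longlongrightarrow> a) at_top"
    using finite_borel_measure.cdf_lim_at_top[OF fb] cdf by simp
  show "(mass_below A \<longlongrightarrow> 0) at_bot"
    using finite_borel_measure.cdf_lim_at_bot[OF fb] cdf by simp
qed

lemma mass_below_attains:
  fixes A :: "real set"
  assumes A: "A \<in> sets borel" and mA: "emeasure lborel A = ennreal a" and xi: "0 < \<xi>" "\<xi> < a"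
  shows "\<exists>x. mass_below A x = \<xi>"
proof -
  have a: "0 \<le> a" using xi by simp
  note MB = mass_below_mono[OF A mA a] isCont_mass_below[OF A mA a] mass_below_at_top[OF A mA a] mass_below_at_bot[OF A mA a]
  have "eventually (\<lambda>x. mass_below A x > \<xi>) at_top"
    using order_tendstoD(1)[OF MB(3) xi(2)] .
  then obtain y where y: "mass_below A y > \<xi>" by (auto simp: eventually_at_top_linorder)
  have "eventually (\<lambda>x. mass_below A x < \<xi>) at_bot"
    using order_tendstoD(2)[OF MB(4) xi(1)] .
  then obtain x where x: "mass_below A x < \<xi>" by (auto simp: eventually_at_bot_linorder)
  have "x \<le> y" using MB(1)[of y x] x y by linarith
  then show ?thesis
    using IVT[of "mass_below A" x \<xi> y] x y MB(2) by auto
qed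

text \<open>A quantile function of \<open>A\<close> carries the uniform measure of \<open>(0, a)\<close> to the restriction of
  Lebesgue measure to \<open>A\<close>; it suffices to compare the two on half-lines.\<close>

lemma nn_integral_quantile:
  fixes A :: "real set" and X :: "real \<Rightarrow> real"
  assumes A[measurable]: "A \<in> sets borel" and mA: "emeasure lborel A = ennreal a" and a: "0 < a"
    and X: "\<And>\<xi>. 0 < \<xi> \<Longrightarrow> \<xi> < a \<Longrightarrow> mass_below A (X \<xi>) = \<xi>"
    and X'[measurable]: "X \<in> borel_measurable borel"
    and g[measurable]: "g \<in> borel_measurable borel"
  shows "(\<integral>\<^sup>+x\<in>A. g x \<partial>lborel) = (\<integral>\<^sup>+\<xi>\<in>{0<..<a}. g (X \<xi>) \<partial>lborel)"
proof -
  have a0: "0 \<le> a" using a by simp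
  note MB = mass_below_mono[OF A mA a0] mass_below_above[OF A mA a0] mass_below_le[OF A mA a0]
  let ?M = "distr (density lborel (indicator {0<..<a})) borel X"
  let ?N = "density lborel (indicator A)"
  have "?N = ?M"
  proof (rule measure_eqI_lessThan)
    fix z :: real
    have N: "emeasure ?N {z<..} = ennreal (a - mass_below A z)"
    proof -
      have "emeasure ?N {z<..} = emeasure lborel (A \<inter> {z<..})"
        by (subst emeasure_density) (auto simp: nn_integral_indicator[symmetric] indicator_inter_arith[symmetric] simp del: nn_integral_indicator)
      also have "\<dots> = ennreal (measure lborel (A \<inter> {z<..}))"
        using mA emeasure_mono[of "A \<inter> {z<..}" A lborel]
        by (intro emeasure_eq_ennreal_measure) (auto simp: top_unique)
      finally show ?thesis using MB(2) by simp
    qed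
    then show "emeasure ?N {z<..} < \<infinity>" by simp
    have S[measurable]: "{\<xi>. 0 < \<xi> \<and> \<xi> < a \<and> z < X \<xi>} \<in> sets borel" by measurable
    have "emeasure ?M {z<..} = emeasure lborel {\<xi>. 0 < \<xi> \<and> \<xi> < a \<and> z < X \<xi>}"
      by (subst emeasure_distr, simp, simp, subst emeasure_density)
        (auto simp: measurable_sets_borel[OF X'] nn_integral_indicator[symmetric] indicator_def simp del: nn_integral_indicator intro!: nn_integral_cong)
    also have "\<dots> = ennreal (a - mass_below A z)"
    proof (rule antisym)
      have "{\<xi>. 0 < \<xi> \<and> \<xi> < a \<and> z < X \<xi>} \<subseteq> {mass_below A z..a}"
        using X by (auto simp: less_imp_le) (metis MB(1) X less_imp_le)
      from emeasure_mono[OF this, of lborel]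
      show "emeasure lborel {\<xi>. 0 < \<xi> \<and> \<xi> < a \<and> z < X \<xi>} \<le> ennreal (a - mass_below A z)"
        using MB(3)[of z] by simp
      have "{mass_below A z<..<a} \<subseteq> {\<xi>. 0 < \<xi> \<and> \<xi> < a \<and> z < X \<xi>}"
      proof
        fix \<xi> assume "\<xi> \<in> {mass_below A z<..<a}"
        moreover have "0 \<le> mass_below A z" by (simp add: mass_below_def)
        ultimately have *: "0 < \<xi>" "\<xi> < a" "mass_below A z < \<xi>" by auto
        then have "\<not> X \<xi> \<le> z" using X[OF *(1,2)] MB(1)[of "X \<xi>" z] by auto
        then show "\<xi> \<in> {\<xi>. 0 < \<xi> \<and> \<xi> < a \<and> z < X \<xi>}" using * by auto
      qed
      from emeasure_mono[OF this, of lborel]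
      show "ennreal (a - mass_below A z) \<le> emeasure lborel {\<xi>. 0 < \<xi> \<and> \<xi> < a \<and> z < X \<xi>}"
        using MB(3)[of z] by simp
    qed
    finally show "emeasure ?N {z<..} = emeasure ?M {z<..}" using N by simp
  qed auto
  then have "integral\<^sup>N ?N g = integral\<^sup>N ?M g" by simp
  then show ?thesis
    by (simp add: nn_integral_density nn_integral_distr mult.commute)
qed

lemma quantile_exists:
  fixes A :: "real set"
  assumes A[measurable]: "A \<in> sets borel" and mA: "emeasure lborel A = ennreal a"
  obtains X where "\<And>\<xi>. 0 < \<xi> \<Longrightarrow> \<xi> < a \<Longrightarrow> mass_below A (X \<xi>) = \<xi>"
    and "X \<in> borel_measurable borel"
proof -
  define Y where "Y \<xi> = (SOME x. mass_below A x = \<xi>)" for \<xi>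
  have Y: "mass_below A (Y \<xi>) = \<xi>" if "0 < \<xi>" "\<xi> < a" for \<xi>
    unfolding Y_def using mass_below_attains[OF A mA that] by (rule someI_ex)
  define X where "X \<xi> = indicator {0<..<a} \<xi> * Y \<xi>" for \<xi>
  have "mono_on {0<..<a} Y"
  proof (rule mono_onI)
    fix r s assume *: "r \<in> {0<..<a}" "s \<in> {0<..<a}" "r \<le> s"
    show "Y r \<le> Y s"
    proof (rule ccontr)
      assume "\<not> Y r \<le> Y s"
      then have "mass_below A (Y s) \<le> mass_below A (Y r)" "Y s < Y r"
        using mass_below_mono[OF A mA, of "Y s" "Y r"] * by auto
      then show False using Y[of r] Y[of s] * by force
    qed
  qed
  then have "Y \<in> borel_measurable (restrict_space borel {0<..<a})"
    by (rule borel_measurable_mono_on_fnc)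
  then have "X \<in> borel_measurable borel"
    by (subst (asm) borel_measurable_restrict_space_iff) (auto simp: X_def[abs_def])
  then show ?thesis using Y by (intro that[of X]) (auto simp: X_def)
qed

text \<open>The heart of the Riesz inequality. Parametrise \<open>A\<close> increasingly by mass, and pair the point at
  mass \<open>i < t\<close> from the left end with the point at mass \<open>a - t + i\<close>. The second point lies at least
  \<open>a - t\<close> further to the right, so the part of \<open>B\<close> to the right of the first point by \<open>r\<close> or more and
  the part to the left of the second point by \<open>r\<close> or more miss at most \<open>(2 r - (a - t))\<^sub>+\<close> of \<open>B\<close>.
  Together they have mass at least \<open>t\<close>, since \<open>t \<le> b\<close> and \<open>b - 2 r + a - t = t\<close>. Integrating over \<open>i\<close> gives \<open>t * t\<close>.\<close>

lemma pairs_apart_lower: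
  assumes A[measurable]: "A \<in> sets borel" and B[measurable]: "B \<in> sets borel"
    and mA: "emeasure lborel A = ennreal a" and mB: "emeasure lborel B = ennreal b"
    and r: "0 < r" and t: "t = (a + b) / 2 - r" and t0: "0 \<le> t" and ta: "t \<le> a" and tb: "t \<le> b"
  shows "ennreal (t\<^sup>2) \<le> pairs_apart r A B"
proof (cases "t = 0")
  case False
  with t0 ta tb have pos: "0 < t" "0 < a" "0 < b" by auto
  obtain X where X: "\<And>\<xi>. 0 < \<xi> \<Longrightarrow> \<xi> < a \<Longrightarrow> mass_below A (X \<xi>) = \<xi>"
    and [measurable]: "X \<in> borel_measurable borel" using quantile_exists[OF A mA] by metis
  define gr where "gr x = emeasure lborel (B \<inter> {x + r..})" for x
  define gl where "gl x = emeasure lborel (B \<inter> {..x - r})" for x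
  have [measurable]: "gr \<in> borel_measurable borel" "gl \<in> borel_measurable borel"
    unfolding gr_def gl_def by measurable
  have a0: "0 \<le> a" using pos by simp
  have pt: "ennreal t \<le> gr (X i) + gl (X (a - t + i))" if i: "0 < i" "i < t" for i
  proof -
    define x x' where "x = X i" and "x' = X (a - t + i)"
    have m: "mass_below A x = i" "mass_below A x' = a - t + i"
      unfolding x_def x'_def using i ta by (auto intro!: X)
    have le: "x \<le> x'"
    proof (cases "t = a")
      case False
      then show ?thesis using mass_below_mono[OF A mA a0, of x' x] m ta by (cases "x \<le> x'") auto
    qed (simp add: x_def x'_def)
    \<comment> \<open>mass grows at most as fast as position\<close>
    have gap: "a - t \<le> x' - x" using mass_below_lipschitz[OF A mA a0 le] m by simp
    have "ennreal b \<le> emeasure lborel ((B \<inter> {x + r..}) \<union> (B \<inter> {..x' - r}) \<union> {x' - r<..<x + r})"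
      unfolding mB[symmetric] by (rule emeasure_mono) auto
    also have "\<dots> \<le> emeasure lborel ((B \<inter> {x + r..}) \<union> (B \<inter> {..x' - r})) + emeasure lborel {x' - r<..<x + r}"
      by (rule emeasure_subadditive) auto
    also have "\<dots> \<le> gr x + gl x' + ennreal (max 0 (b - t))"
    proof (intro add_mono)
      show "emeasure lborel ((B \<inter> {x + r..}) \<union> (B \<inter> {..x' - r})) \<le> gr x + gl x'"
        unfolding gr_def gl_def by (rule emeasure_subadditive) auto
      have "emeasure lborel {x' - r<..<x + r} \<le> ennreal (max 0 (x + r - (x' - r)))"
        by (cases "x' - r \<le> x + r") auto
      also have "\<dots> \<le> ennreal (max 0 (b - t))"
        by (rule ennreal_leI) (use gap t in argo)
      finally show "emeasure lborel {x' - r<..<x + r} \<le> ennreal (max 0 (b - t))" .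
    qed
    finally have "ennreal b \<le> gr x + gl x' + ennreal (b - t)" using tb by simp
    moreover have "ennreal b = ennreal t + ennreal (b - t)"
      using tb t0 by (simp add: ennreal_plus[symmetric] del: ennreal_plus)
    ultimately have "ennreal t + ennreal (b - t) \<le> gr x + gl x' + ennreal (b - t)" by simp
    then show ?thesis
      unfolding x_def x'_def by (simp add: add.commute[of _ "ennreal (b - t)"])
  qed
  have "ennreal (t\<^sup>2) = (\<integral>\<^sup>+i\<in>{0<..<t}. ennreal t \<partial>lborel)"
    using pos by (simp add: nn_integral_cmult power2_eq_square ennreal_mult)
  also have "\<dots> \<le> (\<integral>\<^sup>+i. gr (X i) * indicator {0<..<t} i + gl (X (a - t + i)) * indicator {0<..<t} i \<partial>lborel)"
    by (intro nn_integral_mono) (auto simp: indicator_def pt)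
  also have "\<dots> = (\<integral>\<^sup>+i. gr (X i) * indicator {0<..<t} i \<partial>lborel) + (\<integral>\<^sup>+i. gl (X (a - t + i)) * indicator {0<..<t} i \<partial>lborel)"
    by (intro nn_integral_add) auto
  also have "(\<integral>\<^sup>+i. gl (X (a - t + i)) * indicator {0<..<t} i \<partial>lborel)
      = (\<integral>\<^sup>+i. gl (X i) * indicator {a - t<..<a} i \<partial>lborel)"
    by (subst (2) nn_integral_real_affine[where c=1 and t="a - t"]) (auto simp: indicator_def intro!: nn_integral_cong)
  also have "\<dots> \<le> (\<integral>\<^sup>+i\<in>{0<..<a}. gl (X i) \<partial>lborel)"
    using ta by (intro nn_integral_mono) (auto simp: indicator_def)
  also have "(\<integral>\<^sup>+i. gr (X i) * indicator {0<..<t} i \<partial>lborel) \<le> (\<integral>\<^sup>+i\<in>{0<..<a}. gr (X i) \<partial>lborel)"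
    using ta by (intro nn_integral_mono) (auto simp: indicator_def)
  also have "(\<integral>\<^sup>+i\<in>{0<..<a}. gr (X i) \<partial>lborel) + (\<integral>\<^sup>+i\<in>{0<..<a}. gl (X i) \<partial>lborel)
     = (\<integral>\<^sup>+x\<in>A. gr x \<partial>lborel) + (\<integral>\<^sup>+x\<in>A. gl x \<partial>lborel)"
    by (simp add: nn_integral_quantile[OF A mA pos(2) X])
  also have "\<dots> = (\<integral>\<^sup>+x. gr x * indicator A x + gl x * indicator A x \<partial>lborel)"
    by (intro nn_integral_add[symmetric]) auto
  also have "\<dots> \<le> pairs_apart r A B"
    unfolding pairs_apart_eq_emeasure[OF A B]
  proof (intro nn_integral_mono)
    fix x :: real
    have "gr x + gl x = emeasure lborel ((B \<inter> {x + r..}) \<union> (B \<inter> {..x - r}))"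
      unfolding gr_def gl_def using r by (intro plus_emeasure) auto
    also have "\<dots> \<le> emeasure lborel (B - {x - r<..<x + r})"
      by (intro emeasure_mono) (use r in auto)
    finally show "gr x * indicator A x + gl x * indicator A x \<le> emeasure lborel (B - {x - r<..<x + r}) * indicator A x"
      by (metis distrib_right mult_right_mono zero_le)
  qed
  finally show ?thesis by (simp add: add_left_mono add_right_mono)
qed simp

lemma nn_integral_pos_part_linear:
  assumes "0 \<le> t"
  shows "(\<integral>\<^sup>+x\<in>{0..}. ennreal (t - x) \<partial>lborel) = ennreal (t\<^sup>2 / 2)"
proof -
  have "((\<lambda>x. t - x) has_integral ((t * t - t\<^sup>2/2) - (t * 0 - 0\<^sup>2/2))) {0..t}"
    by (rule fundamental_theorem_of_calculus)
      (use assms in \<open>auto simp: has_real_derivative_iff_has_vector_derivative[symmetric] intro!: derivative_eq_intros\<close>)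
  then have "(\<integral>\<^sup>+x\<in>{0..t}. ennreal (t - x) \<partial>lborel) = ennreal ((t * t - t\<^sup>2/2) - (t * 0 - 0\<^sup>2/2))"
    by (intro nn_integral_has_integral_lebesgue') auto
  moreover have "(\<integral>\<^sup>+x\<in>{0..}. ennreal (t - x) \<partial>lborel) = (\<integral>\<^sup>+x\<in>{0..t}. ennreal (t - x) \<partial>lborel)"
    by (intro nn_integral_cong) (auto simp: indicator_def ennreal_neg)
  ultimately show ?thesis by (simp add: power2_eq_square)
qed

text \<open>For centred intervals the pairs at distance at least \<open>r\<close> fit into two right triangles with legs
  \<open>t\<close>, so their measure is no more than the lower bound that holds for general sets.\<close>

lemma pairs_apart_centered:
  assumes a: "0 \<le> a" and b: "0 \<le> b" and r: "0 < r" and t: "t = max 0 ((a + b) / 2 - r)"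
  shows "pairs_apart r (centered a) (centered b) \<le> ennreal (t\<^sup>2)"
proof -
  have t0: "0 \<le> t" by (simp add: t)
  have pt: "emeasure lborel (centered b - {x - r<..<x + r}) * indicator (centered a) x
      \<le> ennreal (t - (x + a / 2)) * indicator {0..} (x + a / 2)
       + ennreal (t - (a / 2 - x)) * indicator {0..} (a / 2 - x)" for x
  proof (cases "x \<in> centered a")
    case True
    then have x: "-a/2 < x" "x < a/2" by (auto simp: centered_def)
    have t1: "(a + b) / 2 - r \<le> t" unfolding t by (rule max.cobounded2)
    have "emeasure lborel (centered b - {x - r<..<x + r}) \<le> emeasure lborel ({x + r..<b/2} \<union> {-b/2<..x-r})"
      by (intro emeasure_mono) (auto simp: centered_def)
    also have "\<dots> \<le> emeasure lborel {x + r..<b/2} + emeasure lborel {-b/2<..x-r}"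
      by (rule emeasure_subadditive) auto
    also have "emeasure lborel {x + r..<b/2} \<le> ennreal (t - (x + a/2))"
      using t1 by (cases "x + r \<le> b/2") (auto intro!: ennreal_leI simp: field_simps)
    also have "emeasure lborel {-b/2<..x-r} \<le> ennreal (t - (a/2 - x))"
    proof (cases "-b/2 \<le> x - r")
      case True
      then show ?thesis using t1 by (auto intro!: ennreal_leI simp: field_simps)
    next
      case False
      then have "{-b/2<..x-r} = {}" by auto
      then show ?thesis by simp
    qed
    finally show ?thesis using True x by (simp add: add_left_mono add_right_mono)
  qed simp
  have "pairs_apart r (centered a) (centered b) \<le>
    (\<integral>\<^sup>+x. ennreal (t - (x + a / 2)) * indicator {0..} (x + a / 2)
       + ennreal (t - (a / 2 - x)) * indicator {0..} (a / 2 - x) \<partial>lborel)"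
    by (subst pairs_apart_eq_emeasure) (auto intro!: nn_integral_mono pt)
  also have "\<dots> = (\<integral>\<^sup>+x. ennreal (t - (x + a / 2)) * indicator {0..} (x + a / 2) \<partial>lborel)
       + (\<integral>\<^sup>+x. ennreal (t - (a / 2 - x)) * indicator {0..} (a / 2 - x) \<partial>lborel)"
    by (intro nn_integral_add) auto
  also have "(\<integral>\<^sup>+x. ennreal (t - (x + a / 2)) * indicator {0..} (x + a / 2) \<partial>lborel) = ennreal (t\<^sup>2 / 2)"
    using nn_integral_pos_part_linear[OF t0]
    by (subst (asm) nn_integral_real_affine[where c=1 and t="a/2"]) (auto simp: add.commute)
  also have "(\<integral>\<^sup>+x. ennreal (t - (a / 2 - x)) * indicator {0..} (a / 2 - x) \<partial>lborel) = ennreal (t\<^sup>2 / 2)"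
    using nn_integral_pos_part_linear[OF t0]
    by (subst (asm) nn_integral_real_affine[where c="-1" and t="a/2"]) (auto simp: add.commute)
  finally show ?thesis by (simp add: ennreal_plus[symmetric] del: ennreal_plus)
qed

text \<open>Counting pairs with the second point outside \<open>B\<close> keeps all quantities finite and is what the
  layers of the seminorm need. It differs from the number of pairs at distance at least \<open>r\<close> by terms
  that only involve the measures of the two sets.\<close>

theorem riesz_centered:
  assumes A[measurable]: "A \<in> sets borel" and B[measurable]: "B \<in> sets borel"
    and mA: "emeasure lborel A = ennreal a" and mB: "emeasure lborel B = ennreal b"
    and a: "0 \<le> a" and ab: "a \<le> b" and r: "0 < r"
  shows "pairs_closer r (centered a) (- centered b) \<le> pairs_closer r A (- B)"
proof (cases "2 * r \<le> b - a")
  case True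
  have "pairs_closer r (centered a) (- centered b) = (\<integral>\<^sup>+x\<in>centered a. 0 \<partial>lborel)"
    unfolding pairs_closer_eq_emeasure[OF centered_borel borel_comp[OF centered_borel]]
  proof (intro nn_integral_cong)
    fix x :: real
    have "x \<in> centered a \<Longrightarrow> - centered b \<inter> {x - r<..<x + r} = {}"
      using True by (auto simp: centered_def)
    then show "emeasure lborel (- centered b \<inter> {x - r<..<x + r}) * indicator (centered a) x = 0 * indicator (centered a) x"
      by (auto simp: indicator_def)
  qed
  then show ?thesis by simp
next
  case False
  define t where "t = max 0 ((a + b) / 2 - r)"
  have le: "pairs_apart r (centered a) (centered b) \<le> pairs_apart r A B"
  proof (rule order_trans[OF pairs_apart_centered[OF a _ r t_def]])
    show "0 \<le> b" using a ab by simp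
    show "ennreal (t\<^sup>2) \<le> pairs_apart r A B"
    proof (cases "(a + b) / 2 - r \<le> 0")
      case True then show ?thesis by (simp add: t_def)
    next
      case nz: False
      then have t: "t = (a + b) / 2 - r" by (simp add: t_def)
      have "t \<le> a" "t \<le> b" "0 \<le> t" using nz False ab by (simp_all add: t field_simps)
      from pairs_apart_lower[OF A B mA mB r t this(3) this(1,2)] show ?thesis .
    qed
  qed
  have eq1: "pairs_closer r A (- B) + ennreal a * ennreal b = ennreal (2 * r) * ennreal a + pairs_apart r A B"
    using pairs_closer_compl_apart[OF A B, of r] r mA mB by simp
  have eq2: "pairs_closer r (centered a) (- centered b) + ennreal a * ennreal b
      = ennreal (2 * r) * ennreal a + pairs_apart r (centered a) (centered b)"
    using pairs_closer_compl_apart[OF centered_borel centered_borel, of r a b] r a ab by (simp add: emeasure_centered)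
  have "ennreal a * ennreal b + pairs_closer r (centered a) (- centered b)
     \<le> ennreal a * ennreal b + pairs_closer r A (- B)"
    using eq1 eq2 le by (metis add.commute add_left_mono)
  then show ?thesis using a ab by (simp add: ennreal_mult[symmetric])
qed

text \<open>At radii beyond the measure of \<open>E\<close>, the centred interval has no pairs at distance \<open>r\<close> or more, so
  those of \<open>E\<close> are exactly the deficit.\<close>

lemma riesz_deficit:
  assumes E[measurable]: "E \<in> sets borel" and mE: "emeasure lborel E = ennreal m"
    and m: "0 \<le> m" and r: "m < r"
  shows "pairs_closer r E (- E) = pairs_closer r (centered m) (- centered m) + pairs_apart r E E"
proof -
  have r0: "0 < r" using m r by simp
  have eq1: "pairs_closer r E (- E) + ennreal m * ennreal m = ennreal (2 * r) * ennreal m + pairs_apart r E E"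
    using pairs_closer_compl_apart[OF E E, of r] r0 mE by simp
  have eq2: "pairs_closer r (centered m) (- centered m) + ennreal m * ennreal m
      = ennreal (2 * r) * ennreal m + pairs_apart r (centered m) (centered m)"
    using pairs_closer_compl_apart[OF centered_borel centered_borel, of r m m] r0 m by (simp add: emeasure_centered)
  have "pairs_apart r (centered m) (centered m) = 0"
    using pairs_apart_centered[OF m m r0, of 0] r by simp
  with eq1 eq2 have "ennreal m * ennreal m + pairs_closer r E (- E)
     = ennreal m * ennreal m + (pairs_closer r (centered m) (- centered m) + pairs_apart r E E)"
    by (metis add.assoc add.commute add.right_neutral)
  then show ?thesis by (simp add: ennreal_mult[symmetric] m)
qed

section \<open>Layers of the Gagliardo seminorm\<close>

definition near_energy :: "real \<Rightarrow> real \<Rightarrow> (real \<Rightarrow> real) \<Rightarrow> ennreal" where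
  "near_energy p r f = (\<integral>\<^sup>+y. (\<integral>\<^sup>+x. ennreal (\<bar>f x - f y\<bar> powr p) * indicator {-r<..<r} (x - y) \<partial>lborel) \<partial>lborel)"

definition trunc_energy :: "real \<Rightarrow> real \<Rightarrow> (real \<Rightarrow> real) \<Rightarrow> ennreal" where
  "trunc_energy c r f = (\<integral>\<^sup>+y. (\<integral>\<^sup>+x. ennreal (\<bar>f x - f y\<bar> - c) * indicator {-r<..<r} (x - y) \<partial>lborel) \<partial>lborel)"

lemma measurable_pred_interval[measurable (raw)]:
  fixes a b :: "'a \<Rightarrow> real"
  assumes [measurable]: "a \<in> borel_measurable M" "b \<in> borel_measurable M"
  shows "Measurable.pred M (\<lambda>z. b z \<in> {a z<..})" "Measurable.pred M (\<lambda>z. b z \<in> {..a z})"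
    "Measurable.pred M (\<lambda>z. b z \<in> {- a z<..<a z})" "Measurable.pred M (\<lambda>z. b z \<in> {a z..})"
  by simp_all

lemma kernel_layer:
  assumes "z \<noteq> 0" "0 < q"
  shows "ennreal (1 / \<bar>z\<bar> powr (1 + q)) = (\<integral>\<^sup>+r\<in>{0<..}. ennreal ((1 + q) * r powr (-2 - q)) * indicator {-r<..<r} z \<partial>lborel)"
proof -
  have "(\<integral>\<^sup>+r\<in>{0<..}. ennreal ((1 + q) * r powr (-2 - q)) * indicator {-r<..<r} z \<partial>lborel)
     = (\<integral>\<^sup>+r. ennreal (1 + q) * (ennreal (r powr (-2 - q)) * indicator {\<bar>z\<bar><..} r) \<partial>lborel)"
    using assms by (intro nn_integral_cong) (auto simp: indicator_def ennreal_mult)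
  also have "\<dots> = ennreal (1 + q) * ennreal (\<bar>z\<bar> powr (-1 - q) / (1 + q))"
    using assms nn_integral_powr_to_inf[of "-2 - q" "\<bar>z\<bar>"]
    by (subst nn_integral_cmult) (auto simp: algebra_simps)
  also have "\<dots> = ennreal (\<bar>z\<bar> powr (-(1 + q)))"
  proof -
    have "ennreal (1 + q) * ennreal (\<bar>z\<bar> powr (-1 - q) / (1 + q)) = ennreal (\<bar>z\<bar> powr (-1 - q))"
      using assms by (subst ennreal_mult[symmetric]) simp_all
    then show ?thesis by (metis diff_conv_add_uminus minus_add_distrib)
  qed
  finally show ?thesis by (simp only: powr_minus_divide)
qed

lemma lborel_triple_swap:
  fixes F :: "real \<Rightarrow> real \<Rightarrow> real \<Rightarrow> ennreal"
  assumes [measurable]: "(\<lambda>(r, y, x). F r y x) \<in> borel_measurable (borel \<Otimes>\<^sub>M borel \<Otimes>\<^sub>M borel)"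
  shows "(\<integral>\<^sup>+y. \<integral>\<^sup>+x. \<integral>\<^sup>+r. F r y x \<partial>lborel \<partial>lborel \<partial>lborel) = (\<integral>\<^sup>+r. \<integral>\<^sup>+y. \<integral>\<^sup>+x. F r y x \<partial>lborel \<partial>lborel \<partial>lborel)"
proof -
  have [measurable]: "(\<lambda>z. F (fst (fst z)) (snd (fst z)) (snd z)) \<in> borel_measurable ((borel \<Otimes>\<^sub>M borel) \<Otimes>\<^sub>M borel)"
    using measurable_compose[OF _ assms, of "\<lambda>z. (fst (fst z), snd (fst z), snd z)" "(borel \<Otimes>\<^sub>M borel) \<Otimes>\<^sub>M borel"] by simp
  have [measurable]: "(\<lambda>z. F (snd (fst z)) (fst (fst z)) (snd z)) \<in> borel_measurable ((borel \<Otimes>\<^sub>M borel) \<Otimes>\<^sub>M borel)"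
    using measurable_compose[OF _ assms, of "\<lambda>z. (snd (fst z), fst (fst z), snd z)" "(borel \<Otimes>\<^sub>M borel) \<Otimes>\<^sub>M borel"] by simp
  have F1[measurable]: "(\<lambda>z. F (fst z) y (snd z)) \<in> borel_measurable (borel \<Otimes>\<^sub>M borel)" for y
    using measurable_compose[OF _ assms, of "\<lambda>z. (fst z, y, snd z)" "borel \<Otimes>\<^sub>M borel"] by simp
  have [measurable]: "(\<lambda>z. F (snd z) y (fst z)) \<in> borel_measurable (borel \<Otimes>\<^sub>M borel)" for y
    using F1 measurable_compose[OF measurable_pair_swap', of "\<lambda>z. F (fst z) y (snd z)"] by (simp add: split_beta')
  have "(\<integral>\<^sup>+x. \<integral>\<^sup>+r. F r y x \<partial>lborel \<partial>lborel) = (\<integral>\<^sup>+r. \<integral>\<^sup>+x. F r y x \<partial>lborel \<partial>lborel)" for y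
    by (rule lborel_pair.Fubini') (simp add: split_beta')
  then have "(\<integral>\<^sup>+y. \<integral>\<^sup>+x. \<integral>\<^sup>+r. F r y x \<partial>lborel \<partial>lborel \<partial>lborel) = (\<integral>\<^sup>+y. \<integral>\<^sup>+r. \<integral>\<^sup>+x. F r y x \<partial>lborel \<partial>lborel \<partial>lborel)"
    by simp
  also have "\<dots> = (\<integral>\<^sup>+r. \<integral>\<^sup>+y. \<integral>\<^sup>+x. F r y x \<partial>lborel \<partial>lborel \<partial>lborel)"
    by (rule lborel_pair.Fubini') measurable
  finally show ?thesis .
qed

lemma gagliardo_layer:
  fixes f :: "real \<Rightarrow> real"
  assumes [measurable]: "f \<in> borel_measurable borel" and q: "0 < s * p"
  shows "gagliardo s p f = (\<integral>\<^sup>+r\<in>{0<..}. ennreal ((1 + s * p) * r powr (-2 - s * p)) * near_energy p r f \<partial>lborel)"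
proof -
  let ?k = "\<lambda>r. ennreal ((1 + s * p) * r powr (-2 - s * p)) * indicator {0<..} r :: ennreal"
  let ?e = "\<lambda>r y x. ennreal (\<bar>f x - f y\<bar> powr p) * indicator {-r<..<r} (x - y) :: ennreal"
  have "gagliardo s p f = (\<integral>\<^sup>+y. \<integral>\<^sup>+x. \<integral>\<^sup>+r. ?k r * ?e r y x \<partial>lborel \<partial>lborel \<partial>lborel)"
    unfolding gagliardo_def
  proof (intro nn_integral_cong)
    fix x y :: real
    show "ennreal (\<bar>f x - f y\<bar> powr p / \<bar>x - y\<bar> powr (1 + s * p)) = (\<integral>\<^sup>+r. ?k r * ?e r y x \<partial>lborel)"
    proof (cases "x = y")
      case False
      have "ennreal (\<bar>f x - f y\<bar> powr p / \<bar>x - y\<bar> powr (1 + s * p)) = ennreal (\<bar>f x - f y\<bar> powr p) * ennreal (1 / \<bar>x - y\<bar> powr (1 + s * p))"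
        by (subst ennreal_mult[symmetric]) auto
      also have "\<dots> = (\<integral>\<^sup>+r. ennreal (\<bar>f x - f y\<bar> powr p) * (ennreal ((1 + s * p) * r powr (-2 - s * p)) * indicator {-r<..<r} (x - y) * indicator {0<..} r) \<partial>lborel)"
        by (subst nn_integral_cmult) (use False q in \<open>auto simp: kernel_layer\<close>)
      also have "\<dots> = (\<integral>\<^sup>+r. ?k r * ?e r y x \<partial>lborel)"
        by (intro nn_integral_cong) (simp add: mult.commute split: split_indicator)
      finally show ?thesis .
    qed simp
  qed
  also have "\<dots> = (\<integral>\<^sup>+r. \<integral>\<^sup>+y. \<integral>\<^sup>+x. ?k r * ?e r y x \<partial>lborel \<partial>lborel \<partial>lborel)"
    by (rule lborel_triple_swap) measurable
  also have "\<dots> = (\<integral>\<^sup>+r. ?k r * near_energy p r f \<partial>lborel)"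
    unfolding near_energy_def by (simp add: nn_integral_cmult)
  also have "\<dots> = (\<integral>\<^sup>+r\<in>{0<..}. ennreal ((1 + s * p) * r powr (-2 - s * p)) * near_energy p r f \<partial>lborel)"
    by (intro nn_integral_cong) (simp split: split_indicator)
  finally show ?thesis .
qed

lemma near_energy_1: "near_energy 1 r f = trunc_energy 0 r f"
  by (simp add: near_energy_def trunc_energy_def)

text \<open>A power with exponent above 1 is a superposition of the convex functions \<open>(t - c)\<^sub>+\<close>. For exponent
  1 the density degenerates to a point mass at \<open>c = 0\<close>, which is why that case is kept apart.\<close>

lemma powr_layer:
  fixes t p :: real
  assumes t: "0 \<le> t" and p: "1 < p"
  shows "ennreal (t powr p) = (\<integral>\<^sup>+c\<in>{0<..}. ennreal (p * (p - 1) * c powr (p - 2)) * ennreal (t - c) \<partial>lborel)"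
proof -
  have h1: "((\<lambda>c. c powr (p - 2)) has_integral t powr (p - 1) / (p - 1)) {0..t}"
  proof -
    have "p - 2 + 1 = p - 1" by simp
    then show ?thesis using has_integral_powr_from_0[of "p - 2" t] t p by simp
  qed
  have h2: "((\<lambda>c. c powr (p - 1)) has_integral t powr p / p) {0..t}"
    using has_integral_powr_from_0[of "p - 1" t] t p by simp
  have "((\<lambda>c. p * (p - 1) * (t * c powr (p - 2) - c powr (p - 1))) has_integral
      p * (p - 1) * (t * (t powr (p - 1) / (p - 1)) - t powr p / p)) {0..t}"
    by (rule has_integral_mult_right[OF has_integral_diff[OF has_integral_mult_right[OF h1] h2]])
  also have "p * (p - 1) * (t * (t powr (p - 1) / (p - 1)) - t powr p / p) = t powr p"
  proof -
    have *: "t * t powr (p - 1) = t powr p" using powr_mult_base[of t "p - 1"] t by simp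
    have "p * (p - 1) * (t * A - B) = p * t * ((p - 1) * A) - (p - 1) * (p * B)" for A B
      by (simp add: algebra_simps)
    from this[of "t powr (p - 1) / (p - 1)" "t powr p / p"]
    have "p * (p - 1) * (t * (t powr (p - 1) / (p - 1)) - t powr p / p) = p * (t * t powr (p - 1)) - (p - 1) * t powr p"
      using p by simp
    also have "\<dots> = t powr p" unfolding * by (simp add: left_diff_distrib)
    finally show ?thesis .
  qed
  finally have hi: "((\<lambda>c. p * (p - 1) * (t * c powr (p - 2) - c powr (p - 1))) has_integral t powr p) {0..t}" .
  have eq: "p * (p - 1) * (t * c powr (p - 2) - c powr (p - 1)) = p * (p - 1) * c powr (p - 2) * (t - c)" if "0 \<le> c" for c
    using powr_mult_base[of c "p - 2"] that by (simp add: algebra_simps)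
  have "(\<integral>\<^sup>+c\<in>{0..t}. ennreal (p * (p - 1) * (t * c powr (p - 2) - c powr (p - 1))) \<partial>lborel) = ennreal (t powr p)"
    by (rule nn_integral_has_integral_lebesgue'[OF _ hi]) (use p in \<open>auto simp: eq\<close>)
  moreover have "(\<integral>\<^sup>+c\<in>{0..t}. ennreal (p * (p - 1) * (t * c powr (p - 2) - c powr (p - 1))) \<partial>lborel)
     = (\<integral>\<^sup>+c\<in>{0<..}. ennreal (p * (p - 1) * c powr (p - 2)) * ennreal (t - c) \<partial>lborel)"
  proof (rule nn_integral_cong_AE)
    show "AE c in lborel. ennreal (p * (p - 1) * (t * c powr (p - 2) - c powr (p - 1))) * indicator {0..t} c
      = ennreal (p * (p - 1) * c powr (p - 2)) * ennreal (t - c) * indicator {0<..} c"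
      using AE_lborel_singleton[of 0]
    proof eventually_elim
      case (elim c)
      then show ?case using p eq[of c]
        by (cases "c \<le> t") (auto simp: indicator_def ennreal_mult ennreal_neg mult.assoc)
    qed
  qed
  ultimately show ?thesis by simp
qed

lemma near_energy_trunc:
  fixes f :: "real \<Rightarrow> real"
  assumes [measurable]: "f \<in> borel_measurable borel" and p: "1 < p"
  shows "near_energy p r f = (\<integral>\<^sup>+c\<in>{0<..}. ennreal (p * (p - 1) * c powr (p - 2)) * trunc_energy c r f \<partial>lborel)"
proof -
  let ?k = "\<lambda>c. ennreal (p * (p - 1) * c powr (p - 2)) * indicator {0<..} c :: ennreal"
  let ?e = "\<lambda>c y x. ennreal (\<bar>f x - f y\<bar> - c) * indicator {-r<..<r} (x - y) :: ennreal"
  have "near_energy p r f = (\<integral>\<^sup>+y. \<integral>\<^sup>+x. \<integral>\<^sup>+c. ?k c * ?e c y x \<partial>lborel \<partial>lborel \<partial>lborel)"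
    unfolding near_energy_def
  proof (intro nn_integral_cong)
    fix x y :: real
    have "(\<integral>\<^sup>+c. ?k c * ?e c y x \<partial>lborel) = (\<integral>\<^sup>+c. indicator {-r<..<r} (x - y) * (ennreal (p * (p - 1) * c powr (p - 2)) * ennreal (\<bar>f x - f y\<bar> - c) * indicator {0<..} c) \<partial>lborel)"
      by (intro nn_integral_cong) (simp split: split_indicator)
    also have "\<dots> = indicator {-r<..<r} (x - y) * ennreal (\<bar>f x - f y\<bar> powr p)"
      using p by (subst powr_layer) (auto simp: nn_integral_cmult)
    finally show "ennreal (\<bar>f x - f y\<bar> powr p) * indicator {-r<..<r} (x - y) = (\<integral>\<^sup>+c. ?k c * ?e c y x \<partial>lborel)"
      by (simp add: mult.commute)
  qed
  also have "\<dots> = (\<integral>\<^sup>+c. \<integral>\<^sup>+y. \<integral>\<^sup>+x. ?k c * ?e c y x \<partial>lborel \<partial>lborel \<partial>lborel)"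
    by (rule lborel_triple_swap) measurable
  also have "\<dots> = (\<integral>\<^sup>+c. ?k c * trunc_energy c r f \<partial>lborel)"
    unfolding trunc_energy_def by (simp add: nn_integral_cmult)
  also have "\<dots> = (\<integral>\<^sup>+c\<in>{0<..}. ennreal (p * (p - 1) * c powr (p - 2)) * trunc_energy c r f \<partial>lborel)"
    by (intro nn_integral_cong) (simp split: split_indicator)
  finally show ?thesis .
qed

lemma trunc_diff_layer:
  fixes a b c :: real
  assumes "0 \<le> a" "0 \<le> b" "0 \<le> c"
  shows "ennreal (\<bar>a - b\<bar> - c) = (\<integral>\<^sup>+\<tau>\<in>{0..}. indicator {\<tau> + c<..} a * indicator {..\<tau>} b + indicator {\<tau> + c<..} b * indicator {..\<tau>} a \<partial>lborel)"
proof -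
  have *: "ennreal (\<bar>a - b\<bar> - c) = (\<integral>\<^sup>+\<tau>\<in>{0..}. indicator {\<tau> + c<..} a * indicator {..\<tau>} b + indicator {\<tau> + c<..} b * indicator {..\<tau>} a \<partial>lborel)"
    if "0 \<le> b" "b \<le> a" for a b
  proof -
    have "(\<integral>\<^sup>+\<tau>\<in>{0..}. indicator {\<tau> + c<..} a * indicator {..\<tau>} b + indicator {\<tau> + c<..} b * indicator {..\<tau>} a \<partial>lborel)
       = (\<integral>\<^sup>+\<tau>. indicator {b..<a - c} \<tau> \<partial>lborel)"
      using that assms(3) by (intro nn_integral_cong) (auto simp: indicator_def)
    also have "\<dots> = ennreal (\<bar>a - b\<bar> - c)"
      using that by (cases "b \<le> a - c") (auto simp: ennreal_neg algebra_simps)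
    finally show ?thesis by simp
  qed
  show ?thesis
  proof (cases "b \<le> a")
    case True then show ?thesis using * assms by simp
  next
    case False
    then show ?thesis using *[of a b] assms by (simp add: abs_minus_commute add.commute)
  qed
qed

text \<open>\<open>(\<bar>f x - f y\<bar> - c)\<^sub>+\<close> is the length of the set of levels \<open>\<tau>\<close> such that one value exceeds
  \<open>\<tau> + c\<close> and the other is at most \<open>\<tau>\<close>. The two superlevel sets that occur are nested, which provides
  the order of the measures required by the Riesz inequality.\<close>

lemma trunc_energy_layer:
  fixes f :: "real \<Rightarrow> real"
  assumes [measurable]: "f \<in> borel_measurable borel" and f: "\<And>x. 0 \<le> f x" and c: "0 \<le> c"
  shows "trunc_energy c r f = 2 * (\<integral>\<^sup>+\<tau>\<in>{0..}. pairs_closer r {x. \<tau> + c < f x} (- {x. \<tau> < f x}) \<partial>lborel)"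
proof -
  let ?e = "\<lambda>\<tau> y x. (indicator {\<tau> + c<..} (f x) * indicator {..\<tau>} (f y) + indicator {\<tau> + c<..} (f y) * indicator {..\<tau>} (f x)) * indicator {-r<..<r} (x - y) :: ennreal"
  have "trunc_energy c r f = (\<integral>\<^sup>+y. \<integral>\<^sup>+x. \<integral>\<^sup>+\<tau>. indicator {0..} \<tau> * ?e \<tau> y x \<partial>lborel \<partial>lborel \<partial>lborel)"
    unfolding trunc_energy_def
  proof (intro nn_integral_cong)
    fix x y :: real
    have "(\<integral>\<^sup>+\<tau>. indicator {0..} \<tau> * ?e \<tau> y x \<partial>lborel) = (\<integral>\<^sup>+\<tau>. indicator {-r<..<r} (x - y) *
       ((indicator {\<tau> + c<..} (f x) * indicator {..\<tau>} (f y) + indicator {\<tau> + c<..} (f y) * indicator {..\<tau>} (f x)) * indicator {0..} \<tau>) \<partial>lborel)"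
      by (intro nn_integral_cong) (simp split: split_indicator)
    also have "\<dots> = indicator {-r<..<r} (x - y) * ennreal (\<bar>f x - f y\<bar> - c)"
      unfolding trunc_diff_layer[OF f f c] by (subst nn_integral_cmult) auto
    finally show "ennreal (\<bar>f x - f y\<bar> - c) * indicator {-r<..<r} (x - y) = (\<integral>\<^sup>+\<tau>. indicator {0..} \<tau> * ?e \<tau> y x \<partial>lborel)"
      by (simp add: mult.commute)
  qed
  also have "\<dots> = (\<integral>\<^sup>+\<tau>. \<integral>\<^sup>+y. \<integral>\<^sup>+x. indicator {0..} \<tau> * ?e \<tau> y x \<partial>lborel \<partial>lborel \<partial>lborel)"
    by (rule lborel_triple_swap) measurable
  also have "\<dots> = (\<integral>\<^sup>+\<tau>. 2 * (pairs_closer r {x. \<tau> + c < f x} (- {x. \<tau> < f x}) * indicator {0..} \<tau>) \<partial>lborel)"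
  proof (intro nn_integral_cong)
    fix \<tau> :: real
    let ?A = "{x. \<tau> + c < f x}" and ?B = "- {x. \<tau> < f x}"
    have "(\<integral>\<^sup>+y. \<integral>\<^sup>+x. ?e \<tau> y x \<partial>lborel \<partial>lborel)
       = (\<integral>\<^sup>+y. (\<integral>\<^sup>+x. indicator ?A x * indicator ?B y * indicator {-r<..<r} (x - y) \<partial>lborel)
           + (\<integral>\<^sup>+x. indicator ?A y * indicator ?B x * indicator {-r<..<r} (y - x) \<partial>lborel) \<partial>lborel)"
      by (subst nn_integral_add[symmetric]) (auto intro!: nn_integral_cong simp: indicator_def)
    also have "\<dots> = (\<integral>\<^sup>+y. (\<integral>\<^sup>+x. indicator ?A x * indicator ?B y * indicator {-r<..<r} (x - y) \<partial>lborel) \<partial>lborel)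
           + pairs_closer r ?A ?B"
      unfolding pairs_closer_def by (rule nn_integral_add) auto
    also have "(\<integral>\<^sup>+y. (\<integral>\<^sup>+x. indicator ?A x * indicator ?B y * indicator {-r<..<r} (x - y) \<partial>lborel) \<partial>lborel) = pairs_closer r ?A ?B"
      unfolding pairs_closer_def by (rule lborel_pair.Fubini') simp
    finally have "(\<integral>\<^sup>+y. \<integral>\<^sup>+x. ?e \<tau> y x \<partial>lborel \<partial>lborel) = 2 * pairs_closer r ?A ?B"
      by (simp add: mult_2)
    then show "(\<integral>\<^sup>+y. \<integral>\<^sup>+x. indicator {0..} \<tau> * ?e \<tau> y x \<partial>lborel \<partial>lborel) = 2 * (pairs_closer r ?A ?B * indicator {0..} \<tau>)"
      by (simp add: nn_integral_cmult indicator_def)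
  qed
  also have "\<dots> = 2 * (\<integral>\<^sup>+\<tau>\<in>{0..}. pairs_closer r {x. \<tau> + c < f x} (- {x. \<tau> < f x}) \<partial>lborel)"
  proof (rule nn_integral_cmult)
    have "(\<lambda>\<tau>. (\<integral>\<^sup>+x. (\<integral>\<^sup>+y. indicator {\<tau> + c<..} (f x) * indicator {..\<tau>} (f y) * indicator {-r<..<r} (x - y) \<partial>lborel) \<partial>lborel) * indicator {0..} \<tau> :: ennreal) \<in> borel_measurable lborel"
      by measurable
    also have "(\<lambda>\<tau>. (\<integral>\<^sup>+x. (\<integral>\<^sup>+y. indicator {\<tau> + c<..} (f x) * indicator {..\<tau>} (f y) * indicator {-r<..<r} (x - y) \<partial>lborel) \<partial>lborel) * indicator {0..} \<tau> :: ennreal)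
       = (\<lambda>\<tau>. pairs_closer r {x. \<tau> + c < f x} (- {x. \<tau> < f x}) * indicator {0..} \<tau>)"
      unfolding pairs_closer_def
      by (intro ext arg_cong2[where f="(*)"] nn_integral_cong) (auto simp: indicator_def)
    finally show "(\<lambda>\<tau>. pairs_closer r {x. \<tau> + c < f x} (- {x. \<tau> < f x}) * indicator {0..} \<tau>) \<in> borel_measurable lborel" .
  qed
  finally show ?thesis .
qed

lemma gagliardo_mono_trunc:
  fixes f g :: "real \<Rightarrow> real"
  assumes [measurable]: "f \<in> borel_measurable borel" "g \<in> borel_measurable borel"
    and s: "0 < s" and p: "1 \<le> p"
    and le: "\<And>c r. 0 \<le> c \<Longrightarrow> 0 < r \<Longrightarrow> trunc_energy c r f \<le> trunc_energy c r g"
  shows "gagliardo s p f \<le> gagliardo s p g"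
proof -
  have "near_energy p r f \<le> near_energy p r g" if r: "0 < r" for r
  proof (cases "p = 1")
    case True
    then show ?thesis using le[of 0 r] r by (simp add: near_energy_1)
  next
    case False
    then have "1 < p" using p by simp
    then show ?thesis
    proof (subst (1 2) near_energy_trunc, simp_all, intro nn_integral_mono)
      fix c :: real
      show "ennreal (p * (p - 1) * c powr (p - 2)) * trunc_energy c r f * indicator {0<..} c
        \<le> ennreal (p * (p - 1) * c powr (p - 2)) * trunc_energy c r g * indicator {0<..} c"
        using le[of c r] r by (cases "0 < c") (auto intro!: mult_left_mono)
    qed
  qed
  then have "(\<integral>\<^sup>+r\<in>{0<..}. ennreal ((1 + s * p) * r powr (-2 - s * p)) * near_energy p r f \<partial>lborel)
     \<le> (\<integral>\<^sup>+r\<in>{0<..}. ennreal ((1 + s * p) * r powr (-2 - s * p)) * near_energy p r g \<partial>lborel)"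
    by (intro nn_integral_mono) (auto intro!: mult_left_mono simp: indicator_def)
  then show ?thesis using s p by (simp add: gagliardo_layer)
qed

lemma nn_integral_weight_layer:
  fixes g :: "real \<Rightarrow> real" and w :: "real \<Rightarrow> ennreal"
  assumes [measurable]: "g \<in> borel_measurable borel" "w \<in> borel_measurable borel" and g: "\<And>x. 0 \<le> g x"
  shows "(\<integral>\<^sup>+x. ennreal (g x) * w x \<partial>lborel) = (\<integral>\<^sup>+l\<in>{0..}. (\<integral>\<^sup>+x\<in>{x. l < g x}. w x \<partial>lborel) \<partial>lborel)"
proof -
  have "(\<integral>\<^sup>+x. ennreal (g x) * w x \<partial>lborel) = (\<integral>\<^sup>+x. \<integral>\<^sup>+l. (if 0 \<le> l \<and> l < g x then w x else 0) \<partial>lborel \<partial>lborel)"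
  proof (intro nn_integral_cong)
    fix x
    have "(\<integral>\<^sup>+l. (if 0 \<le> l \<and> l < g x then w x else 0) \<partial>lborel) = (\<integral>\<^sup>+l. w x * indicator {0..<g x} l \<partial>lborel)"
      by (intro nn_integral_cong) (simp split: split_indicator)
    also have "\<dots> = w x * ennreal (g x)" using g[of x] by (subst nn_integral_cmult) auto
    finally show "ennreal (g x) * w x = (\<integral>\<^sup>+l. (if 0 \<le> l \<and> l < g x then w x else 0) \<partial>lborel)"
      by (simp add: mult.commute)
  qed
  also have "\<dots> = (\<integral>\<^sup>+l. \<integral>\<^sup>+x. (if 0 \<le> l \<and> l < g x then w x else 0) \<partial>lborel \<partial>lborel)"
    by (rule lborel_pair.Fubini') measurable
  also have "\<dots> = (\<integral>\<^sup>+l\<in>{0..}. (\<integral>\<^sup>+x\<in>{x. l < g x}. w x \<partial>lborel) \<partial>lborel)"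
  proof (intro nn_integral_cong)
    fix l :: real
    show "(\<integral>\<^sup>+x. (if 0 \<le> l \<and> l < g x then w x else 0) \<partial>lborel)
        = (\<integral>\<^sup>+x\<in>{x. l < g x}. w x \<partial>lborel) * indicator {0..} l"
      by (cases "0 \<le> l") (auto intro!: nn_integral_cong split: split_indicator)
  qed
  finally show ?thesis .
qed

lemma measurable_weight_layer:
  fixes g :: "real \<Rightarrow> real" and w :: "real \<Rightarrow> ennreal"
  assumes [measurable]: "g \<in> borel_measurable borel" "w \<in> borel_measurable borel"
  shows "(\<lambda>l. \<integral>\<^sup>+x\<in>{x. l < g x}. w x \<partial>lborel) \<in> borel_measurable borel"
proof -
  have "(\<lambda>l. \<integral>\<^sup>+x. (if l < g x then w x else 0) \<partial>lborel) \<in> borel_measurable borel"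
    by measurable
  also have "(\<lambda>l. \<integral>\<^sup>+x. (if l < g x then w x else 0) \<partial>lborel) = (\<lambda>l. \<integral>\<^sup>+x\<in>{x. l < g x}. w x \<partial>lborel)"
    by (intro ext nn_integral_cong) (simp split: split_indicator)
  finally show ?thesis .
qed

section \<open>Symmetric decreasing rearrangement\<close>

text \<open>The value at \<open>x\<close> is the highest level whose superlevel set has measure above \<open>2 * \<bar>x\<bar>\<close>. Inserting
  \<open>0\<close> makes the supremum meaningful outside the rearranged support.\<close>

definition rearr :: "(real \<Rightarrow> real) \<Rightarrow> real \<Rightarrow> real" where
  "rearr u x = Sup (insert 0 {\<tau>. 0 \<le> \<tau> \<and> 2 * \<bar>x\<bar> < measure lborel {y. \<tau> < \<bar>u y\<bar>}})"

locale rearrangeable =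
  fixes u :: "real \<Rightarrow> real" and M :: real
  assumes u_borel[measurable]: "u \<in> borel_measurable borel"
    and u_bound: "\<And>x. \<bar>u x\<bar> \<le> M"
    and u_finite: "emeasure lborel {x. u x \<noteq> 0} < \<infinity>"
begin

definition levelm :: "real \<Rightarrow> real" where
  "levelm \<tau> = measure lborel {y. \<tau> < \<bar>u y\<bar>}"

lemma level_fmeasurable:
  assumes "0 \<le> \<tau>"
  shows "{y. \<tau> < \<bar>u y\<bar>} \<in> fmeasurable lborel"
proof (rule fmeasurableI)
  have "emeasure lborel {y. \<tau> < \<bar>u y\<bar>} \<le> emeasure lborel {x. u x \<noteq> 0}"
    using assms by (intro emeasure_mono) auto
  then show "emeasure lborel {y. \<tau> < \<bar>u y\<bar>} < \<infinity>" using u_finite by (rule le_less_trans)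
qed simp

lemma emeasure_level: "0 \<le> \<tau> \<Longrightarrow> emeasure lborel {y. \<tau> < \<bar>u y\<bar>} = ennreal (levelm \<tau>)"
  unfolding levelm_def using level_fmeasurable[of \<tau>]
  by (intro emeasure_eq_ennreal_measure) (auto simp: fmeasurable_def)

lemma levelm_antimono: "0 \<le> \<tau> \<Longrightarrow> \<tau> \<le> \<sigma> \<Longrightarrow> levelm \<sigma> \<le> levelm \<tau>"
  unfolding levelm_def by (rule measure_mono_fmeasurable) (auto intro: level_fmeasurable)

lemma levelm_nonneg: "0 \<le> levelm \<tau>"
  by (simp add: levelm_def)

lemma levelm_0: "M \<le> \<tau> \<Longrightarrow> levelm \<tau> = 0"
proof -
  assume "M \<le> \<tau>"
  then have "{y. \<tau> < \<bar>u y\<bar>} = {}" by (auto simp: not_less intro: order_trans[OF u_bound])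
  then show ?thesis by (simp add: levelm_def)
qed

lemma M_nonneg: "0 \<le> M"
  using u_bound[of 0] by linarith

lemma rearr_alt: "rearr u x = Sup (insert 0 {\<tau>. 0 \<le> \<tau> \<and> 2 * \<bar>x\<bar> < levelm \<tau>})"
  by (simp add: rearr_def levelm_def)

lemma level_le_M: "2 * \<bar>x\<bar> < levelm \<tau> \<Longrightarrow> \<tau> \<le> M"
  using levelm_0[of \<tau>] by (cases "\<tau> \<le> M") auto

lemma rearr_bdd: "bdd_above (insert 0 {\<tau>. 0 \<le> \<tau> \<and> 2 * \<bar>x\<bar> < levelm \<tau>})"
  using level_le_M by (intro bdd_aboveI[of _ M]) (auto simp: M_nonneg)

lemma rearr_nonneg: "0 \<le> rearr u x"
  unfolding rearr_alt by (rule cSup_upper[OF _ rearr_bdd]) simp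

lemma rearr_le: "rearr u x \<le> M"
  unfolding rearr_alt by (rule cSup_least) (auto simp: M_nonneg intro: level_le_M)

text \<open>The nontrivial direction uses that the measure of a superlevel set is continuous from the right in
  the level, so a strict inequality persists at a slightly higher level.\<close>

lemma rearr_gt_iff:
  assumes \<tau>: "0 \<le> \<tau>"
  shows "\<tau> < rearr u x \<longleftrightarrow> 2 * \<bar>x\<bar> < levelm \<tau>"
proof
  assume "\<tau> < rearr u x"
  then obtain \<sigma> where "\<sigma> \<in> insert 0 {\<tau>. 0 \<le> \<tau> \<and> 2 * \<bar>x\<bar> < levelm \<tau>}" "\<tau> < \<sigma>"
    unfolding rearr_alt by (subst (asm) less_cSup_iff[OF _ rearr_bdd]) auto
  then have "2 * \<bar>x\<bar> < levelm \<sigma>" "\<tau> < \<sigma>" using \<tau> by auto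
  then show "2 * \<bar>x\<bar> < levelm \<tau>" using levelm_antimono[OF \<tau>, of \<sigma>] by linarith
next
  assume *: "2 * \<bar>x\<bar> < levelm \<tau>"
  \<comment> \<open>superlevel sets at levels decreasing to \<open>\<tau>\<close>\<close>
  define L where "L n = {y. \<tau> + 1 / real (Suc n) < \<bar>u y\<bar>}" for n
  have inc: "incseq L"
  proof (rule incseq_SucI)
    fix n
    have "1 / real (Suc (Suc n)) \<le> 1 / real (Suc n)" by (intro divide_left_mono) auto
    then show "L n \<subseteq> L (Suc n)" unfolding L_def by auto
  qed
  have U: "(\<Union>n. L n) = {y. \<tau> < \<bar>u y\<bar>}"
  proof (intro equalityI subsetI)
    fix y assume "y \<in> {y. \<tau> < \<bar>u y\<bar>}"
    then have "0 < \<bar>u y\<bar> - \<tau>" by simp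
    then obtain n where "1 / real (Suc n) < \<bar>u y\<bar> - \<tau>"
      by (metis inverse_eq_divide reals_Archimedean)
    then show "y \<in> (\<Union>n. L n)" by (auto simp: L_def intro!: exI[of _ n])
  next
    fix y assume "y \<in> (\<Union>n. L n)"
    then show "y \<in> {y. \<tau> < \<bar>u y\<bar>}" by (auto simp: L_def) (smt (verit) divide_nonneg_nonneg of_nat_0_le_iff)
  qed
  have "range L \<subseteq> sets lborel" by (auto simp: L_def)
  moreover have "emeasure lborel (\<Union>n. L n) \<noteq> \<infinity>"
    unfolding U using level_fmeasurable[OF \<tau>] by (simp add: fmeasurable_def)
  ultimately have "(\<lambda>n. measure lborel (L n)) \<longlonglongrightarrow> measure lborel (\<Union>n. L n)"
    using inc by (intro Lim_measure_incseq)
  then have "(\<lambda>n. measure lborel (L n)) \<longlonglongrightarrow> levelm \<tau>" unfolding U levelm_def .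
  from order_tendstoD(1)[OF this *] obtain n where "2 * \<bar>x\<bar> < measure lborel (L n)"
    by (auto simp: eventually_sequentially)
  then have "\<tau> + 1 / real (Suc n) \<in> insert 0 {\<tau>. 0 \<le> \<tau> \<and> 2 * \<bar>x\<bar> < levelm \<tau>}"
    using \<tau> by (auto simp: L_def levelm_def)
  from cSup_upper[OF this rearr_bdd] have "\<tau> + 1 / real (Suc n) \<le> rearr u x" by (simp add: rearr_alt)
  moreover have "0 < 1 / real (Suc n)" by simp
  ultimately show "\<tau> < rearr u x" by linarith
qed

lemma rearr_level: "0 \<le> \<tau> \<Longrightarrow> {x. \<tau> < rearr u x} = centered (levelm \<tau>)"
  by (auto simp: rearr_gt_iff centered_def)

lemma rearr_decreasing: "\<bar>x\<bar> \<le> \<bar>y\<bar> \<Longrightarrow> rearr u y \<le> rearr u x"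
  using rearr_gt_iff[OF rearr_nonneg, of x x] rearr_gt_iff[OF rearr_nonneg, of x y]
  by (cases "rearr u x < rearr u y") auto

lemma rearr_eq_0: "levelm 0 \<le> 2 * \<bar>x\<bar> \<Longrightarrow> rearr u x = 0"
  using rearr_gt_iff[of 0 x] rearr_nonneg[of x] by (cases "0 < rearr u x") auto

lemma rearr_borel[measurable]: "rearr u \<in> borel_measurable borel"
proof (rule borel_measurableI_greater)
  fix \<tau> :: real
  show "{x \<in> space borel. \<tau> < rearr u x} \<in> sets borel"
  proof (cases "0 \<le> \<tau>")
    case True then show ?thesis by (simp add: rearr_level)
  next
    case False
    then have "\<tau> < rearr u x" for x using rearr_nonneg[of x] by linarith
    then show ?thesis by simp
  qed
qed

theorem gagliardo_rearr_le:
  assumes s: "0 < s" and p: "1 \<le> p"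
  shows "gagliardo s p (rearr u) \<le> gagliardo s p u"
proof -
  have "gagliardo s p (rearr u) \<le> gagliardo s p (\<lambda>x. \<bar>u x\<bar>)"
  proof (rule gagliardo_mono_trunc[OF _ _ s p])
    fix c r :: real assume c: "0 \<le> c" and r: "0 < r"
    show "trunc_energy c r (rearr u) \<le> trunc_energy c r (\<lambda>x. \<bar>u x\<bar>)"
      unfolding trunc_energy_layer[OF rearr_borel rearr_nonneg c]
      using c
    proof (subst trunc_energy_layer, simp, simp, simp, intro mult_left_mono nn_integral_mono)
      fix \<tau> :: real
      show "pairs_closer r {x. \<tau> + c < rearr u x} (- {x. \<tau> < rearr u x}) * indicator {0..} \<tau>
         \<le> pairs_closer r {x. \<tau> + c < \<bar>u x\<bar>} (- {x. \<tau> < \<bar>u x\<bar>}) * indicator {0..} \<tau>"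
      proof (cases "0 \<le> \<tau>")
        case True
        then show ?thesis using c r
          by (auto simp: rearr_level intro!: riesz_centered levelm_antimono levelm_nonneg emeasure_level)
      qed simp
    qed simp
  qed auto
  also have "gagliardo s p (\<lambda>x. \<bar>u x\<bar>) \<le> gagliardo s p u"
    unfolding gagliardo_def
    using p by (intro nn_integral_mono ennreal_leI divide_right_mono powr_mono2) auto
  finally show ?thesis .
qed

end

text \<open>A comparison of weights that holds on all superlevel sets, with the rearranged sets on the right,
  integrates to a comparison of weighted \<open>p\<close>-th powers.\<close>

lemma (in rearrangeable) weighted_rearr_le:
  fixes w w' :: "real \<Rightarrow> ennreal"
  assumes [measurable]: "w \<in> borel_measurable borel" "w' \<in> borel_measurable borel" and p: "0 < p"
    and le: "\<And>\<tau>. 0 \<le> \<tau> \<Longrightarrow> (\<integral>\<^sup>+x\<in>{x. \<tau> < \<bar>u x\<bar>}. w x \<partial>lborel) \<le> C * (\<integral>\<^sup>+x\<in>centered (levelm \<tau>). w' x \<partial>lborel)"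
  shows "(\<integral>\<^sup>+x. ennreal (\<bar>u x\<bar> powr p) * w x \<partial>lborel) \<le> C * (\<integral>\<^sup>+x. ennreal (rearr u x powr p) * w' x \<partial>lborel)"
proof -
  have lev: "{x. l < g x powr p} = {x. l powr (1 / p) < g x}" if "0 \<le> l" "\<And>x. 0 \<le> g x" for l and g :: "real \<Rightarrow> real"
  proof -
    have "l < t powr p \<longleftrightarrow> l powr (1 / p) < t" if "0 \<le> t" for t
    proof
      assume "l < t powr p"
      then have "l powr (1 / p) < (t powr p) powr (1 / p)" using p \<open>0 \<le> l\<close> by (intro powr_less_mono2) auto
      then show "l powr (1 / p) < t" using p that by (simp add: powr_powr)
    next
      assume "l powr (1 / p) < t"
      then have "(l powr (1 / p)) powr p < t powr p" using p by (intro powr_less_mono2) auto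
      then show "l < t powr p" using p \<open>0 \<le> l\<close> by (simp add: powr_powr)
    qed
    then show ?thesis using that by auto
  qed
  have "(\<integral>\<^sup>+x. ennreal (\<bar>u x\<bar> powr p) * w x \<partial>lborel) = (\<integral>\<^sup>+l\<in>{0..}. (\<integral>\<^sup>+x\<in>{x. l < \<bar>u x\<bar> powr p}. w x \<partial>lborel) \<partial>lborel)"
    by (rule nn_integral_weight_layer) auto
  also have "\<dots> \<le> (\<integral>\<^sup>+l. C * ((\<integral>\<^sup>+x\<in>{x. l < rearr u x powr p}. w' x \<partial>lborel) * indicator {0..} l) \<partial>lborel)"
  proof (intro nn_integral_mono)
    fix l :: real
    show "(\<integral>\<^sup>+x\<in>{x. l < \<bar>u x\<bar> powr p}. w x \<partial>lborel) * indicator {0..} l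
       \<le> C * ((\<integral>\<^sup>+x\<in>{x. l < rearr u x powr p}. w' x \<partial>lborel) * indicator {0..} l)"
    proof (cases "0 \<le> l")
      case True
      have 1: "{x. l < \<bar>u x\<bar> powr p} = {x. l powr (1 / p) < \<bar>u x\<bar>}" using lev[of l "\<lambda>x. \<bar>u x\<bar>"] True by simp
      have 2: "{x. l < rearr u x powr p} = centered (levelm (l powr (1 / p)))"
        using lev[of l "rearr u"] True rearr_nonneg by (simp add: rearr_level)
      show ?thesis using True le[of "l powr (1/p)"] unfolding 1 2 by simp
    qed simp
  qed
  also have "\<dots> = C * (\<integral>\<^sup>+l\<in>{0..}. (\<integral>\<^sup>+x\<in>{x. l < rearr u x powr p}. w' x \<partial>lborel) \<partial>lborel)"
  proof (rule nn_integral_cmult)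
    have [measurable]: "(\<lambda>l. \<integral>\<^sup>+x\<in>{x. l < rearr u x powr p}. w' x \<partial>lborel) \<in> borel_measurable borel"
      by (rule measurable_weight_layer) auto
    show "(\<lambda>l. (\<integral>\<^sup>+x\<in>{x. l < rearr u x powr p}. w' x \<partial>lborel) * indicator {0..} l) \<in> borel_measurable lborel"
      by simp
  qed
  also have "(\<integral>\<^sup>+l\<in>{0..}. (\<integral>\<^sup>+x\<in>{x. l < rearr u x powr p}. w' x \<partial>lborel) \<partial>lborel) = (\<integral>\<^sup>+x. ennreal (rearr u x powr p) * w' x \<partial>lborel)"
    by (rule nn_integral_weight_layer[symmetric]) auto
  finally show ?thesis .
qed


section \<open>Perimeters\<close>

lemma gagliardo_indicator:
  assumes [measurable]: "E \<in> sets borel" and p: "0 < p"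
  shows "gagliardo s p (indicator E) = 2 * (\<integral>\<^sup>+y\<in>E. (\<integral>\<^sup>+x\<in>- E. ennreal (1 / \<bar>x - y\<bar> powr (1 + s * p)) \<partial>lborel) \<partial>lborel)"
proof -
  let ?K = "\<lambda>x y. ennreal (1 / \<bar>x - y\<bar> powr (1 + s * p))"
  have "gagliardo s p (indicator E) = (\<integral>\<^sup>+y. (\<integral>\<^sup>+x. ?K x y * indicator (- E) x * indicator E y + ?K y x * indicator (- E) y * indicator E x \<partial>lborel) \<partial>lborel)"
    unfolding gagliardo_def using p
    by (intro nn_integral_cong) (auto simp: abs_minus_commute split: split_indicator)
  also have "\<dots> = (\<integral>\<^sup>+y. (\<integral>\<^sup>+x. ?K x y * indicator (- E) x * indicator E y \<partial>lborel)
      + (\<integral>\<^sup>+x. ?K y x * indicator (- E) y * indicator E x \<partial>lborel) \<partial>lborel)"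
    by (intro nn_integral_cong nn_integral_add) auto
  also have "\<dots> = (\<integral>\<^sup>+y. (\<integral>\<^sup>+x. ?K x y * indicator (- E) x * indicator E y \<partial>lborel) \<partial>lborel)
      + (\<integral>\<^sup>+y. (\<integral>\<^sup>+x. ?K y x * indicator (- E) y * indicator E x \<partial>lborel) \<partial>lborel)"
    by (intro nn_integral_add) auto
  also have "(\<integral>\<^sup>+y. (\<integral>\<^sup>+x. ?K y x * indicator (- E) y * indicator E x \<partial>lborel) \<partial>lborel)
      = (\<integral>\<^sup>+x. (\<integral>\<^sup>+y. ?K y x * indicator (- E) y * indicator E x \<partial>lborel) \<partial>lborel)"
    by (rule lborel_pair.Fubini') measurable
  finally show ?thesis
    by (simp add: mult_2 nn_integral_multc)
qed

lemma nn_integral_kernel_right: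
  assumes "0 < q" "y < b"
  shows "(\<integral>\<^sup>+x\<in>{b..}. ennreal (1 / \<bar>x - y\<bar> powr (1 + q)) \<partial>lborel) = ennreal ((b - y) powr - q / q)"
proof -
  have "(\<integral>\<^sup>+x\<in>{b..}. ennreal (1 / \<bar>x - y\<bar> powr (1 + q)) \<partial>lborel)
     = (\<integral>\<^sup>+x. ennreal (1 / \<bar>y + 1 * x - y\<bar> powr (1 + q)) * indicator {b..} (y + 1 * x) \<partial>lborel)"
    by (subst nn_integral_real_affine[where c=1 and t=y]) simp_all
  also have "\<dots> = (\<integral>\<^sup>+x\<in>{b - y<..}. ennreal (x powr (- 1 - q)) \<partial>lborel)"
  proof (rule nn_integral_cong_AE)
    have *: "1 / x powr (1 + q) = x powr (-1 - q)" for x :: real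
      using powr_minus_divide[of x "1 + q"] by (metis diff_conv_add_uminus minus_add_distrib)
    show "AE x in lborel. ennreal (1 / \<bar>y + 1 * x - y\<bar> powr (1 + q)) * indicator {b..} (y + 1 * x) = ennreal (x powr (- 1 - q)) * indicator {b - y<..} x"
      using AE_lborel_singleton[of "b - y"]
      by eventually_elim (use assms in \<open>auto simp: * split: split_indicator\<close>)
  qed
  also have "\<dots> = ennreal ((b - y) powr (- 1 - q + 1) / (- (- 1 - q) - 1))"
    using assms by (intro nn_integral_powr_to_inf) auto
  finally show ?thesis by simp
qed

lemma nn_integral_reflect:
  fixes f :: "real \<Rightarrow> ennreal"
  assumes [measurable]: "f \<in> borel_measurable borel"
  shows "(\<integral>\<^sup>+x. f (- x) \<partial>lborel) = (\<integral>\<^sup>+x. f x \<partial>lborel)"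
  using nn_integral_real_affine[of f "-1" 0] by simp

lemma nn_integral_kernel_left:
  assumes "0 < q" "a < y"
  shows "(\<integral>\<^sup>+x\<in>{..a}. ennreal (1 / \<bar>x - y\<bar> powr (1 + q)) \<partial>lborel) = ennreal ((y - a) powr - q / q)"
proof -
  have "(\<integral>\<^sup>+x\<in>{..a}. ennreal (1 / \<bar>x - y\<bar> powr (1 + q)) \<partial>lborel)
     = (\<integral>\<^sup>+x. ennreal (1 / \<bar>- x - y\<bar> powr (1 + q)) * indicator {..a} (- x) \<partial>lborel)"
    by (rule nn_integral_reflect[symmetric]) simp
  also have "\<dots> = (\<integral>\<^sup>+x\<in>{- a..}. ennreal (1 / \<bar>x - (- y)\<bar> powr (1 + q)) \<partial>lborel)"
  proof (intro nn_integral_cong)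
    fix x :: real
    have "\<bar>- x - y\<bar> = \<bar>x - (- y)\<bar>" by linarith
    then show "ennreal (1 / \<bar>- x - y\<bar> powr (1 + q)) * indicator {..a} (- x) = ennreal (1 / \<bar>x - (- y)\<bar> powr (1 + q)) * indicator {- a..} x"
      by (auto split: split_indicator)
  qed
  also have "\<dots> = ennreal ((y - a) powr - q / q)"
    using assms by (subst nn_integral_kernel_right) auto
  finally show ?thesis .
qed

lemma nn_integral_left_end:
  assumes "0 < q" "q < 1" "a \<le> b"
  shows "(\<integral>\<^sup>+y\<in>{a<..<b}. ennreal ((y - a) powr - q) \<partial>lborel) = ennreal ((b - a) powr (1 - q) / (1 - q))"
proof -
  have "(\<integral>\<^sup>+y\<in>{a<..<b}. ennreal ((y - a) powr - q) \<partial>lborel)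
    = (\<integral>\<^sup>+y. ennreal ((a + 1 * y - a) powr - q) * indicator {a<..<b} (a + 1 * y) \<partial>lborel)"
    by (subst nn_integral_real_affine[where c=1 and t=a]) simp_all
  also have "\<dots> = (\<integral>\<^sup>+y\<in>{0<..<b - a}. ennreal (y powr - q) \<partial>lborel)"
    by (intro nn_integral_cong) (auto split: split_indicator)
  also have "\<dots> = ennreal ((b - a) powr (- q + 1) / (- q + 1))"
    using assms by (intro nn_integral_powr_from_0) auto
  finally show ?thesis by (simp add: add.commute)
qed

lemma nn_integral_right_end:
  assumes "0 < q" "q < 1" "a \<le> b"
  shows "(\<integral>\<^sup>+y\<in>{a<..<b}. ennreal ((b - y) powr - q) \<partial>lborel) = ennreal ((b - a) powr (1 - q) / (1 - q))"
proof -
  have "(\<integral>\<^sup>+y\<in>{a<..<b}. ennreal ((b - y) powr - q) \<partial>lborel)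
    = (\<integral>\<^sup>+y. ennreal ((b - (- y)) powr - q) * indicator {a<..<b} (- y) \<partial>lborel)"
    by (rule nn_integral_reflect[symmetric]) simp
  also have "\<dots> = (\<integral>\<^sup>+y\<in>{- b<..<- a}. ennreal ((y - (- b)) powr - q) \<partial>lborel)"
    by (intro nn_integral_cong) (auto simp: add.commute split: split_indicator)
  also have "\<dots> = ennreal ((b - a) powr (1 - q) / (1 - q))"
    using assms by (subst nn_integral_left_end) auto
  finally show ?thesis .
qed

lemma gagliardo_interval:
  assumes q: "0 < s * p" "s * p < 1" and p: "0 < p" and ab: "a \<le> b"
  shows "gagliardo s p (indicator {a<..<b}) = ennreal (4 * (b - a) powr (1 - s * p) / (s * p * (1 - s * p)))"
proof -
  let ?q = "s * p"
  have double: "2 * (ennreal A * (ennreal X + ennreal X)) = ennreal (2 * (A * (X + X)))" if "0 \<le> A" "0 \<le> X" for A X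
  proof -
    have "ennreal (2 * (A * (X + X))) = ennreal 2 * (ennreal A * ennreal (X + X))"
      using that by (simp only: ennreal_mult mult_nonneg_nonneg add_nonneg_nonneg zero_le_numeral)
    moreover have "ennreal (X + X) = ennreal X + ennreal X" using that by (intro ennreal_plus) auto
    ultimately show ?thesis by (simp only: ennreal_numeral)
  qed
  have out: "(\<integral>\<^sup>+x\<in>- {a<..<b}. ennreal (1 / \<bar>x - y\<bar> powr (1 + s * p)) \<partial>lborel) * indicator {a<..<b} y
     = ennreal (1 / ?q) * (ennreal ((y - a) powr - ?q) * indicator {a<..<b} y + ennreal ((b - y) powr - ?q) * indicator {a<..<b} y)" for y
  proof (cases "y \<in> {a<..<b}")
    case True
    have "(\<integral>\<^sup>+x\<in>- {a<..<b}. ennreal (1 / \<bar>x - y\<bar> powr (1 + s * p)) \<partial>lborel)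
       = (\<integral>\<^sup>+x. ennreal (1 / \<bar>x - y\<bar> powr (1 + s * p)) * indicator {..a} x + ennreal (1 / \<bar>x - y\<bar> powr (1 + s * p)) * indicator {b..} x \<partial>lborel)"
      using True by (intro nn_integral_cong) (auto split: split_indicator)
    also have "\<dots> = ennreal ((y - a) powr - ?q / ?q) + ennreal ((b - y) powr - ?q / ?q)"
      using True q by (subst nn_integral_add) (auto simp: nn_integral_kernel_left nn_integral_kernel_right)
    also have "\<dots> = ennreal (1 / ?q) * (ennreal ((y - a) powr - ?q) + ennreal ((b - y) powr - ?q))"
      using q by (simp add: distrib_left ennreal_mult[symmetric])
    finally show ?thesis using True by simp
  qed simp
  have "gagliardo s p (indicator {a<..<b}) = 2 * (ennreal (1 / ?q) * (ennreal ((b - a) powr (1 - ?q) / (1 - ?q)) + ennreal ((b - a) powr (1 - ?q) / (1 - ?q))))"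
    using q ab by (subst gagliardo_indicator)
      (simp_all add: p out nn_integral_cmult nn_integral_add nn_integral_left_end nn_integral_right_end)
  also have "\<dots> = ennreal (2 * (1 / ?q * ((b - a) powr (1 - ?q) / (1 - ?q) + (b - a) powr (1 - ?q) / (1 - ?q))))"
    using q by (intro double) auto
  also have "2 * (1 / ?q * ((b - a) powr (1 - ?q) / (1 - ?q) + (b - a) powr (1 - ?q) / (1 - ?q))) = 4 * (b - a) powr (1 - ?q) / (?q * (1 - ?q))"
    by simp
  finally show ?thesis .
qed

lemma measurable_pairs_radius[measurable]:
  assumes [measurable]: "A \<in> sets borel" "B \<in> sets borel"
  shows "(\<lambda>r. pairs_closer r A B) \<in> borel_measurable borel" "(\<lambda>r. pairs_apart r A B) \<in> borel_measurable borel"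
proof -
  have "(\<lambda>r. \<integral>\<^sup>+x. \<integral>\<^sup>+y. (if x \<in> A \<and> y \<in> B \<and> \<bar>x - y\<bar> < r then 1 else 0) \<partial>lborel \<partial>lborel) \<in> borel_measurable borel"
    by measurable
  also have "(\<lambda>r. \<integral>\<^sup>+x. \<integral>\<^sup>+y. (if x \<in> A \<and> y \<in> B \<and> \<bar>x - y\<bar> < r then 1 else 0) \<partial>lborel \<partial>lborel) = (\<lambda>r. pairs_closer r A B)"
    unfolding pairs_closer_def by (intro ext nn_integral_cong) (auto split: split_indicator)
  finally show "(\<lambda>r. pairs_closer r A B) \<in> borel_measurable borel" .
  have "(\<lambda>r. \<integral>\<^sup>+x. \<integral>\<^sup>+y. (if x \<in> A \<and> y \<in> B \<and> \<not> \<bar>x - y\<bar> < r then 1 else 0) \<partial>lborel \<partial>lborel) \<in> borel_measurable borel"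
    by measurable
  also have "(\<lambda>r. \<integral>\<^sup>+x. \<integral>\<^sup>+y. (if x \<in> A \<and> y \<in> B \<and> \<not> \<bar>x - y\<bar> < r then 1 else 0) \<partial>lborel \<partial>lborel) = (\<lambda>r. pairs_apart r A B)"
    unfolding pairs_apart_def by (intro ext nn_integral_cong) (auto split: split_indicator)
  finally show "(\<lambda>r. pairs_apart r A B) \<in> borel_measurable borel" .
qed

lemma gagliardo_set:
  assumes E[measurable]: "E \<in> sets borel" and s: "0 < s"
  shows "gagliardo s 1 (indicator E) = 2 * (\<integral>\<^sup>+r\<in>{0<..}. ennreal ((1 + s) * r powr (-2 - s)) * pairs_closer r E (- E) \<partial>lborel)"
proof -
  have "trunc_energy 0 r (indicator E) = 2 * pairs_closer r E (- E)" for r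
  proof -
    have "(\<integral>\<^sup>+\<tau>\<in>{0..}. pairs_closer r {x. \<tau> + 0 < indicat_real E x} (- {x. \<tau> < indicat_real E x}) \<partial>lborel)
       = (\<integral>\<^sup>+\<tau>. pairs_closer r E (- E) * indicator {0..<1::real} \<tau> \<partial>lborel)"
    proof (intro nn_integral_cong)
      fix \<tau> :: real
      have "0 \<le> \<tau> \<Longrightarrow> {x. \<tau> < indicat_real E x} = (if \<tau> < 1 then E else {})"
        by (auto split: split_indicator)
      then show "pairs_closer r {x. \<tau> + 0 < indicat_real E x} (- {x. \<tau> < indicat_real E x}) * indicator {0..} \<tau>
        = pairs_closer r E (- E) * indicator {0..<1} \<tau>"
        by (auto simp: pairs_closer_def split: split_indicator)
    qed
    also have "\<dots> = pairs_closer r E (- E)" by (simp add: nn_integral_cmult)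
    finally show ?thesis by (subst trunc_energy_layer) auto
  qed
  then have "gagliardo s 1 (indicator E) = (\<integral>\<^sup>+r. 2 * (ennreal ((1 + s) * r powr (-2 - s)) * pairs_closer r E (- E) * indicator {0<..} r) \<partial>lborel)"
    using s by (subst gagliardo_layer) (auto simp: near_energy_1 mult.left_commute mult.assoc intro!: nn_integral_cong)
  then show ?thesis by (simp add: nn_integral_cmult)
qed

text \<open>For \<open>p = 1\<close> the layers in the jump disappear and only superlevel sets remain.\<close>

lemma gagliardo_coarea:
  assumes [measurable]: "u \<in> borel_measurable borel" and s: "0 < s"
  shows "gagliardo s 1 (\<lambda>x. \<bar>u x\<bar>) = (\<integral>\<^sup>+\<tau>\<in>{0..}. gagliardo s 1 (indicator {x. \<tau> < \<bar>u x\<bar>}) \<partial>lborel)"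
proof -
  let ?k = "\<lambda>r. ennreal ((1 + s) * r powr (-2 - s)) * indicator {0<..} r :: ennreal"
  let ?P = "\<lambda>r \<tau>. pairs_closer r {x. \<tau> < \<bar>u x\<bar>} (- {x. \<tau> < \<bar>u x\<bar>})"
  have [measurable]: "(\<lambda>z. ?P (fst z) (snd z)) \<in> borel_measurable (borel \<Otimes>\<^sub>M borel)"
  proof -
    have "(\<lambda>z. \<integral>\<^sup>+x. \<integral>\<^sup>+y. (if snd z < \<bar>u x\<bar> \<and> \<not> snd z < \<bar>u y\<bar> \<and> \<bar>x - y\<bar> < fst z then 1 else 0) \<partial>lborel \<partial>lborel) \<in> borel_measurable (borel \<Otimes>\<^sub>M borel)"
      by measurable
    also have "(\<lambda>z. \<integral>\<^sup>+x. \<integral>\<^sup>+y. (if snd z < \<bar>u x\<bar> \<and> \<not> snd z < \<bar>u y\<bar> \<and> \<bar>x - y\<bar> < fst z then 1 else 0) \<partial>lborel \<partial>lborel) = (\<lambda>z. ?P (fst z) (snd z))"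
      unfolding pairs_closer_def by (intro ext nn_integral_cong) (auto split: split_indicator)
    finally show ?thesis .
  qed
  have [measurable]: "(\<lambda>z. ?P (snd z) (fst z)) \<in> borel_measurable (borel \<Otimes>\<^sub>M borel)"
    using measurable_compose[OF measurable_pair_swap', of "\<lambda>z. ?P (fst z) (snd z)"] by (simp add: split_beta')
  have P1[measurable]: "(\<lambda>\<tau>. ?P r \<tau>) \<in> borel_measurable borel" for r
    using measurable_compose[of "\<lambda>\<tau>. (r, \<tau>)" borel "borel \<Otimes>\<^sub>M borel" "\<lambda>z. ?P (fst z) (snd z)" borel] by simp
  have P2[measurable]: "(\<lambda>r. ?P r \<tau>) \<in> borel_measurable borel" for \<tau>
    using measurable_compose[of "\<lambda>r. (r, \<tau>)" borel "borel \<Otimes>\<^sub>M borel" "\<lambda>z. ?P (fst z) (snd z)" borel] by simp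
  have "gagliardo s 1 (\<lambda>x. \<bar>u x\<bar>) = (\<integral>\<^sup>+r. ?k r * (2 * (\<integral>\<^sup>+\<tau>. ?P r \<tau> * indicator {0..} \<tau> \<partial>lborel)) \<partial>lborel)"
    using s by (subst gagliardo_layer) (auto simp: near_energy_1 trunc_energy_layer intro!: nn_integral_cong split: split_indicator)
  also have "\<dots> = (\<integral>\<^sup>+r. \<integral>\<^sup>+\<tau>. ?k r * 2 * (?P r \<tau> * indicator {0..} \<tau>) \<partial>lborel \<partial>lborel)"
    by (intro nn_integral_cong, subst nn_integral_cmult) (auto simp: mult.assoc)
  also have "\<dots> = (\<integral>\<^sup>+\<tau>. \<integral>\<^sup>+r. ?k r * 2 * (?P r \<tau> * indicator {0..} \<tau>) \<partial>lborel \<partial>lborel)"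
    by (rule lborel_pair.Fubini') (simp add: split_beta')
  also have "\<dots> = (\<integral>\<^sup>+\<tau>. (2 * (\<integral>\<^sup>+r. ?k r * ?P r \<tau> \<partial>lborel)) * indicator {0..} \<tau> \<partial>lborel)"
  proof (intro nn_integral_cong)
    fix \<tau>
    have "(\<integral>\<^sup>+r. ?k r * 2 * (?P r \<tau> * indicator {0..} \<tau>) \<partial>lborel) = (\<integral>\<^sup>+r. 2 * indicator {0..} \<tau> * (?k r * ?P r \<tau>) \<partial>lborel)"
      by (intro nn_integral_cong) (simp add: mult.commute mult.left_commute mult.assoc split: split_indicator)
    also have "\<dots> = 2 * indicator {0..} \<tau> * (\<integral>\<^sup>+r. ?k r * ?P r \<tau> \<partial>lborel)"
      by (rule nn_integral_cmult) simp
    finally show "(\<integral>\<^sup>+r. ?k r * 2 * (?P r \<tau> * indicator {0..} \<tau>) \<partial>lborel) = (2 * (\<integral>\<^sup>+r. ?k r * ?P r \<tau> \<partial>lborel)) * indicator {0..} \<tau>"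
      by (simp split: split_indicator)
  qed
  also have "\<dots> = (\<integral>\<^sup>+\<tau>\<in>{0..}. gagliardo s 1 (indicator {x. \<tau> < \<bar>u x\<bar>}) \<partial>lborel)"
  proof (intro nn_integral_cong)
    fix \<tau>
    have "(\<integral>\<^sup>+r. ?k r * ?P r \<tau> \<partial>lborel) = (\<integral>\<^sup>+r\<in>{0<..}. ennreal ((1 + s) * r powr (-2 - s)) * ?P r \<tau> \<partial>lborel)"
      by (intro nn_integral_cong) (simp split: split_indicator)
    then show "2 * (\<integral>\<^sup>+r. ?k r * ?P r \<tau> \<partial>lborel) * indicator {0..} \<tau> = gagliardo s 1 (indicator {x. \<tau> < \<bar>u x\<bar>}) * indicator {0..} \<tau>"
      using s by (simp add: gagliardo_set)
  qed
  finally show ?thesis .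
qed

text \<open>The isoperimetric inequality together with its deficit: how much the perimeter exceeds that of an
  interval is controlled from below by the pairs of points of \<open>E\<close> further apart than \<open>m\<close>.\<close>

lemma perimeter_deficit:
  assumes E[measurable]: "E \<in> sets borel" and mE: "emeasure lborel E = ennreal m" and m: "0 \<le> m" and s: "0 < s" "s < 1"
  shows "ennreal (4 * m powr (1 - s) / (s * (1 - s))) +
      2 * (\<integral>\<^sup>+r\<in>{m<..}. ennreal ((1 + s) * r powr (-2 - s)) * pairs_apart r E E \<partial>lborel) \<le> gagliardo s 1 (indicator E)"
proof -
  let ?k = "\<lambda>r. ennreal ((1 + s) * r powr (-2 - s))"
  have "ennreal (4 * m powr (1 - s) / (s * (1 - s))) = gagliardo s 1 (indicator (centered m))"
    unfolding centered_def using s m by (subst gagliardo_interval) auto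
  also have "\<dots> = 2 * (\<integral>\<^sup>+r\<in>{0<..}. ?k r * pairs_closer r (centered m) (- centered m) \<partial>lborel)"
    by (rule gagliardo_set) (use s in auto)
  finally have "ennreal (4 * m powr (1 - s) / (s * (1 - s))) + 2 * (\<integral>\<^sup>+r\<in>{m<..}. ?k r * pairs_apart r E E \<partial>lborel)
    = 2 * (\<integral>\<^sup>+r. ?k r * pairs_closer r (centered m) (- centered m) * indicator {0<..} r + ?k r * pairs_apart r E E * indicator {m<..} r \<partial>lborel)"
    by (subst nn_integral_add) (auto simp: distrib_left)
  also have "\<dots> \<le> 2 * (\<integral>\<^sup>+r\<in>{0<..}. ?k r * pairs_closer r E (- E) \<partial>lborel)"
  proof (intro mult_left_mono nn_integral_mono)
    fix r :: real
    show "?k r * pairs_closer r (centered m) (- centered m) * indicator {0<..} r + ?k r * pairs_apart r E E * indicator {m<..} r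
       \<le> ?k r * pairs_closer r E (- E) * indicator {0<..} r"
    proof (cases "m < r")
      case True
      then show ?thesis using riesz_deficit[OF E mE m True] m by (simp add: distrib_left)
    next
      case False
      then show ?thesis using riesz_centered[OF E E mE mE m order_refl, of r]
        by (auto intro!: mult_left_mono split: split_indicator)
    qed
  qed simp
  also have "\<dots> = gagliardo s 1 (indicator E)"
    using s by (simp add: gagliardo_set)
  finally show ?thesis .
qed

section \<open>Smooth mollifiers\<close>

text \<open>The functions \<open>Q (1 / x) * exp (- 1 / x)\<close> for a polynomial \<open>Q\<close>, extended by \<open>0\<close>, form a family that
  is closed under differentiation. This makes all derivatives of the standard bump accessible at once.\<close>

definition flat_exp :: "real poly \<Rightarrow> real \<Rightarrow> real" where
  "flat_exp Q x = (if x \<le> 0 then 0 else poly Q (1 / x) * exp (- (1 / x)))"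

lemma poly_exp_tendsto_0: "((\<lambda>y. poly Q y * exp (- y)) \<longlongrightarrow> (0::real)) at_top"
proof -
  have "((\<lambda>y. \<Sum>i\<le>degree Q. coeff Q i * (y ^ i / exp y)) \<longlongrightarrow> (\<Sum>i\<le>degree Q. coeff Q i * 0)) at_top"
    by (intro tendsto_intros tendsto_power_div_exp_0)
  moreover have "(\<Sum>i\<le>degree Q. coeff Q i * (y ^ i / exp y)) = poly Q y * exp (- y)" for y :: real
    unfolding poly_altdef sum_distrib_right by (intro sum.cong) (auto simp: exp_minus field_simps)
  ultimately show ?thesis by simp
qed

lemma flat_tendsto_0: "((\<lambda>x. poly Q (1 / x) * exp (- (1 / x))) \<longlongrightarrow> (0::real)) (at_right 0)"
  using filterlim_compose[OF poly_exp_tendsto_0 filterlim_inverse_at_top_right] by (simp add: inverse_eq_divide)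

lemma flat_deriv: "(flat_exp Q has_field_derivative flat_exp ([:0, 0, 1:] * (Q - pderiv Q)) x) (at x)"
proof -
  consider "x < 0" | "x = 0" | "x > 0" by linarith
  then show ?thesis
  proof cases
    case 1
    have "((\<lambda>_. 0) has_field_derivative 0) (at x)" by simp
    then have "(flat_exp Q has_field_derivative 0) (at x)"
      by (rule DERIV_cong_ev[THEN iffD1, rotated -1])
        (use 1 eventually_nhds_in_open[of "{..<0}" x] in \<open>auto simp: flat_exp_def elim!: eventually_mono\<close>)
    then show ?thesis using 1 by (simp add: flat_exp_def)
  next
    case 3
    have "((\<lambda>x. poly Q (1 / x) * exp (- (1 / x))) has_field_derivative
        flat_exp ([:0, 0, 1:] * (Q - pderiv Q)) x) (at x)"
      using 3 by (auto intro!: derivative_eq_intros DERIV_chain2[OF poly_DERIV]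
        simp: flat_exp_def power2_eq_square field_simps)
    then show ?thesis
      by (rule DERIV_cong_ev[THEN iffD1, rotated -1])
        (use 3 eventually_nhds_in_open[of "{0<..}" x] in \<open>auto simp: flat_exp_def elim!: eventually_mono\<close>)
  next
    case 2
    have "((\<lambda>h. flat_exp Q h / h) \<longlongrightarrow> 0) (at_left 0)"
      by (rule tendsto_cong[THEN iffD1, OF _ tendsto_const[of 0]])
        (auto simp: flat_exp_def eventually_at_filter)
    moreover have "((\<lambda>h. flat_exp Q h / h) \<longlongrightarrow> 0) (at_right 0)"
      by (rule tendsto_cong[THEN iffD1, OF _ flat_tendsto_0[of "[:0, 1:] * Q"]])
        (auto simp: flat_exp_def eventually_at_filter)
    ultimately have "((\<lambda>h. flat_exp Q h / h) \<longlongrightarrow> 0) (at 0)"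
      by (rule filterlim_split_at)
    then have "(flat_exp Q has_field_derivative 0) (at 0)"
      by (simp add: has_field_derivative_iff flat_exp_def)
    then show ?thesis using 2 by (simp add: flat_exp_def)
  qed
qed

text \<open>Finite sums of products of two such functions, one for each end of \<open>[-\<delta>, \<delta>]\<close>. The products
  alone are not closed under differentiation; the sums are, by the Leibniz rule.\<close>

inductive_set bumps :: "real \<Rightarrow> (real \<Rightarrow> real) set" for \<delta> :: real where
  base: "(\<lambda>x. flat_exp Q (\<delta> + x) * flat_exp R (\<delta> - x)) \<in> bumps \<delta>"
| add: "f \<in> bumps \<delta> \<Longrightarrow> g \<in> bumps \<delta> \<Longrightarrow> (\<lambda>x. f x + g x) \<in> bumps \<delta>"

lemma bumps_deriv:
  assumes "f \<in> bumps \<delta>"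
  shows "\<exists>g\<in>bumps \<delta>. \<forall>x. (f has_field_derivative g x) (at x)"
  using assms
proof induction
  case (base Q R)
  \<comment> \<open>differentiation acts on the polynomial in \<open>1 / x\<close> by this
    operator\<close>
  let ?D = "\<lambda>Q. [:0, 0, 1:] * (Q - pderiv Q)"
  have neg: "flat_exp (- S) x = - flat_exp S x" for S x by (simp add: flat_exp_def)
  let ?g = "\<lambda>x. flat_exp (?D Q) (\<delta> + x) * flat_exp R (\<delta> - x) + flat_exp Q (\<delta> + x) * flat_exp (- ?D R) (\<delta> - x)"
  have "((\<lambda>x. flat_exp Q (\<delta> + x) * flat_exp R (\<delta> - x)) has_field_derivative ?g x) (at x)" for x
  proof -
    have 1: "((\<lambda>x. flat_exp Q (\<delta> + x)) has_field_derivative flat_exp (?D Q) (\<delta> + x) * (0 + 1)) (at x)"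
      by (rule DERIV_chain2[OF flat_deriv]) (auto intro!: derivative_eq_intros)
    have 2: "((\<lambda>x. flat_exp R (\<delta> - x)) has_field_derivative flat_exp (?D R) (\<delta> - x) * (0 - 1)) (at x)"
      by (rule DERIV_chain2[OF flat_deriv]) (auto intro!: derivative_eq_intros)
    from DERIV_mult[OF 1 2] show ?thesis unfolding neg
      by (rule DERIV_cong) (simp only: add_0 diff_0 mult_1_right mult_minus_right mult_minus_left, simp add: mult.commute)
  qed
  moreover have "?g \<in> bumps \<delta>" by (intro bumps.intros)
  ultimately show ?case by (intro bexI[of _ ?g]) auto
next
  case (add f g)
  then obtain f' g' where "f' \<in> bumps \<delta>" "g' \<in> bumps \<delta>"
    "\<And>x. (f has_field_derivative f' x) (at x)" "\<And>x. (g has_field_derivative g' x) (at x)" by blast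
  then show ?case
    by (intro bexI[of _ "\<lambda>x. f' x + g' x"]) (auto intro: bumps.intros DERIV_add)
qed

lemma bumps_deriv_mem:
  assumes "f \<in> bumps \<delta>"
  shows "deriv f \<in> bumps \<delta>" and "(f has_field_derivative deriv f x) (at x)"
proof -
  obtain g where g: "g \<in> bumps \<delta>" "\<And>x. (f has_field_derivative g x) (at x)"
    using bumps_deriv[OF assms] by blast
  then have "deriv f = g" by (intro ext DERIV_imp_deriv)
  then show "deriv f \<in> bumps \<delta>" "(f has_field_derivative deriv f x) (at x)" using g by auto
qed

lemma bumps_isCont: "f \<in> bumps \<delta> \<Longrightarrow> isCont f x"
  using bumps_deriv_mem(2) DERIV_isCont by blast

lemma bumps_borel[measurable_dest]: "f \<in> bumps \<delta> \<Longrightarrow> f \<in> borel_measurable borel"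
  by (intro borel_measurable_continuous_onI) (simp add: continuous_at_imp_continuous_on bumps_isCont)

lemma bumps_support: "f \<in> bumps \<delta> \<Longrightarrow> \<delta> \<le> \<bar>x\<bar> \<Longrightarrow> f x = 0"
  by (induction rule: bumps.induct) (auto simp: flat_exp_def)

lemma bumps_bounded:
  assumes "f \<in> bumps \<delta>"
  obtains C where "0 \<le> C" "\<And>x. \<bar>f x\<bar> \<le> C"
proof -
  have "compact (f ` {-\<delta>..\<delta>})"
    by (intro compact_continuous_image continuous_at_imp_continuous_on) (auto intro: bumps_isCont[OF assms])
  then obtain C where C: "\<And>x. x \<in> {-\<delta>..\<delta>} \<Longrightarrow> \<bar>f x\<bar> \<le> C"
    using compact_imp_bounded bounded_iff by (metis image_eqI real_norm_def)
  have "\<bar>f x\<bar> \<le> max 0 C" for x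
  proof (cases "\<delta> \<le> \<bar>x\<bar>")
    case True then show ?thesis using bumps_support[OF assms] by simp
  next
    case False then show ?thesis using C[of x] by (simp add: abs_if max_def split: if_splits)
  qed
  then show ?thesis by (intro that[of "max 0 C"]) auto
qed

lemma mollifier_exists:
  assumes \<delta>: "0 < \<delta>"
  obtains \<rho> where "\<rho> \<in> bumps \<delta>" "\<And>x. 0 \<le> \<rho> x" "(\<integral>\<^sup>+x. ennreal (\<rho> x) \<partial>lborel) = 1"
proof -
  define b where "b = (\<lambda>x. flat_exp [:1:] (\<delta> + x) * flat_exp [:1:] (\<delta> - x))"
  have b: "b \<in> bumps \<delta>" unfolding b_def by (rule bumps.intros)
  have [measurable]: "b \<in> borel_measurable borel" using b by (rule bumps_borel)
  have nn: "0 \<le> b x" for x by (simp add: b_def flat_exp_def)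
  have pos: "0 < b x" if "\<bar>x\<bar> < \<delta>" for x using that by (simp add: b_def flat_exp_def abs_if split: if_splits)
  define Z where "Z = (\<integral>\<^sup>+x. ennreal (b x) \<partial>lborel)"
  obtain C where C: "0 \<le> C" "\<And>x. \<bar>b x\<bar> \<le> C" using bumps_bounded[OF b] by blast
  have "Z \<le> (\<integral>\<^sup>+x. ennreal C * indicator {-\<delta>..\<delta>} x \<partial>lborel)"
    unfolding Z_def
  proof (intro nn_integral_mono)
    fix x
    show "ennreal (b x) \<le> ennreal C * indicator {-\<delta>..\<delta>} x"
      using bumps_support[OF b, of x] C(2)[of x] nn[of x] by (auto simp: abs_if split: split_indicator intro!: ennreal_leI)
  qed
  also have "\<dots> < \<infinity>" using \<delta> by (simp add: nn_integral_cmult ennreal_mult_less_top)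
  finally have fin: "Z < \<infinity>" .
  have "Z \<noteq> 0"
  proof
    assume "Z = 0"
    then have "AE x in lborel. \<not> \<bar>x\<bar> < \<delta>"
      unfolding Z_def by (subst (asm) nn_integral_0_iff_AE) (auto elim!: eventually_mono dest: pos)
    then have "emeasure lborel {x. \<bar>x\<bar> < \<delta>} = 0" by (subst (asm) AE_iff_measurable[OF _ refl]) auto
    moreover have "{x. \<bar>x\<bar> < \<delta>} = {-\<delta><..<\<delta>}" by auto
    ultimately show False using \<delta> by simp
  qed
  then obtain z where z: "Z = ennreal z" "0 < z" using fin by (cases Z) (auto simp: zero_less_iff_neq_zero)
  define \<rho> where "\<rho> = (\<lambda>x. flat_exp [:1 / z:] (\<delta> + x) * flat_exp [:1:] (\<delta> - x))"
  have \<rho>: "\<rho> x = 1 / z * b x" for x by (simp add: \<rho>_def b_def flat_exp_def)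
  show ?thesis
  proof (rule that[of \<rho>])
    show "\<rho> \<in> bumps \<delta>" unfolding \<rho>_def by (rule bumps.intros)
    show "0 \<le> \<rho> x" for x using nn z by (simp add: \<rho>)
    have "(\<integral>\<^sup>+x. ennreal (\<rho> x) \<partial>lborel) = ennreal (1 / z) * Z"
      unfolding Z_def \<rho> using z nn by (subst nn_integral_cmult[symmetric]) (auto simp: ennreal_mult[symmetric] simp del: times_divide_eq_left)
    also have "\<dots> = 1" using z by (simp add: ennreal_mult[symmetric])
    finally show "(\<integral>\<^sup>+x. ennreal (\<rho> x) \<partial>lborel) = 1" .
  qed
qed

text \<open>Convolution. The bump carries the variable \<open>x\<close>, so that differentiation falls on it and never
  on \<open>f\<close>.\<close>

definition conv :: "(real \<Rightarrow> real) \<Rightarrow> (real \<Rightarrow> real) \<Rightarrow> real \<Rightarrow> real" where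
  "conv \<phi> f x = (\<integral>z. \<phi> (x - z) * f z \<partial>lborel)"

lemma conv_integrable:
  assumes \<phi>: "\<phi> \<in> bumps \<delta>" and f: "integrable lborel f"
  shows "integrable lborel (\<lambda>z. \<phi> (x - z) * f z)"
proof -
  have [measurable]: "\<phi> \<in> borel_measurable borel" using \<phi> by (rule bumps_borel)
  obtain C where C: "0 \<le> C" "\<And>x. \<bar>\<phi> x\<bar> \<le> C" using bumps_bounded[OF \<phi>] by blast
  show ?thesis
    by (rule Bochner_Integration.integrable_bound[of _ "\<lambda>z. C * f z"])
      (use f C in \<open>auto simp: abs_mult intro!: mult_right_mono\<close>)
qed

text \<open>The second derivative of the bump is bounded, so the error in its difference quotient is uniformly
  of order \<open>h\<close>, and so is the error after integration against \<open>f\<close>.\<close>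

lemma conv_deriv:
  assumes \<phi>: "\<phi> \<in> bumps \<delta>" and f: "integrable lborel f"
  shows "(conv \<phi> f has_field_derivative conv (deriv \<phi>) f x) (at x)"
proof -
  note d1 = bumps_deriv_mem[OF \<phi>]
  note d2 = bumps_deriv_mem[OF d1(1)]
  obtain C where C: "0 \<le> C" "\<And>x. \<bar>deriv (deriv \<phi>) x\<bar> \<le> C" using bumps_bounded[OF d2(1)] by blast
  have lip: "\<bar>deriv \<phi> a - deriv \<phi> b\<bar> \<le> C * \<bar>a - b\<bar>" for a b
  proof -
    have "norm (deriv \<phi> a - deriv \<phi> b) \<le> C * norm (a - b)"
      by (rule field_differentiable_bound[of UNIV _ "deriv (deriv \<phi>)"])
        (use d2(2) C in \<open>auto simp: has_field_derivative_at_within\<close>)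
    then show ?thesis by simp
  qed
  have taylor: "\<bar>\<phi> (a + h) - \<phi> a - h * deriv \<phi> a\<bar> \<le> C * h\<^sup>2" for a h
  proof (cases "h = 0")
    case False
    have "\<exists>\<xi>. \<bar>\<xi> - a\<bar> \<le> \<bar>h\<bar> \<and> \<phi> (a + h) - \<phi> a = h * deriv \<phi> \<xi>"
    proof (cases "0 < h")
      case True
      obtain \<xi> where "a < \<xi>" "\<xi> < a + h" "\<phi> (a + h) - \<phi> a = (a + h - a) * deriv \<phi> \<xi>"
        using MVT2[of a "a + h" \<phi> "deriv \<phi>"] d1(2) True by auto
      then show ?thesis by (intro exI[of _ \<xi>]) auto
    next
      case False
      then have "h < 0" using \<open>h \<noteq> 0\<close> by simp
      obtain \<xi> where "a + h < \<xi>" "\<xi> < a" "\<phi> a - \<phi> (a + h) = (a - (a + h)) * deriv \<phi> \<xi>"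
        using MVT2[of "a + h" a \<phi> "deriv \<phi>"] d1(2) \<open>h < 0\<close> by auto
      then show ?thesis by (intro exI[of _ \<xi>]) auto
    qed
    then obtain \<xi> where xi: "\<bar>\<xi> - a\<bar> \<le> \<bar>h\<bar>" "\<phi> (a + h) - \<phi> a = h * deriv \<phi> \<xi>" by blast
    have "\<bar>\<phi> (a + h) - \<phi> a - h * deriv \<phi> a\<bar> = \<bar>h\<bar> * \<bar>deriv \<phi> \<xi> - deriv \<phi> a\<bar>"
      unfolding xi(2) by (simp add: abs_mult[symmetric] right_diff_distrib)
    also have "\<dots> \<le> \<bar>h\<bar> * (C * \<bar>h\<bar>)"
      using lip[of \<xi> a] xi(1) C(1) by (intro mult_left_mono) (auto intro: order_trans[OF _ mult_left_mono])
    also have "\<dots> = C * h\<^sup>2" by (simp add: power2_eq_square)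
    finally show ?thesis .
  qed simp
  define F where "F = (\<integral>z. \<bar>f z\<bar> \<partial>lborel)"
  have quot: "\<bar>(conv \<phi> f (x + h) - conv \<phi> f x) / h - conv (deriv \<phi>) f x\<bar> \<le> C * F * \<bar>h\<bar>" if h: "h \<noteq> 0" for h
  proof -
    have eq: "conv \<phi> f (x + h) - conv \<phi> f x - h * conv (deriv \<phi>) f x
       = (\<integral>z. \<phi> (x + h - z) * f z - \<phi> (x - z) * f z - h * (deriv \<phi> (x - z) * f z) \<partial>lborel)"
      unfolding conv_def using conv_integrable[OF \<phi> f] conv_integrable[OF d1(1) f]
      by simp
    have "\<bar>conv \<phi> f (x + h) - conv \<phi> f x - h * conv (deriv \<phi>) f x\<bar> \<le> (\<integral>z. C * h\<^sup>2 * \<bar>f z\<bar> \<partial>lborel)"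
      unfolding eq
    proof (rule order_trans[OF integral_abs_bound integral_mono])
      fix z
      have "\<phi> (x + h - z) * f z - \<phi> (x - z) * f z - h * (deriv \<phi> (x - z) * f z)
         = (\<phi> ((x - z) + h) - \<phi> (x - z) - h * deriv \<phi> (x - z)) * f z"
        by (simp add: algebra_simps)
      then show "\<bar>\<phi> (x + h - z) * f z - \<phi> (x - z) * f z - h * (deriv \<phi> (x - z) * f z)\<bar> \<le> C * h\<^sup>2 * \<bar>f z\<bar>"
        using taylor[of "x - z" h] by (simp add: abs_mult mult_right_mono)
    qed (use f conv_integrable[OF \<phi> f] conv_integrable[OF d1(1) f] in auto)
    also have "\<dots> = C * F * h\<^sup>2" by (simp add: F_def)
    finally have *: "\<bar>conv \<phi> f (x + h) - conv \<phi> f x - h * conv (deriv \<phi>) f x\<bar> \<le> C * F * h\<^sup>2" .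
    have "\<bar>(conv \<phi> f (x + h) - conv \<phi> f x) / h - conv (deriv \<phi>) f x\<bar>
       = \<bar>conv \<phi> f (x + h) - conv \<phi> f x - h * conv (deriv \<phi>) f x\<bar> / \<bar>h\<bar>"
      using h by (simp add: abs_divide[symmetric] diff_divide_distrib)
    also have "\<dots> \<le> C * F * h\<^sup>2 / \<bar>h\<bar>" by (intro divide_right_mono *) auto
    also have "\<dots> = C * F * \<bar>h\<bar>" using h by (simp add: power2_eq_square abs_if)
    finally show ?thesis .
  qed
  have "((\<lambda>h. (conv \<phi> f (x + h) - conv \<phi> f x) / h - conv (deriv \<phi>) f x) \<longlongrightarrow> 0) (at 0)"
  proof (rule Lim_null_comparison)
    show "((\<lambda>h. C * F * \<bar>h\<bar>) \<longlongrightarrow> 0) (at 0)"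
      by (rule tendsto_eq_intros refl tendsto_rabs_zero | simp)+
    show "eventually (\<lambda>h. norm ((conv \<phi> f (x + h) - conv \<phi> f x) / h - conv (deriv \<phi>) f x) \<le> C * F * \<bar>h\<bar>) (at 0)"
      using quot by (auto simp: eventually_at_filter)
  qed
  then show ?thesis
    by (simp add: DERIV_def LIM_zero_iff)
qed

lemma conv_smooth:
  assumes "\<phi> \<in> bumps \<delta>" and f: "integrable lborel f"
  shows "(deriv ^^ k) (conv \<phi> f) differentiable_on UNIV"
proof -
  have "\<exists>\<psi>\<in>bumps \<delta>. (deriv ^^ k) (conv \<phi> f) = conv \<psi> f"
  proof (induction k)
    case (Suc k)
    then obtain \<psi> where "\<psi> \<in> bumps \<delta>" and eq: "(deriv ^^ k) (conv \<phi> f) = conv \<psi> f" by blast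
    then have "deriv (conv \<psi> f) = conv (deriv \<psi>) f"
      by (intro ext DERIV_imp_deriv conv_deriv[OF _ f])
    then show ?case using bumps_deriv_mem(1)[OF \<open>\<psi> \<in> bumps \<delta>\<close>] eq by auto
  qed (use assms in auto)
  then obtain \<psi> where "\<psi> \<in> bumps \<delta>" "(deriv ^^ k) (conv \<phi> f) = conv \<psi> f" by blast
  then show ?thesis
    using conv_deriv[OF _ f] by (auto simp: differentiable_on_def real_differentiable_def intro!: differentiable_at_withinI)
qed

lemma conv_support:
  assumes "\<phi> \<in> bumps \<delta>" and "conv \<phi> f x \<noteq> 0"
  shows "\<exists>z. \<bar>x - z\<bar> < \<delta> \<and> f z \<noteq> 0"
proof (rule ccontr)
  assume "\<not> ?thesis"
  then have "\<phi> (x - z) * f z = 0" for z using bumps_support[OF assms(1), of "x - z"] by fastforce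
  then have "(\<lambda>z. \<phi> (x - z) * f z) = (\<lambda>_. 0)" by blast
  then have "conv \<phi> f x = 0" unfolding conv_def by simp
  then show False using assms by simp
qed

section \<open>Mollification and cutoff do not increase the seminorm much\<close>

lemma powr_above_tangent:
  fixes a t p :: real
  assumes p: "1 \<le> p" and a: "0 < a" and t: "0 \<le> t"
  shows "a powr p + p * a powr (p - 1) * (t - a) \<le> t powr p"
proof (cases "t = 0")
  case True
  have "a * a powr (p - 1) = a powr p" using powr_mult_base[of a "p - 1"] a by simp
  then show ?thesis using True p a by (simp add: algebra_simps)
next
  case False
  have "((\<lambda>x. x powr p) has_real_derivative p * a powr (p - 1)) (at a within {0<..})"
    by (rule has_field_derivative_at_within[OF has_real_derivative_powr[OF a]])
  then have "t powr p - a powr p \<ge> p * a powr (p - 1) * (t - a)"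
    by (rule convex_on_imp_above_tangent[OF powr_convex[OF p], rotated -1])
      (use a t False in \<open>simp_all add: interior_open\<close>)
  then show ?thesis by linarith
qed

text \<open>Convexity with the weights \<open>1 - \<theta>\<close> and \<open>\<theta>\<close> at the points \<open>A / (1 - \<theta>)\<close> and \<open>B / \<theta>\<close>.
  As \<open>\<theta>\<close> tends to 0, the factor of the first term tends to 1: a perturbation \<open>B\<close> of small energy
  costs nothing in the limit.\<close>

lemma powr_add_le:
  fixes A B \<theta> p :: real
  assumes p: "1 \<le> p" and \<theta>: "0 < \<theta>" "\<theta> < 1" and AB: "0 \<le> A" "0 \<le> B"
  shows "(A + B) powr p \<le> (1 - \<theta>) powr (1 - p) * A powr p + \<theta> powr (1 - p) * B powr p"
proof (cases "A + B = 0")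
  case False
  then have a: "0 < A + B" using AB by linarith
  let ?a = "A + B" let ?c = "p * (A + B) powr (p - 1)"
  have sc: "c * (X / c) powr p = c powr (1 - p) * X powr p" if "0 < c" "0 \<le> X" for c X :: real
    using that by (simp add: powr_divide powr_diff)
  have "(1 - \<theta>) * (?a powr p + ?c * (A / (1 - \<theta>) - ?a)) \<le> (1 - \<theta>) * (A / (1 - \<theta>)) powr p"
    using \<theta> AB by (intro mult_left_mono powr_above_tangent p a) auto
  moreover have "\<theta> * (?a powr p + ?c * (B / \<theta> - ?a)) \<le> \<theta> * (B / \<theta>) powr p"
    using \<theta> AB by (intro mult_left_mono powr_above_tangent p a) auto
  moreover have "(1 - \<theta>) * (X + Y * (A / (1 - \<theta>) - ?a)) + \<theta> * (X + Y * (B / \<theta> - ?a)) = X" for X Y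
  proof -
    have "(1 - \<theta>) * (X + Y * (A / (1 - \<theta>) - ?a)) = (1 - \<theta>) * X + Y * (A - (1 - \<theta>) * ?a)"
      using \<theta> by (simp add: field_simps)
    moreover have "\<theta> * (X + Y * (B / \<theta> - ?a)) = \<theta> * X + Y * (B - \<theta> * ?a)"
      using \<theta> by (simp add: field_simps)
    ultimately show ?thesis by (simp only: right_diff_distrib left_diff_distrib) (simp add: algebra_simps)
  qed
  ultimately have "?a powr p \<le> (1 - \<theta>) * (A / (1 - \<theta>)) powr p + \<theta> * (B / \<theta>) powr p"
    by (metis add_mono)
  also have "\<dots> = (1 - \<theta>) powr (1 - p) * A powr p + \<theta> powr (1 - p) * B powr p"
    using \<theta> AB by (simp add: sc)
  finally show ?thesis .
qed simp

lemma conv_reflect: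
  assumes [measurable]: "\<phi> \<in> borel_measurable borel" "f \<in> borel_measurable borel"
  shows "conv \<phi> f x = (\<integral>z. \<phi> z * f (x - z) \<partial>lborel)"
  unfolding conv_def
  by (subst lborel_integral_real_affine[where c="-1" and t=x]) auto

lemma nn_integral_shift:
  fixes f :: "real \<Rightarrow> ennreal"
  assumes [measurable]: "f \<in> borel_measurable borel"
  shows "(\<integral>\<^sup>+x. f (x - z) \<partial>lborel) = (\<integral>\<^sup>+x. f x \<partial>lborel)"
  using nn_integral_real_affine[of f 1 "- z"] by simp

text \<open>A convolution with a probability density is an average of translates, and the seminorm is convex
  and invariant under translations.\<close>

lemma gagliardo_conv_le:
  assumes \<rho>: "\<rho> \<in> bumps \<delta>" "\<And>x. 0 \<le> \<rho> x" "(\<integral>\<^sup>+x. ennreal (\<rho> x) \<partial>lborel) = 1"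
    and f: "integrable lborel f" and p: "1 \<le> p"
  shows "gagliardo s p (conv \<rho> f) \<le> gagliardo s p f"
proof -
  have [measurable]: "\<rho> \<in> borel_measurable borel" using \<rho>(1) by (rule bumps_borel)
  have [measurable]: "f \<in> borel_measurable borel" using f by auto
  have int: "integrable lborel (\<lambda>z. \<rho> z * f (x - z))" for x
  proof -
    have "integrable lborel (\<lambda>z. \<rho> (x - z) * f z)" by (rule conv_integrable[OF \<rho>(1) f])
    then have "integrable lborel (\<lambda>z. \<rho> (x - (x + -1 * z)) * f (x + -1 * z))"
      by (rule lborel_integrable_real_affine) simp
    then show ?thesis by simp
  qed
  have jensen: "ennreal (\<bar>conv \<rho> f x - conv \<rho> f y\<bar> powr p) \<le> (\<integral>\<^sup>+z. ennreal (\<rho> z) * ennreal (\<bar>f (x - z) - f (y - z)\<bar> powr p) \<partial>lborel)" for x y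
  proof (cases "conv \<rho> f x = conv \<rho> f y")
    case False
    define a where "a = \<bar>conv \<rho> f x - conv \<rho> f y\<bar>"
    define c where "c = p * a powr (p - 1)"
    define g where "g z = \<bar>f (x - z) - f (y - z)\<bar>" for z
    have [measurable]: "g \<in> borel_measurable borel" unfolding g_def by measurable
    have a: "0 < a" using False by (simp add: a_def)
    have c: "0 \<le> c" using p by (simp add: c_def)
    let ?I = "\<integral>\<^sup>+z. ennreal (\<rho> z) * ennreal (g z powr p) \<partial>lborel"
    have "conv \<rho> f x - conv \<rho> f y = (\<integral>z. \<rho> z * (f (x - z) - f (y - z)) \<partial>lborel)"
      using int by (simp add: conv_reflect right_diff_distrib)
    moreover have "integrable lborel (\<lambda>z. \<rho> z * (f (x - z) - f (y - z)))"
      using int by (simp add: right_diff_distrib)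
    ultimately have "ennreal a \<le> (\<integral>\<^sup>+z. ennreal (norm (\<rho> z * (f (x - z) - f (y - z)))) \<partial>lborel)"
      unfolding a_def by (metis integral_norm_bound_ennreal real_norm_def)
    also have "\<dots> = (\<integral>\<^sup>+z. ennreal (\<rho> z) * ennreal (g z) \<partial>lborel)"
      by (intro nn_integral_cong) (simp add: abs_mult \<rho>(2) g_def ennreal_mult)
    finally have aG: "ennreal a \<le> (\<integral>\<^sup>+z. ennreal (\<rho> z) * ennreal (g z) \<partial>lborel)" .
    \<comment> \<open>Jensen's inequality through the tangent at \<open>a\<close>; the finite
      term \<open>c * a\<close> is added on both sides to stay within nonnegative quantities, and
      cancels at the end\<close>
    have "ennreal (c * a) + ennreal (a powr p) = ennreal (a powr p) + ennreal c * ennreal a"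
      using c a by (simp add: ennreal_mult add.commute)
    also have "\<dots> \<le> ennreal (a powr p) + ennreal c * (\<integral>\<^sup>+z. ennreal (\<rho> z) * ennreal (g z) \<partial>lborel)"
      by (intro add_left_mono mult_left_mono aG) simp
    also have "\<dots> = (\<integral>\<^sup>+z. ennreal (a powr p) * ennreal (\<rho> z) + ennreal c * (ennreal (\<rho> z) * ennreal (g z)) \<partial>lborel)"
      by (subst nn_integral_add) (auto simp: nn_integral_cmult \<rho>(3))
    also have "\<dots> \<le> (\<integral>\<^sup>+z. ennreal (\<rho> z) * ennreal (g z powr p) + ennreal (c * a) * ennreal (\<rho> z) \<partial>lborel)"
    proof (intro nn_integral_mono)
      fix z
      have "a powr p + c * (g z - a) \<le> g z powr p"
        unfolding c_def by (rule powr_above_tangent[OF p a]) (simp add: g_def)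
      then have "a powr p + c * g z \<le> g z powr p + c * a" by (simp add: right_diff_distrib)
      then have "\<rho> z * (a powr p + c * g z) \<le> \<rho> z * (g z powr p + c * a)"
        by (rule mult_left_mono[OF _ \<rho>(2)])
      then have "a powr p * \<rho> z + c * (\<rho> z * g z) \<le> \<rho> z * g z powr p + c * a * \<rho> z"
        by (simp add: algebra_simps)
      then show "ennreal (a powr p) * ennreal (\<rho> z) + ennreal c * (ennreal (\<rho> z) * ennreal (g z))
         \<le> ennreal (\<rho> z) * ennreal (g z powr p) + ennreal (c * a) * ennreal (\<rho> z)"
        using ennreal_leI[OF \<open>a powr p * \<rho> z + c * (\<rho> z * g z) \<le> \<rho> z * g z powr p + c * a * \<rho> z\<close>] \<rho>(2)[of z] c a
        by (simp add: g_def ennreal_mult mult.assoc)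
    qed
    also have "\<dots> = ?I + ennreal (c * a)"
      by (subst nn_integral_add) (auto simp: nn_integral_cmult \<rho>(3))
    finally have "ennreal (c * a) + ennreal (a powr p) \<le> ennreal (c * a) + ?I" by (simp only: add.commute)
    then show ?thesis by (simp add: a_def g_def)
  qed simp
  let ?k = "\<lambda>x y. ennreal (1 / \<bar>x - y\<bar> powr (1 + s * p))"
  have "gagliardo s p (conv \<rho> f) \<le> (\<integral>\<^sup>+y. \<integral>\<^sup>+x. \<integral>\<^sup>+z. ennreal (\<rho> z) * (ennreal (\<bar>f (x - z) - f (y - z)\<bar> powr p) * ?k x y) \<partial>lborel \<partial>lborel \<partial>lborel)"
    unfolding gagliardo_def
  proof (intro nn_integral_mono)
    fix x y
    have "ennreal (\<bar>conv \<rho> f x - conv \<rho> f y\<bar> powr p / \<bar>x - y\<bar> powr (1 + s * p))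
      = ennreal (\<bar>conv \<rho> f x - conv \<rho> f y\<bar> powr p) * ?k x y"
      by (subst ennreal_mult[symmetric]) auto
    also have "\<dots> \<le> (\<integral>\<^sup>+z. ennreal (\<rho> z) * ennreal (\<bar>f (x - z) - f (y - z)\<bar> powr p) \<partial>lborel) * ?k x y"
      by (intro mult_right_mono jensen) simp
    also have "\<dots> = (\<integral>\<^sup>+z. ennreal (\<rho> z) * (ennreal (\<bar>f (x - z) - f (y - z)\<bar> powr p) * ?k x y) \<partial>lborel)"
      by (subst nn_integral_multc[symmetric]) (auto simp: mult.assoc)
    finally show "ennreal (\<bar>conv \<rho> f x - conv \<rho> f y\<bar> powr p / \<bar>x - y\<bar> powr (1 + s * p)) \<le> \<dots>" .
  qed
  also have "\<dots> = (\<integral>\<^sup>+z. \<integral>\<^sup>+y. \<integral>\<^sup>+x. ennreal (\<rho> z) * (ennreal (\<bar>f (x - z) - f (y - z)\<bar> powr p) * ?k x y) \<partial>lborel \<partial>lborel \<partial>lborel)"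
    by (rule lborel_triple_swap) measurable
  also have "\<dots> = (\<integral>\<^sup>+z. ennreal (\<rho> z) * gagliardo s p f \<partial>lborel)"
  proof (intro nn_integral_cong)
    fix z
    let ?H = "\<lambda>y x. ennreal (\<bar>f x - f y\<bar> powr p / \<bar>x - y\<bar> powr (1 + s * p))"
    have "(\<integral>\<^sup>+y. \<integral>\<^sup>+x. ennreal (\<rho> z) * (ennreal (\<bar>f (x - z) - f (y - z)\<bar> powr p) * ?k x y) \<partial>lborel \<partial>lborel)
       = (\<integral>\<^sup>+y. \<integral>\<^sup>+x. ennreal (\<rho> z) * ?H (y - z) (x - z) \<partial>lborel \<partial>lborel)"
      by (intro nn_integral_cong) (simp add: ennreal_mult[symmetric])
    also have "\<dots> = ennreal (\<rho> z) * (\<integral>\<^sup>+y. \<integral>\<^sup>+x. ?H (y - z) (x - z) \<partial>lborel \<partial>lborel)"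
      by (simp add: nn_integral_cmult)
    also have "(\<integral>\<^sup>+y. \<integral>\<^sup>+x. ?H (y - z) (x - z) \<partial>lborel \<partial>lborel) = (\<integral>\<^sup>+y. \<integral>\<^sup>+x. ?H (y - z) x \<partial>lborel \<partial>lborel)"
    proof (rule nn_integral_cong)
      fix y
      show "(\<integral>\<^sup>+x. ?H (y - z) (x - z) \<partial>lborel) = (\<integral>\<^sup>+x. ?H (y - z) x \<partial>lborel)"
        by (rule nn_integral_shift[of "\<lambda>x. ?H (y - z) x"]) measurable
    qed
    also have "\<dots> = gagliardo s p f"
      unfolding gagliardo_def
      by (rule nn_integral_shift[of "\<lambda>y. \<integral>\<^sup>+x. ?H y x \<partial>lborel"]) measurable
    finally show "(\<integral>\<^sup>+y. \<integral>\<^sup>+x. ennreal (\<rho> z) * (ennreal (\<bar>f (x - z) - f (y - z)\<bar> powr p) * ?k x y) \<partial>lborel \<partial>lborel)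
       = ennreal (\<rho> z) * gagliardo s p f" .
  qed
  also have "\<dots> = gagliardo s p f" by (simp add: nn_integral_multc \<rho>(3))
  finally show ?thesis .
qed

text \<open>Vanishes within distance \<open>\<epsilon>\<close> of \<open>F\<close> and equals 1 from distance \<open>2 * \<epsilon>\<close> on, with Lipschitz
  constant \<open>1 / \<epsilon>\<close>. Smoothness comes from the mollification that follows.\<close>

definition cutoff :: "real set \<Rightarrow> real \<Rightarrow> real \<Rightarrow> real" where
  "cutoff F \<epsilon> x = min 1 (max 0 (infdist x F / \<epsilon> - 1))"

lemma infdist_borel[measurable]: "(\<lambda>x::real. infdist x F) \<in> borel_measurable borel"
  by (intro borel_measurable_continuous_onI continuous_intros)

lemma cutoff_borel[measurable]: "cutoff F \<epsilon> \<in> borel_measurable borel"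
  unfolding cutoff_def by measurable

lemma cutoff_range: "0 \<le> cutoff F \<epsilon> x" "cutoff F \<epsilon> x \<le> 1"
  by (auto simp: cutoff_def)

lemma cutoff_eq_0: "0 < \<epsilon> \<Longrightarrow> infdist x F \<le> \<epsilon> \<Longrightarrow> cutoff F \<epsilon> x = 0"
  by (simp add: cutoff_def)

lemma cutoff_eq_1: "0 < \<epsilon> \<Longrightarrow> 2 * \<epsilon> \<le> infdist x F \<Longrightarrow> cutoff F \<epsilon> x = 1"
  by (auto simp: cutoff_def min_def max_def field_simps)

lemma cutoff_lipschitz: "0 < \<epsilon> \<Longrightarrow> \<bar>cutoff F \<epsilon> x - cutoff F \<epsilon> y\<bar> \<le> min 1 (\<bar>x - y\<bar> / \<epsilon>)"
proof -
  assume \<epsilon>: "0 < \<epsilon>"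
  have "\<bar>infdist x F - infdist y F\<bar> / \<epsilon> \<le> \<bar>x - y\<bar> / \<epsilon>"
    using infdist_triangle_abs[of x F y] \<epsilon> by (intro divide_right_mono) (auto simp: dist_real_def)
  moreover have "\<bar>cutoff F \<epsilon> x - cutoff F \<epsilon> y\<bar> \<le> \<bar>infdist x F / \<epsilon> - infdist y F / \<epsilon>\<bar>"
    unfolding cutoff_def by (simp add: min_def max_def)
  moreover have "\<bar>infdist x F / \<epsilon> - infdist y F / \<epsilon>\<bar> = \<bar>infdist x F - infdist y F\<bar> / \<epsilon>"
    using \<epsilon> by (simp add: diff_divide_distrib[symmetric])
  moreover have "\<bar>cutoff F \<epsilon> x - cutoff F \<epsilon> y\<bar> \<le> 1"
    using cutoff_range[of F \<epsilon> x] cutoff_range[of F \<epsilon> y] by linarith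
  ultimately show ?thesis by simp
qed

lemma nn_integral_truncated_kernel:
  assumes \<epsilon>: "0 < \<epsilon>" and q: "0 < q" "q < p"
  shows "(\<integral>\<^sup>+z. ennreal (min 1 (\<bar>z\<bar> / \<epsilon>) powr p / \<bar>z\<bar> powr (1 + q)) \<partial>lborel) \<le> ennreal (2 * (1 / (p - q) + 1 / q) * \<epsilon> powr - q)"
proof -
  let ?h = "\<lambda>z. ennreal (min 1 (\<bar>z\<bar> / \<epsilon>) powr p / \<bar>z\<bar> powr (1 + q))"
  let ?g = "\<lambda>z. ennreal (\<epsilon> powr - p) * (ennreal (z powr (p - 1 - q)) * indicator {0<..<\<epsilon>} z) + ennreal (1 / \<bar>z - 0\<bar> powr (1 + q)) * indicator {\<epsilon>..} z"
  have le: "?h z \<le> ?g z" if "0 < z" for z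
  proof (cases "z < \<epsilon>")
    case True
    have "min 1 (\<bar>z\<bar> / \<epsilon>) powr p / \<bar>z\<bar> powr (1 + q) = (z / \<epsilon>) powr p / z powr (1 + q)"
      using that True \<epsilon> by (simp add: min_def)
    also have "\<dots> = \<epsilon> powr - p * z powr (p - 1 - q)"
    proof -
      have "z powr (p - 1 - q) = z powr p / z powr (1 + q)" by (simp add: powr_diff[symmetric] diff_diff_eq)
      moreover have "\<epsilon> powr - p = 1 / \<epsilon> powr p" by (rule powr_minus_divide)
      ultimately show ?thesis using that \<epsilon> by (simp add: powr_divide)
    qed
    finally show ?thesis using True that by (simp add: ennreal_mult)
  next
    case False
    then show ?thesis using that \<epsilon> by (simp add: min_def)
  qed
  have "(\<integral>\<^sup>+z. ?h z \<partial>lborel) \<le> (\<integral>\<^sup>+z. ?g z + ?g (- z) \<partial>lborel)"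
  proof (intro nn_integral_mono)
    fix z :: real
    consider "0 < z" | "z < 0" | "z = 0" by linarith
    then show "?h z \<le> ?g z + ?g (- z)"
    proof cases
      case 1 then show ?thesis using le[of z] by (simp add: add_increasing2)
    next
      case 2 then show ?thesis using le[of "- z"] by (simp add: add_increasing)
    qed simp
  qed
  also have "\<dots> = (\<integral>\<^sup>+z. ?g z \<partial>lborel) + (\<integral>\<^sup>+z. ?g (- z) \<partial>lborel)"
    by (intro nn_integral_add) measurable
  also have "(\<integral>\<^sup>+z. ?g (- z) \<partial>lborel) = (\<integral>\<^sup>+z. ?g z \<partial>lborel)"
    by (rule nn_integral_reflect[of ?g]) measurable
  also have "(\<integral>\<^sup>+z. ?g z \<partial>lborel) = ennreal ((1 / (p - q) + 1 / q) * \<epsilon> powr - q)"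
  proof -
    have "(\<integral>\<^sup>+z. ?g z \<partial>lborel) = ennreal (\<epsilon> powr - p) * (\<integral>\<^sup>+z\<in>{0<..<\<epsilon>}. ennreal (z powr (p - 1 - q)) \<partial>lborel)
       + (\<integral>\<^sup>+z\<in>{\<epsilon>..}. ennreal (1 / \<bar>z - 0\<bar> powr (1 + q)) \<partial>lborel)"
      by (subst nn_integral_add) (auto simp: nn_integral_cmult)
    also have "\<dots> = ennreal (\<epsilon> powr - p) * ennreal (\<epsilon> powr (p - 1 - q + 1) / (p - 1 - q + 1)) + ennreal ((\<epsilon> - 0) powr - q / q)"
      using \<epsilon> q by (subst nn_integral_powr_from_0, simp, simp, subst nn_integral_kernel_right) auto
    also have "\<dots> = ennreal (\<epsilon> powr - p * (\<epsilon> powr (p - q) / (p - q)) + \<epsilon> powr - q / q)"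
      using \<epsilon> q by (subst ennreal_mult[symmetric]) (auto simp: ennreal_plus[symmetric] simp del: ennreal_plus)
    also have "\<epsilon> powr - p * (\<epsilon> powr (p - q) / (p - q)) = \<epsilon> powr - q / (p - q)"
      using powr_add[of \<epsilon> "- p" "p - q"] by simp
    finally show ?thesis by (simp add: distrib_right)
  qed
  also have "ennreal ((1 / (p - q) + 1 / q) * \<epsilon> powr - q) + ennreal ((1 / (p - q) + 1 / q) * \<epsilon> powr - q)
     = ennreal (2 * (1 / (p - q) + 1 / q) * \<epsilon> powr - q)"
    using q by (subst ennreal_plus[symmetric]) auto
  finally show ?thesis .
qed

text \<open>Finite sets have capacity zero for \<open>s * p < 1\<close>: the cutoff only varies on a set of measure of order
  \<open>\<epsilon>\<close>, and it is Lipschitz with constant \<open>1 / \<epsilon>\<close>, so its energy is of order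
  \<open>\<epsilon> powr (1 - s * p)\<close>.\<close>

lemma gagliardo_cutoff_le:
  assumes F: "finite F" "F \<noteq> {}" and \<epsilon>: "0 < \<epsilon>" and q: "0 < s * p" "s * p < p"
  shows "gagliardo s p (cutoff F \<epsilon>) \<le> ennreal (16 * real (card F) * (1 / (p - s * p) + 1 / (s * p)) * \<epsilon> powr (1 - s * p))"
proof -
  let ?q = "s * p"
  let ?h = "\<lambda>z. ennreal (min 1 (\<bar>z\<bar> / \<epsilon>) powr p / \<bar>z\<bar> powr (1 + ?q))"
  define U where "U = (\<Union>a\<in>F. {a - 2 * \<epsilon><..<a + 2 * \<epsilon>})"
  have [measurable]: "U \<in> sets borel" unfolding U_def using F by (intro sets.finite_UN) auto
  have "emeasure lborel U \<le> (\<Sum>a\<in>F. emeasure lborel {a - 2 * \<epsilon><..<a + 2 * \<epsilon>})"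
    unfolding U_def using F by (intro emeasure_subadditive_finite) auto
  also have "\<dots> = (\<Sum>a\<in>F. ennreal (4 * \<epsilon>))" using \<epsilon> by (intro sum.cong) auto
  also have "\<dots> = ennreal (real (card F) * (4 * \<epsilon>))" using \<epsilon> by (simp add: ennreal_mult ennreal_of_nat_eq_real_of_nat)
  finally have mU: "emeasure lborel U \<le> ennreal (4 * \<epsilon> * real (card F))" by (simp add: mult.commute)
  have one: "cutoff F \<epsilon> x = 1" if "x \<notin> U" for x
  proof (rule cutoff_eq_1[OF \<epsilon>])
    show "2 * \<epsilon> \<le> infdist x F"
      unfolding infdist_notempty[OF F(2)]
    proof (rule cINF_greatest[OF F(2)])
      fix a assume "a \<in> F"
      then have "x \<notin> {a - 2 * \<epsilon><..<a + 2 * \<epsilon>}" using that by (auto simp: U_def)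
      then show "2 * \<epsilon> \<le> dist x a" by (auto simp: dist_real_def)
    qed
  qed
  have "gagliardo s p (cutoff F \<epsilon>) \<le> (\<integral>\<^sup>+y. \<integral>\<^sup>+x. indicator U y * ?h (x - y) + indicator U x * ?h (x - y) \<partial>lborel \<partial>lborel)"
    unfolding gagliardo_def
  proof (intro nn_integral_mono)
    fix x y :: real
    have "\<bar>cutoff F \<epsilon> x - cutoff F \<epsilon> y\<bar> powr p / \<bar>x - y\<bar> powr (1 + ?q) \<le> min 1 (\<bar>x - y\<bar> / \<epsilon>) powr p / \<bar>x - y\<bar> powr (1 + ?q)"
      using q by (intro divide_right_mono powr_mono2 cutoff_lipschitz \<epsilon>) auto
    then have *: "ennreal (\<bar>cutoff F \<epsilon> x - cutoff F \<epsilon> y\<bar> powr p / \<bar>x - y\<bar> powr (1 + ?q)) \<le> ?h (x - y)"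
      by (rule ennreal_leI)
    show "ennreal (\<bar>cutoff F \<epsilon> x - cutoff F \<epsilon> y\<bar> powr p / \<bar>x - y\<bar> powr (1 + ?q))
       \<le> indicator U y * ?h (x - y) + indicator U x * ?h (x - y)"
    proof (cases "x \<in> U \<or> y \<in> U")
      case True
      then show ?thesis using * by (auto split: split_indicator intro: add_increasing add_increasing2)
    next
      case False
      then show ?thesis by (simp add: one)
    qed
  qed
  also have "\<dots> = (\<integral>\<^sup>+y. (\<integral>\<^sup>+x. indicator U y * ?h (x - y) \<partial>lborel) + (\<integral>\<^sup>+x. indicator U x * ?h (x - y) \<partial>lborel) \<partial>lborel)"
    by (intro nn_integral_cong nn_integral_add) auto
  also have "\<dots> = (\<integral>\<^sup>+y. (\<integral>\<^sup>+x. indicator U y * ?h (x - y) \<partial>lborel) \<partial>lborel) + (\<integral>\<^sup>+y. (\<integral>\<^sup>+x. indicator U x * ?h (x - y) \<partial>lborel) \<partial>lborel)"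
    by (intro nn_integral_add) auto
  also have "(\<integral>\<^sup>+y. (\<integral>\<^sup>+x. indicator U x * ?h (x - y) \<partial>lborel) \<partial>lborel) = (\<integral>\<^sup>+x. (\<integral>\<^sup>+y. indicator U x * ?h (x - y) \<partial>lborel) \<partial>lborel)"
    by (rule lborel_pair.Fubini') measurable
  also have "\<dots> = (\<integral>\<^sup>+x. (\<integral>\<^sup>+y. indicator U x * ?h (y - x) \<partial>lborel) \<partial>lborel)"
    by (intro nn_integral_cong) (simp add: abs_minus_commute)
  also have "(\<integral>\<^sup>+y. (\<integral>\<^sup>+x. indicator U y * ?h (x - y) \<partial>lborel) \<partial>lborel) = emeasure lborel U * (\<integral>\<^sup>+z. ?h z \<partial>lborel)"
  proof -
    have "(\<integral>\<^sup>+x. indicator U y * ?h (x - y) \<partial>lborel) = indicator U y * (\<integral>\<^sup>+z. ?h z \<partial>lborel)" for y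
      using nn_integral_shift[of ?h y] by (simp add: nn_integral_cmult)
    then show ?thesis by (simp add: nn_integral_multc)
  qed
  also have "emeasure lborel U * (\<integral>\<^sup>+z. ?h z \<partial>lborel) + emeasure lborel U * (\<integral>\<^sup>+z. ?h z \<partial>lborel) = 2 * (emeasure lborel U * (\<integral>\<^sup>+z. ?h z \<partial>lborel))"
    by (simp add: mult_2)
  also have "\<dots> \<le> 2 * (ennreal (4 * \<epsilon> * real (card F)) * ennreal (2 * (1 / (p - ?q) + 1 / ?q) * \<epsilon> powr - ?q))"
    by (intro mult_left_mono mult_mono mU nn_integral_truncated_kernel \<epsilon> q) auto
  also have "\<dots> = ennreal (2 * (4 * \<epsilon> * real (card F) * (2 * (1 / (p - ?q) + 1 / ?q) * \<epsilon> powr - ?q)))"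
  proof -
    have double: "2 * (ennreal A * ennreal B) = ennreal (2 * (A * B))" if "0 \<le> A" "0 \<le> B" for A B
      using that by (simp add: ennreal_mult)
    have "0 < p - ?q" using q by linarith
    then have "0 \<le> 1 / (p - ?q)" by (intro divide_nonneg_pos) auto
    moreover have "0 \<le> 1 / ?q" using q by (intro divide_nonneg_pos) auto
    ultimately have "0 \<le> 2 * (1 / (p - ?q) + 1 / ?q) * \<epsilon> powr - ?q" by (intro mult_nonneg_nonneg) auto
    moreover have "0 \<le> 4 * \<epsilon> * real (card F)" using \<epsilon> by simp
    ultimately show ?thesis by (rule double[rotated])
  qed
  also have "2 * (4 * \<epsilon> * real (card F) * (2 * (1 / (p - ?q) + 1 / ?q) * \<epsilon> powr - ?q))
    = 16 * real (card F) * (1 / (p - ?q) + 1 / ?q) * (\<epsilon> * \<epsilon> powr - ?q)"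
    by (simp only: mult.assoc mult.left_commute)
  also have "\<epsilon> * \<epsilon> powr - ?q = \<epsilon> powr (1 - ?q)"
    using powr_mult_base[of \<epsilon> "- ?q"] \<epsilon> by simp
  finally show ?thesis .
qed

lemma gagliardo_product_le:
  fixes f h :: "real \<Rightarrow> real"
  assumes [measurable]: "f \<in> borel_measurable borel" "h \<in> borel_measurable borel"
    and f: "\<And>x. \<bar>f x\<bar> \<le> M" and h: "\<And>x. \<bar>h x\<bar> \<le> 1" and p: "1 \<le> p" and \<theta>: "0 < \<theta>" "\<theta> < 1"
  shows "gagliardo s p (\<lambda>x. f x * h x) \<le> ennreal ((1 - \<theta>) powr (1 - p)) * gagliardo s p f + ennreal (\<theta> powr (1 - p) * M powr p) * gagliardo s p h"
proof -
  have M: "0 \<le> M" using f[of 0] by linarith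
  let ?k = "\<lambda>x y. \<bar>x - y\<bar> powr (1 + s * p)"
  have pt: "\<bar>f x * h x - f y * h y\<bar> powr p \<le> (1 - \<theta>) powr (1 - p) * \<bar>f x - f y\<bar> powr p + \<theta> powr (1 - p) * M powr p * \<bar>h x - h y\<bar> powr p" for x y
  proof -
    have "f x * h x - f y * h y = h x * (f x - f y) + f y * (h x - h y)" by (simp add: algebra_simps)
    then have "\<bar>f x * h x - f y * h y\<bar> \<le> \<bar>h x\<bar> * \<bar>f x - f y\<bar> + \<bar>f y\<bar> * \<bar>h x - h y\<bar>"
      by (metis abs_mult abs_triangle_ineq)
    also have "\<dots> \<le> 1 * \<bar>f x - f y\<bar> + M * \<bar>h x - h y\<bar>"
      by (intro add_mono mult_right_mono f h) auto
    finally have "\<bar>f x * h x - f y * h y\<bar> powr p \<le> (\<bar>f x - f y\<bar> + M * \<bar>h x - h y\<bar>) powr p"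
      using p by (intro powr_mono2) auto
    also have "\<dots> \<le> (1 - \<theta>) powr (1 - p) * \<bar>f x - f y\<bar> powr p + \<theta> powr (1 - p) * (M * \<bar>h x - h y\<bar>) powr p"
      using M by (intro powr_add_le p \<theta>) auto
    finally show ?thesis using M by (simp add: powr_mult mult.assoc)
  qed
  have "gagliardo s p (\<lambda>x. f x * h x) \<le> (\<integral>\<^sup>+y. \<integral>\<^sup>+x. ennreal ((1 - \<theta>) powr (1 - p)) * ennreal (\<bar>f x - f y\<bar> powr p / ?k x y)
     + ennreal (\<theta> powr (1 - p) * M powr p) * ennreal (\<bar>h x - h y\<bar> powr p / ?k x y) \<partial>lborel \<partial>lborel)"
    unfolding gagliardo_def
  proof (intro nn_integral_mono)
    fix x y
    have "\<bar>f x * h x - f y * h y\<bar> powr p / ?k x y \<le> ((1 - \<theta>) powr (1 - p) * \<bar>f x - f y\<bar> powr p + \<theta> powr (1 - p) * M powr p * \<bar>h x - h y\<bar> powr p) / ?k x y"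
      by (intro divide_right_mono pt) simp
    also have "\<dots> = (1 - \<theta>) powr (1 - p) * (\<bar>f x - f y\<bar> powr p / ?k x y) + \<theta> powr (1 - p) * M powr p * (\<bar>h x - h y\<bar> powr p / ?k x y)"
      by (simp add: add_divide_distrib)
    finally show "ennreal (\<bar>f x * h x - f y * h y\<bar> powr p / ?k x y) \<le>
       ennreal ((1 - \<theta>) powr (1 - p)) * ennreal (\<bar>f x - f y\<bar> powr p / ?k x y) + ennreal (\<theta> powr (1 - p) * M powr p) * ennreal (\<bar>h x - h y\<bar> powr p / ?k x y)"
      by (subst (1 2) ennreal_mult[symmetric]) (auto simp: ennreal_plus[symmetric] simp del: ennreal_plus intro!: ennreal_leI)
  qed
  also have "\<dots> = ennreal ((1 - \<theta>) powr (1 - p)) * gagliardo s p f + ennreal (\<theta> powr (1 - p) * M powr p) * gagliardo s p h"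
    unfolding gagliardo_def
    by (subst nn_integral_cmult[symmetric], simp, subst nn_integral_cmult[symmetric], simp, subst nn_integral_add[symmetric], simp, simp)
      (simp add: nn_integral_add nn_integral_cmult)
  finally show ?thesis .
qed

section \<open>The Hardy inequality beyond test functions\<close>

definition hardy_term :: "real \<Rightarrow> real \<Rightarrow> real set \<Rightarrow> (real \<Rightarrow> real) \<Rightarrow> ennreal" where
  "hardy_term s p \<Omega> u = (\<integral>\<^sup>+x\<in>\<Omega>. ennreal (\<bar>u x\<bar> powr p / infdist x (frontier \<Omega>) powr (s * p)) \<partial>lborel)"

lemma infdist_frontier_pos:
  assumes "open \<Omega>" "frontier \<Omega> \<noteq> {}" "x \<in> \<Omega>"
  shows "0 < infdist x (frontier \<Omega>)"
proof -
  have "x \<notin> frontier \<Omega>" using assms by (simp add: frontier_def interior_open)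
  then have "infdist x (frontier \<Omega>) \<noteq> 0"
    using in_closed_iff_infdist_zero[of "frontier \<Omega>" x] assms(2) by auto
  then show ?thesis using infdist_nonneg[of x "frontier \<Omega>"] by linarith
qed

lemma test_function_continuous:
  assumes "u \<in> test_functions \<Omega>"
  shows "continuous_on UNIV u"
proof -
  have "(deriv ^^ 0) u differentiable_on UNIV" using assms unfolding test_functions_def by blast
  then show ?thesis by (simp add: differentiable_imp_continuous_on)
qed

lemma test_function_borel: "u \<in> test_functions \<Omega> \<Longrightarrow> u \<in> borel_measurable borel"
  by (intro borel_measurable_continuous_onI test_function_continuous)

lemma test_function_bounded:
  assumes "u \<in> test_functions \<Omega>"
  obtains M where "\<And>x. \<bar>u x\<bar> \<le> M"
proof -
  have K: "compact (closure {x. u x \<noteq> 0})" using assms unfolding test_functions_def by blast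
  have "compact (u ` closure {x. u x \<noteq> 0})"
    by (rule compact_continuous_image[OF continuous_on_subset[OF test_function_continuous[OF assms] subset_UNIV] K])
  then obtain M where M: "\<And>y. y \<in> u ` closure {x. u x \<noteq> 0} \<Longrightarrow> norm y \<le> M"
    using compact_imp_bounded bounded_iff by metis
  have "\<bar>u x\<bar> \<le> max 0 M" for x
  proof (cases "u x = 0")
    case False
    then have "x \<in> closure {x. u x \<noteq> 0}" using closure_subset[of "{x. u x \<noteq> 0}"] by blast
    then show ?thesis using M[of "u x"] by auto
  qed simp
  then show ?thesis by (rule that)
qed

lemma test_function_support_finite:
  assumes "u \<in> test_functions \<Omega>"
  shows "emeasure lborel {x. u x \<noteq> 0} < \<infinity>"
proof -
  have "compact (closure {x. u x \<noteq> 0})" using assms unfolding test_functions_def by blast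
  then have "bounded {x. u x \<noteq> 0}" using bounded_subset[OF compact_imp_bounded closure_subset] by blast
  then show ?thesis by (rule emeasure_bounded_finite)
qed

lemma test_function_cmult:
  assumes u: "u \<in> test_functions \<Omega>" and c: "c \<noteq> 0"
  shows "(\<lambda>x. c * u x) \<in> test_functions \<Omega>"
proof -
  have d: "(deriv ^^ k) u differentiable_on UNIV" for k using u unfolding test_functions_def by blast
  have "(deriv ^^ k) (\<lambda>x. c * u x) = (\<lambda>x. c * (deriv ^^ k) u x)" for k
  proof (induction k)
    case (Suc k)
    have "(deriv ^^ k) u field_differentiable at x" for x
      using d[of k] by (simp add: differentiable_on_def field_differentiable_def real_differentiable_def)
    then show ?case by (auto simp: Suc intro!: ext deriv_cmult)
  qed simp
  then have "(deriv ^^ k) (\<lambda>x. c * u x) differentiable_on UNIV" for k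
    using d[of k] by (auto intro!: derivative_intros)
  moreover have "{x. c * u x \<noteq> 0} = {x. u x \<noteq> 0}" using c by auto
  ultimately show ?thesis using u by (auto simp: test_functions_def)
qed

lemma hardy_term_finite:
  assumes u: "u \<in> test_functions \<Omega>" and \<Omega>: "open \<Omega>" "frontier \<Omega> \<noteq> {}" and p: "0 \<le> p" and q: "0 \<le> s * p"
  shows "hardy_term s p \<Omega> u < \<infinity>"
proof -
  let ?K = "closure {x. u x \<noteq> 0}"
  have K: "compact ?K" "?K \<subseteq> \<Omega>" using u unfolding test_functions_def by auto
  obtain M where M: "\<And>x. \<bar>u x\<bar> \<le> M" using test_function_bounded[OF u] by blast
  obtain d where d: "0 < d" "\<And>x. x \<in> ?K \<Longrightarrow> d \<le> infdist x (frontier \<Omega>)"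
  proof (cases "?K = {}")
    case False
    have "continuous_on ?K (\<lambda>x. infdist x (frontier \<Omega>))" by (intro continuous_intros)
    from continuous_attains_inf[OF K(1) False this] obtain z where
      "z \<in> ?K" "\<And>y. y \<in> ?K \<Longrightarrow> infdist z (frontier \<Omega>) \<le> infdist y (frontier \<Omega>)" by blast
    then show ?thesis using infdist_frontier_pos[OF \<Omega>, of z] K(2) by (intro that[of "infdist z (frontier \<Omega>)"]) auto
  qed (use that[of 1] in auto)
  have "hardy_term s p \<Omega> u \<le> (\<integral>\<^sup>+x. ennreal (M powr p / d powr (s * p)) * indicator ?K x \<partial>lborel)"
    unfolding hardy_term_def
  proof (intro nn_integral_mono)
    fix x
    show "ennreal (\<bar>u x\<bar> powr p / infdist x (frontier \<Omega>) powr (s * p)) * indicator \<Omega> x \<le> ennreal (M powr p / d powr (s * p)) * indicator ?K x"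
    proof (cases "u x = 0")
      case False
      then have x: "x \<in> ?K" using closure_subset[of "{x. u x \<noteq> 0}"] by blast
      have "\<bar>u x\<bar> powr p / infdist x (frontier \<Omega>) powr (s * p) \<le> M powr p / d powr (s * p)"
        using d(1) d(2)[OF x] p q M[of x] by (intro frac_le powr_mono2) auto
      then show ?thesis using x by (auto split: split_indicator intro!: ennreal_leI)
    qed simp
  qed
  also have "\<dots> < \<infinity>"
    using emeasure_bounded_finite[OF compact_imp_bounded[OF K(1)]]
    by (simp add: nn_integral_cmult ennreal_mult_less_top)
  finally show ?thesis .
qed

lemma hardy_const_test:
  assumes u: "u \<in> test_functions \<Omega>" and \<Omega>: "open \<Omega>" "frontier \<Omega> \<noteq> {}" and p: "1 \<le> p" and s: "0 \<le> s"
  shows "hardy_const s p \<Omega> * hardy_term s p \<Omega> u \<le> gagliardo s p u"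
proof -
  have "hardy_term s p \<Omega> u < \<infinity>" using hardy_term_finite[OF u \<Omega>] p s by simp
  then obtain N where N: "hardy_term s p \<Omega> u = ennreal N" "0 \<le> N" by (cases "hardy_term s p \<Omega> u") auto
  have [measurable]: "u \<in> borel_measurable borel" "\<Omega> \<in> sets borel" using test_function_borel[OF u] \<Omega> by auto
  show ?thesis
  proof (cases "N = 0")
    case True then show ?thesis using N by simp
  next
    case False
    then have N0: "0 < N" using N by simp
    define c where "c = N powr (- 1 / p)"
    have c: "0 < c" using N0 by (simp add: c_def)
    have cp: "c powr p = 1 / N" using N0 p by (simp only: c_def powr_powr) (simp add: powr_minus_divide)
    have pull: "ennreal (\<bar>c * v\<bar> powr p / w) = ennreal (1 / N) * ennreal (\<bar>v\<bar> powr p / w)" if "0 \<le> w" for v w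
    proof -
      have "\<bar>c * v\<bar> powr p / w = (1 / N) * (\<bar>v\<bar> powr p / w)"
        using c by (simp add: abs_mult powr_mult cp)
      also have "ennreal \<dots> = ennreal (1 / N) * ennreal (\<bar>v\<bar> powr p / w)"
        using N0 that by (intro ennreal_mult) auto
      finally show ?thesis .
    qed
    have "hardy_term s p \<Omega> (\<lambda>x. c * u x) = (\<integral>\<^sup>+x. ennreal (1 / N) * (ennreal (\<bar>u x\<bar> powr p / infdist x (frontier \<Omega>) powr (s * p)) * indicator \<Omega> x) \<partial>lborel)"
      unfolding hardy_term_def by (intro nn_integral_cong) (simp add: pull mult.assoc)
    also have "\<dots> = ennreal (1 / N) * hardy_term s p \<Omega> u"
      unfolding hardy_term_def by (rule nn_integral_cmult) measurable
    also have "\<dots> = 1" using N N0 by (simp add: ennreal_mult[symmetric])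
    finally have one: "hardy_term s p \<Omega> (\<lambda>x. c * u x) = 1" .
    have "gagliardo s p (\<lambda>x. c * u x) = (\<integral>\<^sup>+y. \<integral>\<^sup>+x. ennreal (1 / N) * ennreal (\<bar>u x - u y\<bar> powr p / \<bar>x - y\<bar> powr (1 + s * p)) \<partial>lborel \<partial>lborel)"
      unfolding gagliardo_def by (intro nn_integral_cong) (simp add: pull right_diff_distrib[symmetric])
    also have "\<dots> = ennreal (1 / N) * gagliardo s p u"
      unfolding gagliardo_def by (simp add: nn_integral_cmult)
    finally have g: "gagliardo s p (\<lambda>x. c * u x) = ennreal (1 / N) * gagliardo s p u" .
    have "hardy_const s p \<Omega> \<le> gagliardo s p (\<lambda>x. c * u x)"
      unfolding hardy_const_def
      by (rule Inf_lower) (use test_function_cmult[OF u, of c] c one in \<open>auto simp: hardy_term_def\<close>)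
    then have "hardy_const s p \<Omega> * ennreal N \<le> ennreal (1 / N) * gagliardo s p u * ennreal N"
      unfolding g by (rule mult_right_mono) simp
    also have "\<dots> = (ennreal (1 / N) * ennreal N) * gagliardo s p u"
      by (metis mult.assoc mult.commute)
    also have "\<dots> = gagliardo s p u" using N0 by (simp add: ennreal_mult[symmetric])
    finally show ?thesis using N by simp
  qed
qed

lemma conv_near:
  assumes \<rho>: "\<rho> \<in> bumps \<delta>" "\<And>x. 0 \<le> \<rho> x" "(\<integral>\<^sup>+x. ennreal (\<rho> x) \<partial>lborel) = 1"
    and f: "integrable lborel f" and e: "\<And>z. \<bar>z - x\<bar> < \<delta> \<Longrightarrow> \<bar>f z - c\<bar> \<le> e"
  shows "\<bar>conv \<rho> f x - c\<bar> \<le> e"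
proof -
  have [measurable]: "\<rho> \<in> borel_measurable borel" using \<rho>(1) by (rule bumps_borel)
  have [measurable]: "f \<in> borel_measurable borel" using f by auto
  have i\<rho>: "integrable lborel \<rho>" "integral\<^sup>L lborel \<rho> = 1"
    using \<rho>(2,3) by (auto intro!: integrableI_nonneg simp: integral_eq_nn_integral)
  have ir: "integrable lborel (\<lambda>z. \<rho> (x - z))" "(\<integral>z. \<rho> (x - z) \<partial>lborel) = 1"
    using lborel_integrable_real_affine[OF i\<rho>(1), of "-1" x] lborel_integral_real_affine[of "-1" \<rho> x] i\<rho>(2) by simp_all
  note ic = conv_integrable[OF \<rho>(1) f, of x]
  have "conv \<rho> f x - c = (\<integral>z. \<rho> (x - z) * f z - \<rho> (x - z) * c \<partial>lborel)"
    unfolding conv_def using ic ir by simp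
  also have "\<bar>\<dots>\<bar> \<le> (\<integral>z. \<rho> (x - z) * e \<partial>lborel)"
  proof (rule order_trans[OF integral_abs_bound integral_mono])
    fix z
    show "\<bar>\<rho> (x - z) * f z - \<rho> (x - z) * c\<bar> \<le> \<rho> (x - z) * e"
    proof (cases "\<bar>z - x\<bar> < \<delta>")
      case True
      have "\<bar>\<rho> (x - z) * f z - \<rho> (x - z) * c\<bar> = \<rho> (x - z) * \<bar>f z - c\<bar>"
        using \<rho>(2)[of "x - z"] by (simp add: right_diff_distrib[symmetric] abs_mult)
      then show ?thesis using e[OF True] \<rho>(2) by (simp add: mult_left_mono)
    next
      case False
      then have "\<rho> (x - z) = 0" using bumps_support[OF \<rho>(1), of "x - z"] by (simp add: abs_minus_commute)
      then show ?thesis by simp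
    qed
  qed (use ic ir in auto)
  also have "\<dots> = e" using ir by simp
  finally show ?thesis .
qed

text \<open>The limit is taken through constants below \<open>X\<close>, because multiplication by \<open>h\<close> is not continuous
  at 0 when \<open>h\<close> is infinite.\<close>

lemma liminf_bound_mult:
  fixes X Y :: ennreal and a b :: "nat \<Rightarrow> ennreal"
  assumes X: "X \<le> liminf a" and le: "\<And>n. h * a n \<le> Y + b n" and b: "b \<longlonglongrightarrow> 0"
  shows "h * X \<le> Y"
proof -
  have c: "h * c \<le> Y" if "c < X" for c
  proof -
    have "c < liminf a" using that X by (rule less_le_trans)
    then have ev: "eventually (\<lambda>n. c < a n) sequentially" by (rule less_LiminfD)
    have "(\<lambda>n. Y + b n) \<longlonglongrightarrow> Y + 0" by (intro tendsto_add tendsto_const b)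
    moreover have "eventually (\<lambda>n. h * c \<le> Y + b n) sequentially"
      using ev by eventually_elim (meson le less_imp_le mult_left_mono order_trans zero_le)
    ultimately show ?thesis
      by (intro tendsto_lowerbound[of "\<lambda>n. Y + b n" Y sequentially "h * c"]) auto
  qed
  show ?thesis
  proof (cases "X = 0")
    case False
    have X': "X = (SUP c\<in>{..<X}. c)"
    proof (rule antisym)
      show "X \<le> (SUP c\<in>{..<X}. c)"
        by (rule dense_le) (auto intro: SUP_upper2)
    qed (auto intro: SUP_least)
    have "h * X = h * (SUP c\<in>{..<X}. c)" by (rule arg_cong[OF X'])
    also have "\<dots> = (SUP c\<in>{..<X}. h * c)" by (rule SUP_mult_left_ennreal)
    also have "\<dots> \<le> Y" by (rule SUP_least) (simp add: c)
    finally show ?thesis .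
  qed simp
qed

text \<open>The boundary points that lie in the closure of the support of \<open>f\<close> are all in the finite set
  \<open>F\<close>, so a cutoff near \<open>F\<close> moves the support into a compact subset of \<open>\<Omega>\<close>. A mollification with
  a sufficiently small radius is then a test function. In the limit the seminorm has not increased,
  and the Hardy term is lower semicontinuous by Fatou's lemma.\<close>

theorem hardy_const_le:
  assumes s: "0 < s" "s < 1" and p: "1 \<le> p" and q: "s * p < 1"
    and \<Omega>: "open \<Omega>" "frontier \<Omega> \<noteq> {}"
    and F: "finite F" "F \<noteq> {}" and S: "bounded S" "closure S \<subseteq> \<Omega> \<union> F"
    and f[measurable]: "f \<in> borel_measurable borel" and M: "\<And>x. \<bar>f x\<bar> \<le> M" and fS: "\<And>x. x \<notin> S \<Longrightarrow> f x = 0"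
    and cont: "AE x in lborel. isCont f x"
  shows "hardy_const s p \<Omega> * hardy_term s p \<Omega> f \<le> gagliardo s p f"
proof -
  have [measurable]: "\<Omega> \<in> sets borel" using \<Omega> by auto
  define \<epsilon> where "\<epsilon> n = 1 / real (Suc n)" for n
  have \<epsilon>: "0 < \<epsilon> n" for n by (simp add: \<epsilon>_def)
  have \<epsilon>0: "\<epsilon> \<longlonglongrightarrow> 0" unfolding \<epsilon>_def using LIMSEQ_Suc[OF lim_1_over_n] by simp
  \<comment> \<open>the functions after cutoff; the mollification radius \<open>\<delta>
    n\<close> is chosen below\<close>
  define g where "g n x = f x * cutoff F (\<epsilon> n) x" for n x
  have [measurable]: "g n \<in> borel_measurable borel" for n unfolding g_def by measurable
  have g_le: "\<bar>g n x\<bar> \<le> M" for n x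
    using M[of x] cutoff_range[of F "\<epsilon> n" x] mult_mono[of "\<bar>f x\<bar>" M "cutoff F (\<epsilon> n) x" 1]
    by (simp add: g_def abs_mult)
  obtain R where R: "\<And>x. x \<in> S \<Longrightarrow> \<bar>x\<bar> \<le> R" using S(1) by (auto simp: bounded_iff)
  have g_int: "integrable lborel (g n)" for n
  proof (rule integrableI_bounded_set[of "{-R..R}" _ _ M])
    show "AE x in lborel. x \<in> {-R..R} \<longrightarrow> norm (g n x) \<le> M" using g_le by simp
    have "g n x = 0" if "x \<notin> {-R..R}" for x
      using that R[of x] fS[of x] by (cases "x \<in> S") (auto simp: g_def abs_le_iff)
    then show "AE x in lborel. x \<notin> {-R..R} \<longrightarrow> g n x = 0" by simp
  qed (cases "- R \<le> R"; simp)+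
  have "\<exists>\<delta>>0. \<delta> \<le> \<epsilon> n \<and> (\<forall>\<rho>\<in>bumps \<delta>. conv \<rho> (g n) \<in> test_functions \<Omega>)" for n
  proof -
    define K where "K = closure S \<inter> {x. \<epsilon> n \<le> infdist x F}"
    have "closed {x. \<epsilon> n \<le> infdist x F}" by (intro closed_Collect_le continuous_intros)
    then have cK: "compact K" unfolding K_def using S(1) by (intro compact_Int_closed) (auto simp: compact_closure)
    have "x \<notin> F" if "\<epsilon> n \<le> infdist x F" for x using that \<epsilon>[of n] by (auto simp: not_less[symmetric])
    then have K\<Omega>: "K \<subseteq> \<Omega>" unfolding K_def using S(2) by blast
    have gK: "x \<in> K" if "g n x \<noteq> 0" for x
    proof -
      have "f x \<noteq> 0" "cutoff F (\<epsilon> n) x \<noteq> 0" using that by (auto simp: g_def)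
      then have "x \<in> S" "\<not> infdist x F \<le> \<epsilon> n" using fS[of x] cutoff_eq_0[OF \<epsilon>[of n], of x F] by auto
      then show ?thesis using closure_subset[of S] by (auto simp: K_def)
    qed
    have "\<exists>\<delta>0>0. {x. infdist x K \<le> \<delta>0} \<subseteq> \<Omega> \<or> K = {}"
      using compact_in_open_separated[OF _ cK \<Omega>(1) K\<Omega>] by (metis zero_less_one)
    then obtain \<delta>0 where \<delta>0: "0 < \<delta>0" "{x. infdist x K \<le> \<delta>0} \<subseteq> \<Omega> \<or> K = {}" by blast
    define \<delta> where "\<delta> = min \<delta>0 (\<epsilon> n)"
    have "conv \<rho> (g n) \<in> test_functions \<Omega>" if \<rho>: "\<rho> \<in> bumps \<delta>" for \<rho>
    proof -
      have near: "K \<noteq> {} \<and> infdist x K \<le> \<delta>" if nz: "conv \<rho> (g n) x \<noteq> 0" for x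
      proof -
        obtain z where z: "\<bar>x - z\<bar> < \<delta>" "g n z \<noteq> 0" using conv_support[OF \<rho> nz] by blast
        then have "z \<in> K" using gK by blast
        then show ?thesis using infdist_le[of z K x] z(1) by (auto simp: dist_real_def)
      qed
      show ?thesis
      proof (cases "K = {}")
        case True
        then have "{x. conv \<rho> (g n) x \<noteq> 0} = {}" using near by blast
        then show ?thesis using conv_smooth[OF \<rho> g_int] unfolding test_functions_def by auto
      next
        case False
        have cl: "closure {x. conv \<rho> (g n) x \<noteq> 0} \<subseteq> {x. infdist x K \<le> \<delta>}"
          by (intro closure_minimal closed_Collect_le continuous_intros) (use near in auto)
        have "bounded {x. infdist x K \<le> \<delta>}"
        proof -
          have "compact {x. infdist x K \<le> \<delta>}"
            by (rule compact_infdist_le[OF False cK]) (use \<delta>0 \<epsilon>[of n] in \<open>auto simp: \<delta>_def\<close>)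
          then show ?thesis by (rule compact_imp_bounded)
        qed
        then have "compact (closure {x. conv \<rho> (g n) x \<noteq> 0})"
          using cl bounded_subset compact_eq_bounded_closed closed_closure by blast
        moreover have "closure {x. conv \<rho> (g n) x \<noteq> 0} \<subseteq> \<Omega>"
          using cl \<delta>0(2) False by (force simp: \<delta>_def)
        ultimately show ?thesis using conv_smooth[OF \<rho> g_int] unfolding test_functions_def by blast
      qed
    qed
    then show ?thesis using \<delta>0(1) \<epsilon>[of n] by (intro exI[of _ \<delta>]) (auto simp: \<delta>_def)
  qed
  then obtain \<delta> where \<delta>: "\<And>n. 0 < \<delta> n" "\<And>n. \<delta> n \<le> \<epsilon> n"
    "\<And>n \<rho>. \<rho> \<in> bumps (\<delta> n) \<Longrightarrow> conv \<rho> (g n) \<in> test_functions \<Omega>" by metis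
  have "\<exists>\<rho>. \<rho> \<in> bumps (\<delta> n) \<and> (\<forall>x. 0 \<le> \<rho> x) \<and> (\<integral>\<^sup>+x. ennreal (\<rho> x) \<partial>lborel) = 1" for n
    using mollifier_exists[OF \<delta>(1)[of n]] by metis
  then obtain \<rho> where \<rho>: "\<And>n. \<rho> n \<in> bumps (\<delta> n)" "\<And>n x. 0 \<le> \<rho> n x" "\<And>n. (\<integral>\<^sup>+x. ennreal (\<rho> n x) \<partial>lborel) = 1"
    by metis
  define u where "u n = conv (\<rho> n) (g n)" for n
  have u: "u n \<in> test_functions \<Omega>" for n unfolding u_def by (rule \<delta>(3)[OF \<rho>(1)])
  have [measurable]: "u n \<in> borel_measurable borel" for n by (rule test_function_borel[OF u])
  have limit: "(\<lambda>n. u n x) \<longlonglongrightarrow> f x" if x: "isCont f x" "x \<notin> F" for x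
  proof (rule LIMSEQ_I)
    fix r :: real assume r: "0 < r"
    obtain d where d: "0 < d" "\<And>z. \<bar>z - x\<bar> < d \<Longrightarrow> \<bar>f z - f x\<bar> < r / 2"
      using x(1) r unfolding continuous_at_eps_delta by (metis dist_real_def half_gt_zero)
    have dF: "0 < infdist x F"
      using x(2) F in_closed_iff_infdist_zero[OF finite_imp_closed[OF F(1)] F(2), of x] infdist_nonneg[of x F] by linarith
    have "eventually (\<lambda>n. \<epsilon> n < min d (infdist x F / 3)) sequentially"
      using \<epsilon>0 d(1) dF by (intro order_tendstoD) auto
    then obtain N where N: "\<And>n. N \<le> n \<Longrightarrow> \<epsilon> n < min d (infdist x F / 3)" by (auto simp: eventually_sequentially)
    have "norm (u n x - f x) < r" if "N \<le> n" for n
    proof -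
      have "\<bar>g n z - f x\<bar> \<le> r / 2" if z: "\<bar>z - x\<bar> < \<delta> n" for z
      proof -
        have z': "\<bar>z - x\<bar> < \<epsilon> n" using z \<delta>(2)[of n] by linarith
        have "infdist x F \<le> infdist z F + \<bar>x - z\<bar>" using infdist_triangle[of x F z] by (simp add: dist_real_def)
        moreover have "\<epsilon> n < infdist x F / 3" using N[OF \<open>N \<le> n\<close>] by simp
        ultimately have "2 * \<epsilon> n \<le> infdist z F" using z' abs_minus_commute[of x z] by linarith
        then have "g n z = f z" by (simp add: g_def cutoff_eq_1[OF \<epsilon>])
        then show ?thesis using d(2)[of z] z' N[OF \<open>N \<le> n\<close>] by simp
      qed
      then have "\<bar>u n x - f x\<bar> \<le> r / 2"
        unfolding u_def by (rule conv_near[OF \<rho>(1) \<rho>(2) \<rho>(3) g_int])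
      then show ?thesis using r by simp
    qed
    then show "\<exists>N. \<forall>n\<ge>N. norm (u n x - f x) < r" by blast
  qed
  let ?w = "\<lambda>v x. ennreal (\<bar>v x\<bar> powr p / infdist x (frontier \<Omega>) powr (s * p)) * indicator \<Omega> x"
  have fatou: "hardy_term s p \<Omega> f \<le> liminf (\<lambda>n. hardy_term s p \<Omega> (u n))"
  proof -
    have "hardy_term s p \<Omega> f = (\<integral>\<^sup>+x. liminf (\<lambda>n. ?w (u n) x) \<partial>lborel)"
      unfolding hardy_term_def
    proof (rule nn_integral_cong_AE)
      have "AE x in lborel. x \<notin> F" by (rule AE_not_in[OF finite_imp_null_set_lborel[OF F(1)]])
      with cont show "AE x in lborel. ?w f x = liminf (\<lambda>n. ?w (u n) x)"
      proof eventually_elim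
        case (elim x)
        have "(\<lambda>n. \<bar>u n x\<bar> powr p) \<longlonglongrightarrow> \<bar>f x\<bar> powr p"
          using p by (intro tendsto_powr2 tendsto_rabs limit[OF elim] tendsto_const) auto
        then have "(\<lambda>n. ?w (u n) x) \<longlonglongrightarrow> ?w f x"
          by (cases "x \<in> \<Omega>"; cases "infdist x (frontier \<Omega>) = 0") (auto intro!: tendsto_ennrealI tendsto_divide)
        then show ?case by (intro lim_imp_Liminf[symmetric]) auto
      qed
    qed
    also have "\<dots> \<le> liminf (\<lambda>n. \<integral>\<^sup>+x. ?w (u n) x \<partial>lborel)"
      by (rule nn_integral_liminf) measurable
    finally show ?thesis by (simp add: hardy_term_def)
  qed
  have q0: "0 < s * p" using s p by simp
  have qp: "s * p < p" using s p by simp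
  define C where "C = 16 * real (card F) * (1 / (p - s * p) + 1 / (s * p))"
  \<comment> \<open>for fixed \<open>\<theta>\<close> the energy of the cutoff vanishes in the
    limit; afterwards \<open>\<theta>\<close> tends to 0\<close>
  have step: "hardy_const s p \<Omega> * hardy_term s p \<Omega> f \<le> ennreal ((1 - \<theta>) powr (1 - p)) * gagliardo s p f"
    if \<theta>: "0 < \<theta>" "\<theta> < 1" for \<theta>
  proof (rule liminf_bound_mult[OF fatou])
    let ?b = "\<lambda>n. ennreal (\<theta> powr (1 - p) * M powr p) * ennreal (C * \<epsilon> n powr (1 - s * p))"
    fix n
    have "hardy_const s p \<Omega> * hardy_term s p \<Omega> (u n) \<le> gagliardo s p (u n)"
      using hardy_const_test[OF u \<Omega> p] s by simp
    also have "\<dots> \<le> gagliardo s p (g n)"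
      unfolding u_def by (rule gagliardo_conv_le[OF \<rho>(1) \<rho>(2) \<rho>(3) g_int p])
    also have "\<dots> \<le> ennreal ((1 - \<theta>) powr (1 - p)) * gagliardo s p f + ennreal (\<theta> powr (1 - p) * M powr p) * gagliardo s p (cutoff F (\<epsilon> n))"
      unfolding g_def by (rule gagliardo_product_le) (use M cutoff_range p \<theta> in \<open>auto simp: abs_le_iff intro: order_trans[OF _ cutoff_range(1)]\<close>)
    also have "\<dots> \<le> ennreal ((1 - \<theta>) powr (1 - p)) * gagliardo s p f + ?b n"
      unfolding C_def by (intro add_left_mono mult_left_mono gagliardo_cutoff_le F \<epsilon> q0 qp) simp
    finally show "hardy_const s p \<Omega> * hardy_term s p \<Omega> (u n) \<le> ennreal ((1 - \<theta>) powr (1 - p)) * gagliardo s p f + ?b n" .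
  next
    have "(\<lambda>n. C * \<epsilon> n powr (1 - s * p)) \<longlonglongrightarrow> C * 0 powr (1 - s * p)"
      using q by (intro tendsto_intros tendsto_powr2 \<epsilon>0) (simp_all add: less_imp_le[OF \<epsilon>])
    then have "(\<lambda>n. ennreal (C * \<epsilon> n powr (1 - s * p))) \<longlonglongrightarrow> ennreal 0" using q by (intro tendsto_ennrealI) simp
    then have "(\<lambda>n. ennreal (\<theta> powr (1 - p) * M powr p) * ennreal (C * \<epsilon> n powr (1 - s * p))) \<longlonglongrightarrow> ennreal (\<theta> powr (1 - p) * M powr p) * ennreal 0"
      by (intro ennreal_tendsto_cmult) auto
    then show "(\<lambda>n. ennreal (\<theta> powr (1 - p) * M powr p) * ennreal (C * \<epsilon> n powr (1 - s * p))) \<longlonglongrightarrow> 0" by simp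
  qed
  show ?thesis
  proof (cases "gagliardo s p f = \<infinity>")
    case False
    have "(\<lambda>n. 1 / real (Suc (Suc n))) \<longlonglongrightarrow> 0" using LIMSEQ_Suc[OF LIMSEQ_Suc[OF lim_1_over_n]] by simp
    then have "(\<lambda>n. ennreal ((1 - 1 / real (Suc (Suc n))) powr (1 - p))) \<longlonglongrightarrow> ennreal ((1 - 0) powr (1 - p))"
      by (intro tendsto_ennrealI tendsto_powr tendsto_diff tendsto_const) auto
    then have "(\<lambda>n. ennreal ((1 - 1 / real (Suc (Suc n))) powr (1 - p)) * gagliardo s p f) \<longlonglongrightarrow> ennreal ((1 - 0) powr (1 - p)) * gagliardo s p f"
      using False by (intro tendsto_mult_ennreal tendsto_const) auto
    then have "hardy_const s p \<Omega> * hardy_term s p \<Omega> f \<le> ennreal ((1 - 0) powr (1 - p)) * gagliardo s p f"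
    proof (rule tendsto_lowerbound)
      show "eventually (\<lambda>n. hardy_const s p \<Omega> * hardy_term s p \<Omega> f \<le> ennreal ((1 - 1 / real (Suc (Suc n))) powr (1 - p)) * gagliardo s p f) sequentially"
        by (intro always_eventually allI step) (simp_all add: field_simps)
    qed simp
    then show ?thesis by simp
  qed simp
qed

section \<open>The lower bound\<close>

text \<open>A decreasing function of \<open>\<bar>x\<bar>\<close> becomes monotone on the line when its values on one side are
  reflected at the value at the origin, and a monotone function has countably many discontinuities.\<close>

lemma (in rearrangeable) rearr_isCont_AE: "AE x in lborel. isCont (rearr u) x"
proof -
  \<comment> \<open>the reflected function, with its sign chosen so that it increases\<close>
  define h where "h x = (if x < 0 then rearr u x - 2 * rearr u 0 else - rearr u x)" for x
  have "mono h"
  proof (rule monoI)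
    fix x y :: real assume "x \<le> y"
    then show "h x \<le> h y"
      using rearr_decreasing[of x y] rearr_decreasing[of y x] rearr_decreasing[of 0 x] rearr_decreasing[of 0 y]
      by (auto simp: h_def)
  qed
  then have "countable {x. \<not> isCont h x}" by (rule mono_ctble_discont)
  then have "AE x in lborel. x \<notin> {x. \<not> isCont h x} \<union> {0}"
    by (intro AE_not_in countable_imp_null_set_lborel) auto
  then show ?thesis
  proof eventually_elim
    case (elim x)
    then have c: "isCont h x" and x: "x \<noteq> 0" by auto
    show "isCont (rearr u) x"
    proof (cases "x < 0")
      case True
      have "isCont (\<lambda>y. h y + 2 * rearr u 0) x" using c by (intro continuous_intros)
      moreover have "eventually (\<lambda>y. rearr u y = h y + 2 * rearr u 0) (nhds x)"
        using eventually_nhds_in_open[of "{..<0}" x] True by (auto simp: h_def elim!: eventually_mono)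
      ultimately show ?thesis by (simp add: isCont_cong)
    next
      case False
      have "isCont (\<lambda>y. - h y) x" using c by (intro continuous_intros)
      moreover have "eventually (\<lambda>y. rearr u y = - h y) (nhds x)"
        using eventually_nhds_in_open[of "{0<..}" x] False x by (auto simp: h_def elim!: eventually_mono)
      ultimately show ?thesis by (simp add: isCont_cong)
    qed
  qed
qed

lemma test_function_rearrangeable:
  assumes "u \<in> test_functions \<Omega>"
  obtains M where "rearrangeable u M"
proof -
  obtain M where "\<And>x. \<bar>u x\<bar> \<le> M" using test_function_bounded[OF assms] by blast
  then have "rearrangeable u M"
    using test_function_borel[OF assms] test_function_support_finite[OF assms] by unfold_locales
  then show ?thesis by (rule that)
qed

lemma frontier_punctured: "frontier (UNIV - {0::real}) = {0}"
proof -
  have "frontier (UNIV - {0::real}) = frontier {0}" by (metis frontier_complement Compl_eq_Diff_UNIV)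
  then show ?thesis by (simp add: frontier_def)
qed

lemma infdist_singleton: "infdist (x::real) {a} = \<bar>x - a\<bar>"
  by (simp add: dist_real_def)

lemma nn_integral_centered_kernel:
  assumes q: "0 < q" "q < 1" and m: "0 \<le> m"
  shows "(\<integral>\<^sup>+x\<in>centered m. ennreal (1 / \<bar>x\<bar> powr q) \<partial>lborel) = ennreal (2 powr q * m powr (1 - q) / (1 - q))"
proof -
  have pm: "1 / y powr q = y powr - q" for y :: real by (rule powr_minus_divide[symmetric])
  have "(\<integral>\<^sup>+x\<in>centered m. ennreal (1 / \<bar>x\<bar> powr q) \<partial>lborel)
     = (\<integral>\<^sup>+x. ennreal ((0 - x) powr - q) * indicator {-(m/2)<..<0} x + ennreal ((x - 0) powr - q) * indicator {0<..<m/2} x \<partial>lborel)"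
    using AE_lborel_singleton[of 0]
    by (intro nn_integral_cong_AE, eventually_elim) (auto simp: centered_def pm abs_if split: split_indicator)
  also have "\<dots> = ennreal ((m / 2) powr (1 - q) / (1 - q)) + ennreal ((m / 2) powr (1 - q) / (1 - q))"
    using q m by (subst nn_integral_add) (auto simp: nn_integral_right_end[of q "-(m/2)" 0, simplified] nn_integral_left_end[of q 0 "m/2", simplified])
  also have "\<dots> = ennreal (2 * (m / 2) powr (1 - q) / (1 - q))"
    using q by (subst ennreal_plus[symmetric]) auto
  also have "2 * (m / 2) powr (1 - q) = 2 powr q * m powr (1 - q)"
    using m by (simp add: powr_divide powr_diff)
  finally show ?thesis .
qed

lemma hardy_term_eq_weight:
  assumes "\<Omega> \<in> sets borel"
  shows "hardy_term s p \<Omega> u = (\<integral>\<^sup>+x. ennreal (\<bar>u x\<bar> powr p) * (ennreal (1 / infdist x (frontier \<Omega>) powr (s * p)) * indicator \<Omega> x) \<partial>lborel)"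
  unfolding hardy_term_def
proof (intro nn_integral_cong)
  fix x
  have "ennreal (\<bar>u x\<bar> powr p / infdist x (frontier \<Omega>) powr (s * p)) = ennreal (\<bar>u x\<bar> powr p) * ennreal (1 / infdist x (frontier \<Omega>) powr (s * p))"
    by (subst ennreal_mult[symmetric]) auto
  then show "ennreal (\<bar>u x\<bar> powr p / infdist x (frontier \<Omega>) powr (s * p)) * indicator \<Omega> x
     = ennreal (\<bar>u x\<bar> powr p) * (ennreal (1 / infdist x (frontier \<Omega>) powr (s * p)) * indicator \<Omega> x)"
    by (simp add: mult.assoc)
qed

lemma test_function_support: "u \<in> test_functions \<Omega> \<Longrightarrow> u x \<noteq> 0 \<Longrightarrow> x \<in> \<Omega>"
  using closure_subset[of "{x. u x \<noteq> 0}"] unfolding test_functions_def by blast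

text \<open>The hypothesis counts the points of \<open>\<Omega>\<close> close to its boundary. The punctured line has exactly
  \<open>2 * t\<close> of them at distance below \<open>t\<close>, and there the bathtub estimate is an equality for centred
  intervals, which are the superlevel sets after rearrangement.\<close>

theorem hardy_const_lower:
  fixes c :: real
  assumes s: "0 < s" "s < 1" and p: "1 \<le> p" and q: "s * p < 1"
    and \<Omega>: "open \<Omega>" "frontier \<Omega> \<noteq> {}" and c: "0 < c"
    and distr: "\<And>t. 0 < t \<Longrightarrow> emeasure lborel {x \<in> \<Omega>. infdist x (frontier \<Omega>) < t} \<le> ennreal (2 * c * t)"
  shows "hardy_const s p (UNIV - {0}) / ennreal (c powr (s * p)) \<le> hardy_const s p \<Omega>"
proof -
  let ?q = "s * p"
  have q0: "0 < ?q" using s p by simp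
  have [measurable]: "\<Omega> \<in> sets borel" using \<Omega> by auto
  let ?w = "\<lambda>x. ennreal (1 / infdist x (frontier \<Omega>) powr ?q) * indicator \<Omega> x"
  let ?w' = "\<lambda>x::real. ennreal (1 / infdist x (frontier (UNIV - {0})) powr ?q) * indicator (UNIV - {0}) x"
  have "hardy_const s p (UNIV - {0}) / ennreal (c powr ?q) \<le> gagliardo s p u"
    if u: "u \<in> test_functions \<Omega>" and one: "hardy_term s p \<Omega> u = 1" for u
  proof -
    obtain M where "rearrangeable u M" using test_function_rearrangeable[OF u] by blast
    then interpret rearrangeable u M .
    have "hardy_term s p \<Omega> u \<le> ennreal (c powr ?q) * (\<integral>\<^sup>+x. ennreal (rearr u x powr p) * ?w' x \<partial>lborel)"
      unfolding hardy_term_eq_weight[OF \<open>\<Omega> \<in> sets borel\<close>]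
    proof (rule weighted_rearr_le)
      fix \<tau> :: real assume \<tau>: "0 \<le> \<tau>"
      let ?E = "{x. \<tau> < \<bar>u x\<bar>}"
      have E\<Omega>: "?E \<subseteq> \<Omega>" using test_function_support[OF u] \<tau> by auto
      have "(\<integral>\<^sup>+x\<in>?E. ?w x \<partial>lborel) = (\<integral>\<^sup>+x\<in>?E. ennreal (1 / infdist x (frontier \<Omega>) powr ?q) \<partial>lborel)"
        using E\<Omega> by (intro nn_integral_cong) (auto split: split_indicator)
      also have "\<dots> \<le> ennreal ((2 * c) powr ?q * levelm \<tau> powr (1 - ?q) / (1 - ?q))"
      proof (rule bathtub_powr)
        show "emeasure lborel {x \<in> ?E. infdist x (frontier \<Omega>) < t} \<le> ennreal (2 * c * t)" if "0 < t" for t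
          using E\<Omega> by (intro order_trans[OF emeasure_mono distr[OF that]]) auto
        show "0 < infdist x (frontier \<Omega>)" if "x \<in> ?E" for x
          using that E\<Omega> by (intro infdist_frontier_pos \<Omega>) auto
      qed (use q0 q c \<tau> in \<open>auto simp: levelm_nonneg emeasure_level\<close>)
      also have "\<dots> = ennreal (c powr ?q) * ennreal (2 powr ?q * levelm \<tau> powr (1 - ?q) / (1 - ?q))"
        using c q by (subst ennreal_mult[symmetric]) (auto simp: powr_mult mult_ac)
      also have "ennreal (2 powr ?q * levelm \<tau> powr (1 - ?q) / (1 - ?q)) = (\<integral>\<^sup>+x\<in>centered (levelm \<tau>). ennreal (1 / \<bar>x\<bar> powr ?q) \<partial>lborel)"
        using nn_integral_centered_kernel[OF q0 q levelm_nonneg[of \<tau>]] by simp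
      also have "\<dots> = (\<integral>\<^sup>+x\<in>centered (levelm \<tau>). ?w' x \<partial>lborel)"
        by (intro nn_integral_cong) (auto simp: frontier_punctured infdist_singleton split: split_indicator)
      finally show "(\<integral>\<^sup>+x\<in>?E. ?w x \<partial>lborel) \<le> ennreal (c powr ?q) * (\<integral>\<^sup>+x\<in>centered (levelm \<tau>). ?w' x \<partial>lborel)" .
    qed (use p in auto)
    also have "(\<integral>\<^sup>+x. ennreal (rearr u x powr p) * ?w' x \<partial>lborel) = hardy_term s p (UNIV - {0}) (rearr u)"
      by (subst hardy_term_eq_weight) (auto simp: rearr_nonneg)
    finally have le: "1 \<le> ennreal (c powr ?q) * hardy_term s p (UNIV - {0}) (rearr u)" using one by simp
    have h0: "hardy_const s p (UNIV - {0}) * hardy_term s p (UNIV - {0}) (rearr u) \<le> gagliardo s p (rearr u)"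
    proof (rule hardy_const_le[OF s p q, where F = "{0}" and S = "centered (levelm 0)" and M = M])
      show "bounded (centered (levelm 0))" by (simp add: centered_def)
      show "rearr u x = 0" if "x \<notin> centered (levelm 0)" for x
        using that by (intro rearr_eq_0) (auto simp: centered_def abs_if split: if_splits)
      show "\<bar>rearr u x\<bar> \<le> M" for x using rearr_nonneg rearr_le by simp
    qed (auto simp: frontier_punctured rearr_isCont_AE open_delete)
    have "hardy_const s p (UNIV - {0}) * 1 \<le> hardy_const s p (UNIV - {0}) * (ennreal (c powr ?q) * hardy_term s p (UNIV - {0}) (rearr u))"
      by (intro mult_left_mono le) simp
    also have "\<dots> = ennreal (c powr ?q) * (hardy_const s p (UNIV - {0}) * hardy_term s p (UNIV - {0}) (rearr u))"
      by (simp add: mult.left_commute)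
    also have "\<dots> \<le> ennreal (c powr ?q) * gagliardo s p u"
      using order_trans[OF h0 gagliardo_rearr_le[OF s(1) p]] by (rule mult_left_mono) simp
    finally have "hardy_const s p (UNIV - {0}) \<le> gagliardo s p u * ennreal (c powr ?q)" by (simp add: mult.commute)
    then have "hardy_const s p (UNIV - {0}) / ennreal (c powr ?q) \<le> gagliardo s p u * ennreal (c powr ?q) / ennreal (c powr ?q)"
      by (rule divide_right_mono_ennreal)
    also have "\<dots> = gagliardo s p u" using c by (intro ennreal_mult_divide_eq) auto
    finally show ?thesis .
  qed
  then show ?thesis
    unfolding hardy_const_def[of s p \<Omega>] by (intro Inf_greatest) (auto simp: hardy_term_def)
qed

section \<open>Finite unions of bounded open intervals\<close>

lemma bounded_open_interval:
  fixes S :: "real set"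
  assumes "S \<noteq> {}" "open S" "is_interval S" "bounded S"
  shows "S = {Inf S<..<Sup S}" "Inf S < Sup S"
proof -
  have bd: "bdd_above S" "bdd_below S" using assms(4) by (auto simp: bounded_imp_bdd_above bounded_imp_bdd_below)
  show eq: "S = {Inf S<..<Sup S}"
  proof (intro equalityI subsetI)
    fix x assume x: "x \<in> S"
    then obtain e where e: "0 < e" "ball x e \<subseteq> S" using assms(2) openE by blast
    have "x - e / 2 \<in> S" "x + e / 2 \<in> S" using e by (auto simp: dist_real_def intro!: subsetD[OF e(2)])
    then show "x \<in> {Inf S<..<Sup S}"
      using cInf_lower[OF _ bd(2), of "x - e/2"] cSup_upper[OF _ bd(1), of "x + e/2"] e(1) by auto
  next
    fix x assume "x \<in> {Inf S<..<Sup S}"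
    then obtain y z where "y \<in> S" "y < x" "z \<in> S" "x < z"
      using cInf_less_iff[OF assms(1) bd(2)] less_cSup_iff[OF assms(1) bd(1)] by auto
    then show "x \<in> S" using assms(3) unfolding is_interval_1 by (meson less_imp_le)
  qed
  have "{Inf S<..<Sup S} \<noteq> {}" using eq assms(1) by simp
  then show "Inf S < Sup S" by simp
qed

locale interval_union =
  fixes n :: nat and I :: "nat \<Rightarrow> real set" and \<Omega> :: "real set"
  assumes n: "1 \<le> n"
    and pieces: "\<And>k. k \<in> {1..n} \<Longrightarrow> I k \<noteq> {} \<and> open (I k) \<and> is_interval (I k) \<and> bounded (I k)"
    and disj: "disjoint_family_on I {1..n}"
    and \<Omega>_def: "\<Omega> = (\<Union>k\<in>{1..n}. I k)"
begin

definition lo where "lo k = Inf (I k)"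
definition hi where "hi k = Sup (I k)"

lemma I_eq: "k \<in> {1..n} \<Longrightarrow> I k = {lo k<..<hi k}" and lo_less_hi: "k \<in> {1..n} \<Longrightarrow> lo k < hi k"
  unfolding lo_def hi_def using bounded_open_interval[of "I k"] pieces[of k] by auto

lemma open_\<Omega>: "open \<Omega>" unfolding \<Omega>_def using pieces by auto

lemma \<Omega>_borel[measurable]: "\<Omega> \<in> sets borel" using open_\<Omega> by auto

lemma bounded_\<Omega>: "bounded \<Omega>" unfolding \<Omega>_def using pieces by auto

text \<open>An end of one piece is in its closure; were it in another piece, that open piece would meet the
  first one.\<close>

lemma ends_notin: assumes k: "k \<in> {1..n}" shows "lo k \<notin> \<Omega>" "hi k \<notin> \<Omega>"
proof -
  have "False" if e: "e \<in> \<Omega>" "e \<in> {lo k, hi k}" for e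
  proof -
    obtain j where j: "j \<in> {1..n}" "e \<in> I j" using e(1) unfolding \<Omega>_def by blast
    have "e \<notin> I k" using e(2) I_eq[OF k] by auto
    then have "j \<noteq> k" using j by auto
    then have "I j \<inter> I k = {}" using disj j k unfolding disjoint_family_on_def by blast
    moreover have "e \<in> closure (I k)" using e(2) I_eq[OF k] lo_less_hi[OF k] by (auto simp: closure_greaterThanLessThan)
    ultimately show False using j pieces[OF j(1)] by (metis disjoint_iff open_Int_closure_eq_empty)
  qed
  then show "lo k \<notin> \<Omega>" "hi k \<notin> \<Omega>" by blast+
qed

lemma ends_frontier: assumes k: "k \<in> {1..n}" shows "lo k \<in> frontier \<Omega>" "hi k \<in> frontier \<Omega>"
proof -
  have "closure (I k) \<subseteq> closure \<Omega>" unfolding \<Omega>_def using k by (intro closure_mono) auto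
  moreover have "closure (I k) = {lo k..hi k}" using I_eq[OF k] lo_less_hi[OF k] by (simp add: closure_greaterThanLessThan)
  ultimately have "lo k \<in> closure \<Omega>" "hi k \<in> closure \<Omega>" using lo_less_hi[OF k] by auto
  then show "lo k \<in> frontier \<Omega>" "hi k \<in> frontier \<Omega>"
    using ends_notin[OF k] open_\<Omega> by (auto simp: frontier_def interior_open)
qed

lemma frontier_subset: "frontier \<Omega> \<subseteq> lo ` {1..n} \<union> hi ` {1..n}"
proof
  fix x assume x: "x \<in> frontier \<Omega>"
  have "closure \<Omega> \<subseteq> (\<Union>k\<in>{1..n}. closure (I k))"
  proof (rule closure_minimal)
    show "\<Omega> \<subseteq> (\<Union>k\<in>{1..n}. closure (I k))" unfolding \<Omega>_def using closure_subset by blast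
  qed (intro closed_UN; simp)
  then obtain k where k: "k \<in> {1..n}" "x \<in> closure (I k)" using x unfolding frontier_def by blast
  have "x \<notin> \<Omega>" using x open_\<Omega> by (simp add: frontier_def interior_open)
  then have "x \<notin> I k" using k(1) unfolding \<Omega>_def by blast
  then have "x = lo k \<or> x = hi k" using k I_eq[OF k(1)] lo_less_hi[OF k(1)] by (auto simp: closure_greaterThanLessThan)
  then show "x \<in> lo ` {1..n} \<union> hi ` {1..n}" using k(1) by auto
qed

lemma finite_frontier: "finite (frontier \<Omega>)"
  using finite_subset[OF frontier_subset] by simp

lemma frontier_nonempty: "frontier \<Omega> \<noteq> {}"
  using ends_frontier(1)[of 1] n by auto

lemma infdist_piece:
  assumes k: "k \<in> {1..n}" and x: "x \<in> I k"
  shows "infdist x (frontier \<Omega>) = min (x - lo k) (hi k - x)"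
proof (rule antisym)
  show "infdist x (frontier \<Omega>) \<le> min (x - lo k) (hi k - x)"
    using infdist_le[OF ends_frontier(1)[OF k], of x] infdist_le[OF ends_frontier(2)[OF k], of x] x I_eq[OF k]
    by (auto simp: dist_real_def)
  show "min (x - lo k) (hi k - x) \<le> infdist x (frontier \<Omega>)"
    unfolding infdist_notempty[OF frontier_nonempty]
  proof (rule cINF_greatest[OF frontier_nonempty])
    fix y assume y: "y \<in> frontier \<Omega>"
    then have "y \<notin> \<Omega>" using open_\<Omega> by (simp add: frontier_def interior_open)
    then have "y \<notin> I k" using k unfolding \<Omega>_def by blast
    then show "min (x - lo k) (hi k - x) \<le> dist x y" using x I_eq[OF k] by (auto simp: dist_real_def)
  qed
qed

lemma near_frontier:
  assumes t: "0 < t"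
  shows "emeasure lborel {x \<in> \<Omega>. infdist x (frontier \<Omega>) < t} \<le> ennreal (2 * real n * t)"
proof -
  have "{x \<in> \<Omega>. infdist x (frontier \<Omega>) < t} \<subseteq> (\<Union>k\<in>{1..n}. {lo k<..<lo k + t} \<union> {hi k - t<..<hi k})"
  proof
    fix x assume x: "x \<in> {x \<in> \<Omega>. infdist x (frontier \<Omega>) < t}"
    then obtain k where k: "k \<in> {1..n}" "x \<in> I k" unfolding \<Omega>_def by blast
    then have "min (x - lo k) (hi k - x) < t" using infdist_piece[OF k] x by simp
    then show "x \<in> (\<Union>k\<in>{1..n}. {lo k<..<lo k + t} \<union> {hi k - t<..<hi k})"
      using k I_eq[OF k(1)] by (intro UN_I[OF k(1)]) auto
  qed
  then have "emeasure lborel {x \<in> \<Omega>. infdist x (frontier \<Omega>) < t} \<le> emeasure lborel (\<Union>k\<in>{1..n}. {lo k<..<lo k + t} \<union> {hi k - t<..<hi k})"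
    by (intro emeasure_mono) auto
  also have "\<dots> \<le> (\<Sum>k\<in>{1..n}. emeasure lborel ({lo k<..<lo k + t} \<union> {hi k - t<..<hi k}))"
    by (intro emeasure_subadditive_finite) auto
  also have "\<dots> \<le> (\<Sum>k\<in>{1..n}. ennreal (2 * t))"
  proof (intro sum_mono)
    fix k
    have "emeasure lborel ({lo k<..<lo k + t} \<union> {hi k - t<..<hi k}) \<le> emeasure lborel {lo k<..<lo k + t} + emeasure lborel {hi k - t<..<hi k}"
      by (rule emeasure_subadditive) auto
    also have "\<dots> = ennreal (2 * t)" using t by (simp add: ennreal_plus[symmetric] del: ennreal_plus)
    finally show "emeasure lborel ({lo k<..<lo k + t} \<union> {hi k - t<..<hi k}) \<le> ennreal (2 * t)" .
  qed
  also have "\<dots> = ennreal (2 * real n * t)"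
    using t by (simp add: ennreal_of_nat_eq_real_of_nat ennreal_mult[symmetric] mult_ac)
  finally show ?thesis .
qed

end

section \<open>Removing the integers from an interval\<close>

lemma gap_weight:
  assumes q: "0 < q" "q < 1" and ab: "\<alpha> \<le> \<beta>"
  shows "(\<integral>\<^sup>+x\<in>{\<alpha><..<\<beta>}. ennreal (1 / min (x - \<alpha>) (\<beta> - x) powr q) \<partial>lborel) = ennreal (2 powr q * (\<beta> - \<alpha>) powr (1 - q) / (1 - q))"
proof -
  define c where "c = (\<alpha> + \<beta>) / 2"
  have c: "c - \<alpha> = (\<beta> - \<alpha>) / 2" "\<beta> - c = (\<beta> - \<alpha>) / 2" by (auto simp: c_def field_simps)
  have pm: "1 / y powr q = y powr - q" for y :: real by (rule powr_minus_divide[symmetric])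
  have "(\<integral>\<^sup>+x\<in>{\<alpha><..<\<beta>}. ennreal (1 / min (x - \<alpha>) (\<beta> - x) powr q) \<partial>lborel)
     = (\<integral>\<^sup>+x. ennreal ((x - \<alpha>) powr - q) * indicator {\<alpha><..<c} x + ennreal ((\<beta> - x) powr - q) * indicator {c<..<\<beta>} x \<partial>lborel)"
    using AE_lborel_singleton[of c]
    by (intro nn_integral_cong_AE, eventually_elim)
      (use ab in \<open>auto simp: c_def pm min_def field_simps split: split_indicator\<close>)
  also have "\<dots> = ennreal ((c - \<alpha>) powr (1 - q) / (1 - q)) + ennreal ((\<beta> - c) powr (1 - q) / (1 - q))"
    using q ab by (subst nn_integral_add) (auto simp: c_def nn_integral_right_end nn_integral_left_end)
  also have "ennreal ((c - \<alpha>) powr (1 - q) / (1 - q)) + ennreal ((\<beta> - c) powr (1 - q) / (1 - q))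
     = ennreal (2 * ((\<beta> - \<alpha>) / 2) powr (1 - q) / (1 - q))"
    unfolding c using q by (simp add: ennreal_plus[symmetric] del: ennreal_plus)
  also have "2 * ((\<beta> - \<alpha>) / 2) powr (1 - q) = 2 powr q * (\<beta> - \<alpha>) powr (1 - q)"
    using ab by (simp add: powr_divide powr_diff)
  finally show ?thesis .
qed

lemma isCont_indicator_AE:
  fixes A :: "real set"
  assumes "finite (frontier A)"
  shows "AE x in lborel. isCont (indicator A :: real \<Rightarrow> real) x"
  using AE_not_in[OF finite_imp_null_set_lborel[OF assms]]
  by eventually_elim (simp only: isCont_indicator not_False_eq_True)

lemma gagliardo_cong_AE:
  assumes "AE x in lborel. f x = g x"
  shows "gagliardo s p f = gagliardo s p g"
  unfolding gagliardo_def
proof (rule nn_integral_cong_AE)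
  show "AE y in lborel. (\<integral>\<^sup>+x. ennreal (\<bar>f x - f y\<bar> powr p / \<bar>x - y\<bar> powr (1 + s * p)) \<partial>lborel)
      = (\<integral>\<^sup>+x. ennreal (\<bar>g x - g y\<bar> powr p / \<bar>x - y\<bar> powr (1 + s * p)) \<partial>lborel)"
    using assms
  proof eventually_elim
    case (elim y)
    show ?case
      by (rule nn_integral_cong_AE) (use assms in \<open>eventually_elim, simp add: elim\<close>)
  qed
qed

lemma hardy_term_indicator:
  "hardy_term s p \<Omega> (indicator S) = (\<integral>\<^sup>+x\<in>\<Omega> \<inter> S. ennreal (1 / infdist x (frontier \<Omega>) powr (s * p)) \<partial>lborel)"
  unfolding hardy_term_def by (intro nn_integral_cong) (auto split: split_indicator)

lemma le_divide_ennreal_real: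
  assumes "h * ennreal A \<le> ennreal B" "0 < A" "0 \<le> B"
  shows "h \<le> ennreal (B / A)"
proof -
  have "h = h * ennreal A / ennreal A" using assms by (intro ennreal_mult_divide_eq[symmetric]) auto
  also have "\<dots> \<le> ennreal B / ennreal A" by (rule divide_right_mono_ennreal[OF assms(1)])
  finally show ?thesis using assms by (simp add: divide_ennreal)
qed

text \<open>The competitor is the indicator function of \<open>(-R, R)\<close>. Its Hardy term is at least that of the
  \<open>2 * \<lfloor>R\<rfloor>\<close> unit gaps it covers. Leaving \<open>\<Omega>\<close> open, apart from containing \<open>(-R, R) - \<int>\<close>, covers
  the complement of the integers as well.\<close>

theorem hardy_const_integers_removed:
  assumes s: "0 < s" "s < 1" and p: "1 \<le> p" and q: "s * p < 1" and R: "1 \<le> R"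
    and \<Omega>: "open \<Omega>" "\<Omega> \<inter> \<int> = {}" "{-R<..<R} - \<int> \<subseteq> \<Omega>"
  shows "hardy_const s p \<Omega> \<le> ennreal (R powr (1 - s * p) / of_int \<lfloor>R\<rfloor> * (4 powr (1 - s * p) / (s * p)))"
proof -
  let ?q = "s * p"
  have q0: "0 < ?q" using s p by simp
  have [measurable]: "\<Omega> \<in> sets borel" using \<Omega> by auto
  define m where "m = \<lfloor>R\<rfloor>"
  have m: "1 \<le> m" "of_int m \<le> R" using R by (auto simp: m_def le_floor_iff)
  define G where "G j = {of_int j<..<of_int (j + 1) :: real}" for j :: int
  have G\<Omega>: "G j \<subseteq> \<Omega> \<inter> {-R<..<R}" if j: "- m \<le> j" "j < m" for j
  proof
    fix x assume x: "x \<in> G j"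
    have "x \<notin> \<int>"
    proof
      assume "x \<in> \<int>"
      then obtain i :: int where "x = of_int i" by (auto elim: Ints_cases)
      then show False using x by (auto simp: G_def)
    qed
    moreover have "- R < x"
    proof -
      have "real_of_int (- m) \<le> of_int j" using j(1) by (simp only: of_int_le_iff)
      then show ?thesis using m(2) x by (auto simp: G_def)
    qed
    moreover have "x < R"
    proof -
      have "real_of_int (j + 1) \<le> of_int m" using j(2) by (simp only: of_int_le_iff)
      then show ?thesis using m(2) x by (auto simp: G_def)
    qed
    ultimately show "x \<in> \<Omega> \<inter> {-R<..<R}" using \<Omega>(3) by auto
  qed
  have fr: "of_int j \<in> frontier \<Omega>" "of_int (j + 1) \<in> frontier \<Omega>" if j: "- m \<le> j" "j < m" for j
  proof -
    have "closure (G j) \<subseteq> closure \<Omega>" using G\<Omega>[OF j] by (intro closure_mono) auto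
    then have "of_int j \<in> closure \<Omega>" "of_int (j + 1) \<in> closure \<Omega>"
      by (auto simp: G_def closure_greaterThanLessThan)
    moreover have "of_int i \<notin> \<Omega>" for i using \<Omega>(2) by (auto simp: disjoint_iff)
    ultimately show "of_int j \<in> frontier \<Omega>" "of_int (j + 1) \<in> frontier \<Omega>"
      using \<Omega>(1) by (auto simp: frontier_def interior_open simp del: of_int_add)
  qed
  have frne: "frontier \<Omega> \<noteq> {}" using fr(1)[of 0] m by auto
  define A where "A = 2 * of_int m * (2 powr ?q / (1 - ?q))"
  have A: "0 < A" using m q by (simp add: A_def)
  have "ennreal A \<le> hardy_term s p \<Omega> (indicator {-R<..<R})"
  proof -
    have "ennreal A = (\<Sum>j\<in>{-m..<m}. ennreal (2 powr ?q / (1 - ?q)))"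
      using m q by (simp add: A_def ennreal_of_nat_eq_real_of_nat ennreal_mult[symmetric])
    also have "\<dots> = (\<Sum>j\<in>{-m..<m}. \<integral>\<^sup>+x\<in>G j. ennreal (1 / min (x - of_int j) (of_int (j + 1) - x) powr ?q) \<partial>lborel)"
      unfolding G_def using q0 q by (intro sum.cong refl) (subst gap_weight, auto)
    also have "\<dots> \<le> (\<Sum>j\<in>{-m..<m}. \<integral>\<^sup>+x\<in>G j. ennreal (1 / infdist x (frontier \<Omega>) powr ?q) \<partial>lborel)"
    proof (intro sum_mono nn_integral_mono)
      fix j x assume "j \<in> {-m..<m}"
      then have j: "- m \<le> j" "j < m" by auto
      show "ennreal (1 / min (x - of_int j) (of_int (j + 1) - x) powr ?q) * indicator (G j) x
         \<le> ennreal (1 / infdist x (frontier \<Omega>) powr ?q) * indicator (G j) x"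
      proof (cases "x \<in> G j")
        case True
        have "infdist x (frontier \<Omega>) \<le> min (x - of_int j) (of_int (j + 1) - x)"
          using infdist_le[OF fr(1)[OF j], of x] infdist_le[OF fr(2)[OF j], of x] True
          by (auto simp: G_def dist_real_def)
        moreover have "0 < infdist x (frontier \<Omega>)"
          using G\<Omega>[OF j] True by (intro infdist_frontier_pos \<Omega>(1) frne) auto
        ultimately have "1 / min (x - of_int j) (of_int (j + 1) - x) powr ?q \<le> 1 / infdist x (frontier \<Omega>) powr ?q"
          using q0 by (intro divide_left_mono powr_mono2 mult_pos_pos) auto
        then show ?thesis using True by (simp add: ennreal_leI)
      qed simp
    qed
    also have "\<dots> = (\<integral>\<^sup>+x. (\<Sum>j\<in>{-m..<m}. ennreal (1 / infdist x (frontier \<Omega>) powr ?q) * indicator (G j) x) \<partial>lborel)"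
      by (rule nn_integral_sum[symmetric]) (simp add: G_def)
    also have "\<dots> \<le> hardy_term s p \<Omega> (indicator {-R<..<R})"
      unfolding hardy_term_indicator
    proof (intro nn_integral_mono)
      fix x :: real
      have "(\<Sum>j\<in>{-m..<m}. indicator (G j) x) \<le> (indicator (\<Omega> \<inter> {-R<..<R}) x :: ennreal)"
      proof (cases "\<exists>j\<in>{-m..<m}. x \<in> G j")
        case True
        then obtain j where j: "j \<in> {-m..<m}" "x \<in> G j" by blast
        have uniq: "i = j" if "x \<in> G i" for i using that j(2) unfolding G_def by auto
        have "(\<Sum>i\<in>{-m..<m}. indicator (G i) x :: ennreal) = (\<Sum>i\<in>{-m..<m}. if i = j then 1 else 0)"
        proof (intro sum.cong refl)
          fix i
          show "indicator (G i) x = (if i = j then 1 else 0 :: ennreal)"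
            using uniq[of i] j(2) by (cases "x \<in> G i") auto
        qed
        also have "\<dots> = 1" using j(1) by simp
        finally show ?thesis using G\<Omega>[of j] j by (auto split: split_indicator)
      next
        case False
        then have "(\<Sum>j\<in>{-m..<m}. indicator (G j) x :: ennreal) = 0" by (intro sum.neutral) auto
        then show ?thesis by simp
      qed
      then show "(\<Sum>j\<in>{-m..<m}. ennreal (1 / infdist x (frontier \<Omega>) powr ?q) * indicator (G j) x)
         \<le> ennreal (1 / infdist x (frontier \<Omega>) powr ?q) * indicator (\<Omega> \<inter> {-R<..<R}) x"
        unfolding sum_distrib_left[symmetric] by (rule mult_left_mono) simp
    qed
    finally show ?thesis .
  qed
  then have "hardy_const s p \<Omega> * ennreal A \<le> hardy_const s p \<Omega> * hardy_term s p \<Omega> (indicator {-R<..<R})"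
    by (rule mult_left_mono) simp
  also have "\<dots> \<le> gagliardo s p (indicator {-R<..<R})"
  proof (rule hardy_const_le[OF s p q \<Omega>(1) frne, where F = "(\<int> \<inter> {-R..R}) \<union> {-R, R}" and S = "{-R<..<R}" and M = 1])
    have "\<int> \<inter> {-R..R} = of_int ` {i :: int. -R \<le> of_int i \<and> of_int i \<le> R}"
      by (auto elim: Ints_cases)
    moreover have "finite {i :: int. -R \<le> of_int i \<and> of_int i \<le> R}"
      by (rule finite_subset[of _ "{\<lceil>-R\<rceil>..\<lfloor>R\<rfloor>}"]) (auto simp: ceiling_le_iff le_floor_iff)
    ultimately show "finite (\<int> \<inter> {-R..R} \<union> {-R, R})" by simp
    have "closure {-R<..<R} = {-R..R}" using R by (simp add: closure_greaterThanLessThan)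
    then show "closure {-R<..<R} \<subseteq> \<Omega> \<union> (\<int> \<inter> {-R..R} \<union> {-R, R})"
      using \<Omega>(3) by force
    have "frontier {-R<..<R} = {-R, R}" using R by (auto simp: frontier_def closure_greaterThanLessThan)
    then show "AE x in lborel. isCont (indicat_real {-R<..<R}) x"
      by (intro isCont_indicator_AE) simp
  qed (auto split: split_indicator)
  also have "\<dots> = ennreal (4 * (2 * R) powr (1 - ?q) / (?q * (1 - ?q)))"
    using gagliardo_interval[of s p "-R" R] q0 q p R by simp
  finally have "hardy_const s p \<Omega> * ennreal A \<le> ennreal (4 * (2 * R) powr (1 - ?q) / (?q * (1 - ?q)))" .
  then have "hardy_const s p \<Omega> \<le> ennreal (4 * (2 * R) powr (1 - ?q) / (?q * (1 - ?q)) / A)"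
    by (rule le_divide_ennreal_real[OF _ A]) (use q0 q in simp)
  also have "4 * (2 * R) powr (1 - ?q) / (?q * (1 - ?q)) / A = R powr (1 - ?q) / of_int m * (4 powr (1 - ?q) / ?q)"
  proof -
    have "4 powr (1 - ?q) = (2 * 2) powr (1 - ?q)" by simp
    also have "\<dots> = 2 powr (1 - ?q) * 2 powr (1 - ?q)" by (rule powr_mult)
    also have "\<dots> = 2 powr (1 - ?q) * (2 / 2 powr ?q)" by (simp add: powr_diff)
    finally have four: "4 powr (1 - ?q) = 2 * 2 powr (1 - ?q) / 2 powr ?q" by simp
    have "4 * (X * Y) / (a * b) / (2 * c * (d / b)) = Y / c * (2 * X / d / a)" if "0 < b" "0 < c" "0 < d" "0 < a" for X Y a b c d :: real
      using that by (simp add: field_simps)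
    from this[of "1 - ?q" "of_int m" "2 powr ?q" ?q "2 powr (1 - ?q)" "R powr (1 - ?q)"]
    show ?thesis unfolding four A_def using q q0 m R by (simp add: powr_mult)
  qed
  finally show ?thesis unfolding m_def .
qed

theorem hardy_const_integers_complement:
  assumes s: "0 < s" "s < 1" and p: "1 \<le> p" and q: "s * p < 1"
  shows "hardy_const s p (UNIV - \<int>) = 0"
proof -
  let ?q = "s * p"
  have q0: "0 < ?q" using s p by simp
  have "hardy_const s p (UNIV - \<int>) \<le> ennreal (real (Suc m) powr - ?q * (4 powr (1 - ?q) / ?q))" for m
  proof -
    have "hardy_const s p (UNIV - \<int>) \<le> ennreal (real (Suc m) powr (1 - ?q) / of_int \<lfloor>real (Suc m)\<rfloor> * (4 powr (1 - ?q) / ?q))"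
      by (rule hardy_const_integers_removed[OF s p q]) (auto simp: open_Diff closed_Ints)
    moreover have "real (Suc m) powr (1 - ?q) / of_int \<lfloor>real (Suc m)\<rfloor> = real (Suc m) powr - ?q"
      using powr_mult_base[of "real (Suc m)" "- ?q"] by (simp add: field_simps)
    ultimately show ?thesis by (simp only:)
  qed
  moreover have "(\<lambda>m. ennreal (real (Suc m) powr - ?q * (4 powr (1 - ?q) / ?q))) \<longlonglongrightarrow> ennreal (0 * (4 powr (1 - ?q) / ?q))"
  proof (intro tendsto_ennrealI tendsto_mult tendsto_const)
    have "filterlim (\<lambda>m. real (Suc m)) at_top sequentially"
      by (rule filterlim_compose[OF filterlim_real_sequentially filterlim_Suc])
    then show "(\<lambda>m. real (Suc m) powr - ?q) \<longlonglongrightarrow> 0"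
      using q0 by (intro tendsto_neg_powr) auto
  qed
  ultimately have "hardy_const s p (UNIV - \<int>) \<le> ennreal (0 * (4 powr (1 - ?q) / ?q))"
    by (intro tendsto_lowerbound[of _ _ sequentially]) auto
  then show ?thesis by simp
qed

section \<open>The case \<open>p = 1\<close>\<close>

text \<open>The distance is measured to the boundary of \<open>\<Omega>\<close>, not to that of \<open>E\<close>.\<close>

definition weight_on :: "real \<Rightarrow> real set \<Rightarrow> real set \<Rightarrow> ennreal" where
  "weight_on s \<Omega> E = (\<integral>\<^sup>+x\<in>E. ennreal (1 / infdist x (frontier \<Omega>) powr s) \<partial>lborel)"

lemma weight_on_mono: "E \<subseteq> E' \<Longrightarrow> weight_on s \<Omega> E \<le> weight_on s \<Omega> E'"
  unfolding weight_on_def by (intro nn_integral_mono) (auto split: split_indicator)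

lemma weight_on_Un:
  assumes [measurable]: "E \<in> sets borel" "E' \<in> sets borel"
  shows "weight_on s \<Omega> (E \<union> E') \<le> weight_on s \<Omega> E + weight_on s \<Omega> E'"
proof -
  have "weight_on s \<Omega> (E \<union> E') \<le> (\<integral>\<^sup>+x. ennreal (1 / infdist x (frontier \<Omega>) powr s) * indicator E x + ennreal (1 / infdist x (frontier \<Omega>) powr s) * indicator E' x \<partial>lborel)"
    unfolding weight_on_def by (intro nn_integral_mono) (auto split: split_indicator)
  also have "\<dots> = weight_on s \<Omega> E + weight_on s \<Omega> E'"
    unfolding weight_on_def by (intro nn_integral_add) auto
  finally show ?thesis .
qed

lemma weight_on_bound:
  assumes s: "0 < s" "s < 1" and N: "0 < N" and \<Omega>: "open \<Omega>" "frontier \<Omega> \<noteq> {}"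
    and E[measurable]: "E \<in> sets borel" and E\<Omega>: "E \<subseteq> \<Omega>" and mE: "emeasure lborel E = ennreal m" and m: "0 \<le> m"
    and distr: "\<And>t. 0 < t \<Longrightarrow> emeasure lborel {x \<in> E. infdist x (frontier \<Omega>) < t} \<le> ennreal (N * t)"
  shows "weight_on s \<Omega> E \<le> ennreal (N powr s * m powr (1 - s) / (1 - s))"
  unfolding weight_on_def
  by (rule bathtub_powr[OF s N m E _ mE _ distr]) (use E\<Omega> in \<open>auto intro: infdist_frontier_pos[OF \<Omega>]\<close>)

lemma hardy_term_coarea:
  assumes u: "u \<in> test_functions \<Omega>" and [measurable]: "\<Omega> \<in> sets borel"
  shows "hardy_term s 1 \<Omega> u = (\<integral>\<^sup>+\<tau>\<in>{0..}. weight_on s \<Omega> {x. \<tau> < \<bar>u x\<bar>} \<partial>lborel)"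
proof -
  let ?w = "\<lambda>x. ennreal (1 / infdist x (frontier \<Omega>) powr s) * indicator \<Omega> x"
  have [measurable]: "u \<in> borel_measurable borel" by (rule test_function_borel[OF u])
  have "hardy_term s 1 \<Omega> u = (\<integral>\<^sup>+x. ennreal \<bar>u x\<bar> * ?w x \<partial>lborel)"
    by (subst hardy_term_eq_weight) auto
  also have "\<dots> = (\<integral>\<^sup>+\<tau>\<in>{0..}. (\<integral>\<^sup>+x\<in>{x. \<tau> < \<bar>u x\<bar>}. ?w x \<partial>lborel) \<partial>lborel)"
    by (rule nn_integral_weight_layer) auto
  also have "\<dots> = (\<integral>\<^sup>+\<tau>\<in>{0..}. weight_on s \<Omega> {x. \<tau> < \<bar>u x\<bar>} \<partial>lborel)"
  proof (rule nn_integral_cong)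
    fix \<tau> :: real
    have "0 \<le> \<tau> \<Longrightarrow> (\<integral>\<^sup>+x\<in>{x. \<tau> < \<bar>u x\<bar>}. ?w x \<partial>lborel) = weight_on s \<Omega> {x. \<tau> < \<bar>u x\<bar>}"
      unfolding weight_on_def
    proof (rule nn_integral_cong)
      fix x assume "0 \<le> \<tau>"
      then have "\<tau> < \<bar>u x\<bar> \<Longrightarrow> x \<in> \<Omega>" using test_function_support[OF u, of x] by auto
      then show "?w x * indicator {x. \<tau> < \<bar>u x\<bar>} x = ennreal (1 / infdist x (frontier \<Omega>) powr s) * indicator {x. \<tau> < \<bar>u x\<bar>} x"
        by (auto split: split_indicator)
    qed
    then show "(\<integral>\<^sup>+x\<in>{x. \<tau> < \<bar>u x\<bar>}. ?w x \<partial>lborel) * indicator {0..} \<tau> = weight_on s \<Omega> {x. \<tau> < \<bar>u x\<bar>} * indicator {0..} \<tau>"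
      by (auto split: split_indicator)
  qed
  finally show ?thesis .
qed

lemma gagliardo_levels_le:
  assumes u: "u \<in> test_functions \<Omega>" and s: "0 < s"
  shows "(\<integral>\<^sup>+\<tau>\<in>{0..}. gagliardo s 1 (indicator {x. \<tau> < \<bar>u x\<bar>}) \<partial>lborel) \<le> gagliardo s 1 u"
proof -
  have "(\<integral>\<^sup>+\<tau>\<in>{0..}. gagliardo s 1 (indicator {x. \<tau> < \<bar>u x\<bar>}) \<partial>lborel) = gagliardo s 1 (\<lambda>x. \<bar>u x\<bar>)"
    by (rule gagliardo_coarea[symmetric, OF test_function_borel[OF u] s])
  also have "\<dots> \<le> gagliardo s 1 u"
    unfolding gagliardo_def
    by (intro nn_integral_mono ennreal_leI divide_right_mono powr_mono2) auto
  finally show ?thesis .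
qed

lemma level_set_test:
  assumes u: "u \<in> test_functions \<Omega>" and \<tau>: "0 \<le> \<tau>"
  shows "{x. \<tau> < \<bar>u x\<bar>} \<in> sets borel" "{x. \<tau> < \<bar>u x\<bar>} \<subseteq> \<Omega>" "\<exists>m\<ge>0. emeasure lborel {x. \<tau> < \<bar>u x\<bar>} = ennreal m"
proof -
  have [measurable]: "u \<in> borel_measurable borel" by (rule test_function_borel[OF u])
  show "{x. \<tau> < \<bar>u x\<bar>} \<in> sets borel" by measurable
  show "{x. \<tau> < \<bar>u x\<bar>} \<subseteq> \<Omega>" using test_function_support[OF u] \<tau> by auto
  have "emeasure lborel {x. \<tau> < \<bar>u x\<bar>} \<le> emeasure lborel {x. u x \<noteq> 0}"
    using \<tau> by (intro emeasure_mono) auto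
  then have "emeasure lborel {x. \<tau> < \<bar>u x\<bar>} < \<infinity>" using test_function_support_finite[OF u] by (rule le_less_trans)
  then show "\<exists>m\<ge>0. emeasure lborel {x. \<tau> < \<bar>u x\<bar>} = ennreal m"
    by (cases "emeasure lborel {x. \<tau> < \<bar>u x\<bar>}") auto
qed

lemma perimeter_ge:
  assumes s: "0 < s" "s < 1" and E: "E \<in> sets borel" and mE: "emeasure lborel E = ennreal m" and m: "0 \<le> m"
  shows "ennreal (4 * m powr (1 - s) / (s * (1 - s))) \<le> gagliardo s 1 (indicator E)"
  by (rule order_trans[OF _ perimeter_deficit[OF E mE m s]]) simp

text \<open>By coarea the claim reduces to sets, where the isoperimetric inequality bounds the perimeter from
  below and the bathtub estimate bounds the weight from above, both by multiples of
  \<open>m powr (1 - s)\<close>.\<close>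

theorem hardy_const_1_lower:
  assumes s: "0 < s" "s < 1" and \<Omega>: "open \<Omega>" "frontier \<Omega> \<noteq> {}" and N: "0 < N"
    and distr: "\<And>t. 0 < t \<Longrightarrow> emeasure lborel {x \<in> \<Omega>. infdist x (frontier \<Omega>) < t} \<le> ennreal (N * t)"
  shows "ennreal (4 / (s * N powr s)) \<le> hardy_const s 1 \<Omega>"
proof -
  let ?K = "4 / (s * N powr s)"
  have [measurable]: "\<Omega> \<in> sets borel" using \<Omega> by auto
  have K: "0 \<le> ?K" using s by simp
  have "ennreal ?K \<le> gagliardo s 1 u" if u: "u \<in> test_functions \<Omega>" and one: "hardy_term s 1 \<Omega> u = 1" for u
  proof -
    have lev: "ennreal ?K * weight_on s \<Omega> {x. \<tau> < \<bar>u x\<bar>} \<le> gagliardo s 1 (indicator {x. \<tau> < \<bar>u x\<bar>})" if \<tau>: "0 \<le> \<tau>" for \<tau>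
    proof -
      let ?E = "{x. \<tau> < \<bar>u x\<bar>}"
      note E = level_set_test[OF u \<tau>]
      obtain m where m: "0 \<le> m" "emeasure lborel ?E = ennreal m" using E(3) by blast
      have "ennreal ?K * weight_on s \<Omega> ?E \<le> ennreal ?K * ennreal (N powr s * m powr (1 - s) / (1 - s))"
      proof (intro mult_left_mono weight_on_bound[OF s N \<Omega> E(1,2) m(2,1)])
        show "emeasure lborel {x \<in> ?E. infdist x (frontier \<Omega>) < t} \<le> ennreal (N * t)" if "0 < t" for t
          using E(2) by (intro order_trans[OF emeasure_mono distr[OF that]]) auto
      qed simp
      also have "\<dots> = ennreal (4 * m powr (1 - s) / (s * (1 - s)))"
        using s N by (subst ennreal_mult[symmetric]) auto
      also have "\<dots> \<le> gagliardo s 1 (indicator ?E)" by (rule perimeter_ge[OF s E(1) m(2,1)])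
      finally show ?thesis .
    qed
    have "ennreal ?K = ennreal ?K * hardy_term s 1 \<Omega> u" using one by simp
    also have "\<dots> \<le> (\<integral>\<^sup>+\<tau>. ennreal ?K * (weight_on s \<Omega> {x. \<tau> < \<bar>u x\<bar>} * indicator {0..} \<tau>) \<partial>lborel)"
    proof -
      have [measurable]: "u \<in> borel_measurable borel" by (rule test_function_borel[OF u])
      have [measurable]: "(\<lambda>\<tau>. weight_on s \<Omega> {x. \<tau> < \<bar>u x\<bar>}) \<in> borel_measurable borel"
        unfolding weight_on_def by (rule measurable_weight_layer) auto
      show ?thesis
        unfolding hardy_term_coarea[OF u \<open>\<Omega> \<in> sets borel\<close>] by (subst nn_integral_cmult) auto
    qed
    also have "\<dots> \<le> (\<integral>\<^sup>+\<tau>\<in>{0..}. gagliardo s 1 (indicator {x. \<tau> < \<bar>u x\<bar>}) \<partial>lborel)"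
      by (intro nn_integral_mono) (auto simp: lev split: split_indicator)
    also have "\<dots> \<le> gagliardo s 1 u" by (rule gagliardo_levels_le[OF u s(1)])
    finally show ?thesis .
  qed
  then show ?thesis
    unfolding hardy_const_def by (intro Inf_greatest) (auto simp: hardy_term_def)
qed

theorem hardy_const_1_punctured:
  assumes s: "0 < s" "s < 1"
  shows "hardy_const s 1 (UNIV - {0}) = ennreal (4 / (s * 2 powr s))"
proof (rule antisym)
  have \<Omega>: "open (UNIV - {0::real})" "frontier (UNIV - {0::real}) \<noteq> {}" by (auto simp: frontier_punctured)
  show "ennreal (4 / (s * 2 powr s)) \<le> hardy_const s 1 (UNIV - {0})"
  proof (rule hardy_const_1_lower[OF s \<Omega>])
    fix t :: real assume t: "0 < t"
    have "emeasure lborel {x \<in> UNIV - {0::real}. infdist x (frontier (UNIV - {0})) < t} \<le> emeasure lborel {-t<..<t}"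
      by (intro emeasure_mono) (auto simp: frontier_punctured infdist_singleton)
    then show "emeasure lborel {x \<in> UNIV - {0::real}. infdist x (frontier (UNIV - {0})) < t} \<le> ennreal (2 * t)"
      using t by simp
  qed simp
  let ?f = "indicat_real (centered 2)"
  have c2: "centered 2 = {-1<..<1}" by (simp add: centered_def)
  have "hardy_term s 1 (UNIV - {0}) ?f = (\<integral>\<^sup>+x\<in>centered 2. ennreal (1 / \<bar>x\<bar> powr s) \<partial>lborel)"
    unfolding hardy_term_indicator using s
    by (intro nn_integral_cong) (auto simp: frontier_punctured infdist_singleton split: split_indicator)
  also have "\<dots> = ennreal (2 powr s * 2 powr (1 - s) / (1 - s))"
    using s by (simp add: nn_integral_centered_kernel)
  also have "2 powr s * 2 powr (1 - s) = (2 :: real)" by (simp add: powr_add[symmetric])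
  finally have h: "hardy_term s 1 (UNIV - {0}) ?f = ennreal (2 / (1 - s))" .
  have "hardy_const s 1 (UNIV - {0}) * hardy_term s 1 (UNIV - {0}) ?f \<le> gagliardo s 1 ?f"
  proof (rule hardy_const_le[where F = "{0}" and S = "centered 2" and M = 1])
    have "frontier (centered 2) = {-1, 1}" by (auto simp: c2 frontier_def closure_greaterThanLessThan)
    then show "AE x in lborel. isCont ?f x" by (intro isCont_indicator_AE) simp
  qed (use s \<Omega> in \<open>auto simp: c2 split: split_indicator\<close>)
  also have "gagliardo s 1 ?f = ennreal (4 * 2 powr (1 - s) / (s * (1 - s)))"
    unfolding c2 using gagliardo_interval[of s 1 "-1" 1] s by simp
  finally have "hardy_const s 1 (UNIV - {0}) * ennreal (2 / (1 - s)) \<le> ennreal (4 * 2 powr (1 - s) / (s * (1 - s)))"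
    unfolding h .
  then have "hardy_const s 1 (UNIV - {0}) \<le> ennreal (4 * 2 powr (1 - s) / (s * (1 - s)) / (2 / (1 - s)))"
    by (rule le_divide_ennreal_real) (use s in auto)
  also have "4 * 2 powr (1 - s) / (s * (1 - s)) / (2 / (1 - s)) = 4 / (s * 2 powr s)"
  proof -
    have "4 * (2 / T) / (s * c) / (2 / c) = 4 / (s * T)" if "0 < T" "0 < c" for T c :: real
      using that s by (simp add: field_simps)
    from this[of "2 powr s" "1 - s"] show ?thesis using s by (simp only: powr_diff) simp
  qed
  finally show "hardy_const s 1 (UNIV - {0}) \<le> ennreal (4 / (s * 2 powr s))" .
qed

context interval_union
begin

lemma emeasure_piece: "k \<in> {1..n} \<Longrightarrow> emeasure lborel (I k) = ennreal (hi k - lo k)"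
  using I_eq[of k] lo_less_hi[of k] by simp

lemma emeasure_\<Omega>: "emeasure lborel \<Omega> = ennreal (\<Sum>k\<in>{1..n}. hi k - lo k)"
proof -
  have "emeasure lborel \<Omega> = (\<Sum>k\<in>{1..n}. emeasure lborel (I k))"
    unfolding \<Omega>_def using disj pieces by (intro sum_emeasure[symmetric]) auto
  also have "\<dots> = (\<Sum>k\<in>{1..n}. ennreal (hi k - lo k))" by (intro sum.cong emeasure_piece) auto
  also have "\<dots> = ennreal (\<Sum>k\<in>{1..n}. hi k - lo k)" using lo_less_hi by (intro sum_ennreal) (auto intro: less_imp_le)
  finally show ?thesis .
qed

lemma weight_on_pieces:
  assumes [measurable]: "E \<in> sets borel" and E\<Omega>: "E \<subseteq> \<Omega>"
  shows "weight_on s \<Omega> E = (\<Sum>k\<in>{1..n}. weight_on s \<Omega> (E \<inter> I k))"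
proof -
  have [measurable]: "k \<in> {1..n} \<Longrightarrow> I k \<in> sets borel" for k using pieces by auto
  have "weight_on s \<Omega> E = (\<integral>\<^sup>+x. (\<Sum>k\<in>{1..n}. ennreal (1 / infdist x (frontier \<Omega>) powr s) * indicator (E \<inter> I k) x) \<partial>lborel)"
    unfolding weight_on_def
  proof (rule nn_integral_cong)
    fix x
    have "indicator E x = (\<Sum>k\<in>{1..n}. indicator (E \<inter> I k) x :: ennreal)"
    proof (cases "x \<in> E")
      case True
      then obtain j where j: "j \<in> {1..n}" "x \<in> I j" using E\<Omega> unfolding \<Omega>_def by blast
      have uniq: "k = j" if "k \<in> {1..n}" "x \<in> I k" for k
        using that j disj unfolding disjoint_family_on_def by blast
      have "(\<Sum>k\<in>{1..n}. indicator (E \<inter> I k) x :: ennreal) = (\<Sum>k\<in>{1..n}. if k = j then 1 else 0)"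
      proof (intro sum.cong refl)
        fix k assume "k \<in> {1..n}"
        then show "indicator (E \<inter> I k) x = (if k = j then 1 else 0 :: ennreal)"
          using uniq[of k] j True by (cases "x \<in> I k") auto
      qed
      then show ?thesis using j True by simp
    qed simp
    then show "ennreal (1 / infdist x (frontier \<Omega>) powr s) * indicator E x = (\<Sum>k\<in>{1..n}. ennreal (1 / infdist x (frontier \<Omega>) powr s) * indicator (E \<inter> I k) x)"
      by (simp add: sum_distrib_left)
  qed
  also have "\<dots> = (\<Sum>k\<in>{1..n}. weight_on s \<Omega> (E \<inter> I k))"
    unfolding weight_on_def by (rule nn_integral_sum) measurable
  finally show ?thesis .
qed

lemma weight_on_piece:
  assumes s: "0 < s" "s < 1" and k: "k \<in> {1..n}"
  shows "weight_on s \<Omega> (I k) = ennreal (2 powr s * (hi k - lo k) powr (1 - s) / (1 - s))"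
proof -
  have "weight_on s \<Omega> (I k) = (\<integral>\<^sup>+x\<in>{lo k<..<hi k}. ennreal (1 / min (x - lo k) (hi k - x) powr s) \<partial>lborel)"
    unfolding weight_on_def using I_eq[OF k] infdist_piece[OF k]
    by (intro nn_integral_cong) (auto split: split_indicator)
  then show ?thesis using gap_weight[OF s less_imp_le[OF lo_less_hi[OF k]]] by simp
qed

text \<open>A point between the infimum and the supremum of \<open>\<Omega>\<close> has points of any interval \<open>J\<close> that agrees with
  \<open>\<Omega>\<close> almost everywhere on both sides, because nonempty open parts of \<open>\<Omega>\<close> are not null. So it
  belongs to \<open>J\<close>, and the gaps of \<open>\<Omega>\<close> are null.\<close>

lemma fills_hull:
  assumes "equivalent_to_interval \<Omega>"
  shows "\<Omega> \<subseteq> {Inf \<Omega><..<Sup \<Omega>}" "{Inf \<Omega><..<Sup \<Omega>} - \<Omega> \<in> null_sets lborel" "Inf \<Omega> < Sup \<Omega>"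
proof -
  obtain J where J: "is_interval J" "sym_diff \<Omega> J \<in> null_sets lebesgue"
    using assms unfolding equivalent_to_interval_def by blast
  have bd: "bdd_above \<Omega>" "bdd_below \<Omega>" using bounded_\<Omega> by (auto simp: bounded_imp_bdd_above bounded_imp_bdd_below)
  obtain z where z: "z \<in> \<Omega>" using pieces[of 1] n unfolding \<Omega>_def by force
  show sub: "\<Omega> \<subseteq> {Inf \<Omega><..<Sup \<Omega>}"
  proof
    fix x assume x: "x \<in> \<Omega>"
    then obtain e where e: "0 < e" "ball x e \<subseteq> \<Omega>" using open_\<Omega> openE by blast
    have "x - e / 2 \<in> \<Omega>" "x + e / 2 \<in> \<Omega>" using e by (auto simp: dist_real_def intro!: subsetD[OF e(2)])
    then show "x \<in> {Inf \<Omega><..<Sup \<Omega>}"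
      using cInf_lower[OF _ bd(2), of "x - e/2"] cSup_upper[OF _ bd(1), of "x + e/2"] e(1) by auto
  qed
  then show "Inf \<Omega> < Sup \<Omega>" using z by auto
  \<comment> \<open>an open part of \<open>\<Omega>\<close> that misses \<open>J\<close> would be
    null\<close>
  have meets: "\<exists>y\<in>U. y \<in> J" if U: "open U" "U \<noteq> {}" "U \<subseteq> \<Omega>" for U
  proof (rule ccontr)
    assume "\<not> ?thesis"
    then have "U \<subseteq> sym_diff \<Omega> J" using U by auto
    then have "U \<in> null_sets lebesgue" using J(2) by (rule null_sets_completion_subset)
    moreover have "U \<in> sets lborel" using U by simp
    ultimately have "U \<in> null_sets lborel" by (simp add: null_sets_completion_iff)
    then show False using U open_not_negligible[of U]
      by (simp add: negligible_iff_null_sets null_sets_completion_iff)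
  qed
  have "{Inf \<Omega><..<Sup \<Omega>} - \<Omega> \<subseteq> sym_diff \<Omega> J"
  proof
    fix x assume x: "x \<in> {Inf \<Omega><..<Sup \<Omega>} - \<Omega>"
    obtain y1 where "y1 \<in> \<Omega>" "y1 < x" using x cInf_less_iff[of \<Omega> x] bd z by auto
    then have "\<Omega> \<inter> {..<x} \<noteq> {}" by auto
    then obtain y where y: "y \<in> \<Omega> \<inter> {..<x}" "y \<in> J"
      using meets[OF open_Int[OF open_\<Omega> open_lessThan]] by blast
    obtain w1 where "w1 \<in> \<Omega>" "x < w1" using x less_cSup_iff[of \<Omega> x] bd z by auto
    then have "\<Omega> \<inter> {x<..} \<noteq> {}" by auto
    then obtain w where w: "w \<in> \<Omega> \<inter> {x<..}" "w \<in> J"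
      using meets[OF open_Int[OF open_\<Omega> open_greaterThan]] by blast
    have "x \<in> J" using mem_is_interval_1_I[OF J(1) y(2) w(2), of x] y(1) w(1) by auto
    then show "x \<in> sym_diff \<Omega> J" using x by auto
  qed
  then have "{Inf \<Omega><..<Sup \<Omega>} - \<Omega> \<in> null_sets lebesgue" using J(2) by (rule null_sets_completion_subset)
  then show "{Inf \<Omega><..<Sup \<Omega>} - \<Omega> \<in> null_sets lborel" by (simp add: null_sets_completion_iff)
qed

text \<open>The competitor is the indicator function of \<open>\<Omega>\<close>, whose seminorm is that of the full interval.\<close>

lemma hardy_const_1_equal_lengths:
  assumes s: "0 < s" "s < 1" and J: "equivalent_to_interval \<Omega>"
    and len: "\<And>k. k \<in> {1..n} \<Longrightarrow> hi k - lo k = d"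
  shows "hardy_const s 1 \<Omega> \<le> ennreal (4 / (s * (2 * real n) powr s))"
proof -
  have d: "0 < d" using len[of 1] lo_less_hi[of 1] n by auto
  note hull = fills_hull[OF J]
  have nd: "Sup \<Omega> - Inf \<Omega> = real n * d"
  proof -
    have "emeasure lborel {Inf \<Omega><..<Sup \<Omega>} = emeasure lborel (\<Omega> \<union> ({Inf \<Omega><..<Sup \<Omega>} - \<Omega>))"
      using hull(1) by (intro arg_cong[where f="emeasure lborel"]) auto
    also have "\<dots> = emeasure lborel \<Omega>" using hull(2) by (intro emeasure_Un_null_set) auto
    also have "\<dots> = ennreal (real n * d)" unfolding emeasure_\<Omega> using len by simp
    finally show ?thesis using hull(3) d by simp
  qed
  let ?f = "indicat_real \<Omega>"
  have "hardy_term s 1 \<Omega> ?f = weight_on s \<Omega> \<Omega>" by (simp add: hardy_term_indicator weight_on_def)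
  also have "\<dots> = (\<Sum>k\<in>{1..n}. weight_on s \<Omega> (\<Omega> \<inter> I k))" by (rule weight_on_pieces) auto
  also have "\<dots> = (\<Sum>k\<in>{1..n}. ennreal (2 powr s * d powr (1 - s) / (1 - s)))"
  proof (rule sum.cong[OF refl])
    fix k assume k: "k \<in> {1..n}"
    then have "\<Omega> \<inter> I k = I k" unfolding \<Omega>_def by blast
    then show "weight_on s \<Omega> (\<Omega> \<inter> I k) = ennreal (2 powr s * d powr (1 - s) / (1 - s))"
      using weight_on_piece[OF s k] len[OF k] by simp
  qed
  also have "\<dots> = ennreal (real n * (2 powr s * d powr (1 - s) / (1 - s)))"
    using s by (simp add: ennreal_of_nat_eq_real_of_nat ennreal_mult[symmetric])
  finally have h: "hardy_term s 1 \<Omega> ?f = ennreal (real n * (2 powr s * d powr (1 - s) / (1 - s)))" .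
  have "hardy_const s 1 \<Omega> * hardy_term s 1 \<Omega> ?f \<le> gagliardo s 1 ?f"
  proof (rule hardy_const_le[where F = "frontier \<Omega>" and S = \<Omega> and M = 1])
    show "closure \<Omega> \<subseteq> \<Omega> \<union> frontier \<Omega>" using interior_subset[of \<Omega>] by (auto simp: frontier_def)
    show "AE x in lborel. isCont ?f x" by (rule isCont_indicator_AE[OF finite_frontier])
  qed (use s open_\<Omega> frontier_nonempty finite_frontier bounded_\<Omega> in \<open>auto split: split_indicator\<close>)
  also have "gagliardo s 1 ?f = gagliardo s 1 (indicator {Inf \<Omega><..<Sup \<Omega>})"
  proof (rule gagliardo_cong_AE)
    show "AE x in lborel. ?f x = indicator {Inf \<Omega><..<Sup \<Omega>} x"
      using AE_not_in[OF hull(2)] by eventually_elim (use hull(1) in \<open>auto split: split_indicator\<close>)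
  qed
  also have "\<dots> = ennreal (4 * (real n * d) powr (1 - s) / (s * (1 - s)))"
    using gagliardo_interval[of s 1 "Inf \<Omega>" "Sup \<Omega>"] hull(3) s nd by simp
  finally have "hardy_const s 1 \<Omega> * ennreal (real n * (2 powr s * d powr (1 - s) / (1 - s))) \<le> ennreal (4 * (real n * d) powr (1 - s) / (s * (1 - s)))"
    unfolding h .
  then have "hardy_const s 1 \<Omega> \<le> ennreal (4 * (real n * d) powr (1 - s) / (s * (1 - s)) / (real n * (2 powr s * d powr (1 - s) / (1 - s))))"
    by (rule le_divide_ennreal_real) (use s d n in auto)
  also have "4 * (real n * d) powr (1 - s) / (s * (1 - s)) / (real n * (2 powr s * d powr (1 - s) / (1 - s))) = 4 / (s * (2 * real n) powr s)"
  proof -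
    have 1: "(real n * d) powr (1 - s) = real n / real n powr s * d powr (1 - s)" using n d by (simp add: powr_mult powr_diff)
    have "4 * (N / Ns * D) / (s * c) / (N * (T * D / c)) = 4 / (s * (T * Ns))" if "0 < N" "0 < D" "0 < c" "0 < T" "0 < Ns" for N Ns D c T :: real
      using that s by (simp add: field_simps)
    from this[of "real n" "d powr (1 - s)" "1 - s" "2 powr s" "real n powr s"]
    show ?thesis unfolding 1 using n d s by (simp add: powr_mult)
  qed
  finally show ?thesis .
qed

end

section \<open>Equality forces equal lengths\<close>

lemma powr_below_tangent:
  fixes v \<tau> s :: real
  assumes s: "0 < s" "s < 1" and \<tau>: "0 < \<tau>" and v: "0 \<le> v" "v \<noteq> \<tau>"
  shows "v powr (1 - s) < \<tau> powr (1 - s) + (1 - s) * \<tau> powr - s * (v - \<tau>)"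
proof (cases "v = 0")
  case True
  have "\<tau> powr - s * \<tau> = \<tau> powr (1 - s)" using powr_mult_base[of \<tau> "- s"] \<tau> by (simp add: mult.commute)
  then have "\<tau> powr (1 - s) + (1 - s) * \<tau> powr - s * (v - \<tau>) = s * \<tau> powr (1 - s)"
    using True by (simp add: algebra_simps)
  then show ?thesis using True s \<tau> by simp
next
  case False
  then have v0: "0 < v" using v by simp
  have D: "((\<lambda>w. w powr (1 - s)) has_real_derivative (1 - s) * w powr - s) (at w)" if "0 < w" for w
    using has_real_derivative_powr[OF that, of "1 - s"] by simp
  show ?thesis
  proof (cases "v < \<tau>")
    case True
    obtain \<xi> where \<xi>: "v < \<xi>" "\<xi> < \<tau>" "\<tau> powr (1 - s) - v powr (1 - s) = (\<tau> - v) * ((1 - s) * \<xi> powr - s)"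
      using MVT2[OF True, of "\<lambda>w. w powr (1 - s)" "\<lambda>w. (1 - s) * w powr - s"] D v0 by auto
    have "\<tau> powr - s < \<xi> powr - s" using \<xi> v0 s by (intro powr_less_mono2_neg) auto
    then have "(\<tau> - v) * ((1 - s) * \<tau> powr - s) < (\<tau> - v) * ((1 - s) * \<xi> powr - s)"
      using True s by (intro mult_strict_left_mono) auto
    then show ?thesis using \<xi>(3) by (simp add: algebra_simps)
  next
    case False
    then have lt: "\<tau> < v" using v by simp
    obtain \<xi> where \<xi>: "\<tau> < \<xi>" "\<xi> < v" "v powr (1 - s) - \<tau> powr (1 - s) = (v - \<tau>) * ((1 - s) * \<xi> powr - s)"
      using MVT2[OF lt, of "\<lambda>w. w powr (1 - s)" "\<lambda>w. (1 - s) * w powr - s"] D \<tau> by auto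
    have "\<xi> powr - s < \<tau> powr - s" using \<xi> \<tau> s by (intro powr_less_mono2_neg) auto
    then have "(v - \<tau>) * ((1 - s) * \<xi> powr - s) < (v - \<tau>) * ((1 - s) * \<tau> powr - s)"
      using lt s by (intro mult_strict_left_mono) auto
    then show ?thesis using \<xi>(3) by (simp add: algebra_simps)
  qed
qed

text \<open>The distance to the ends of a strictly larger interval is strictly larger on one half of
  \<open>(\<alpha>, \<beta>)\<close>.\<close>

lemma gap_weight_strict:
  assumes s: "0 < s" "s < 1" and ab: "a \<le> \<alpha>" "\<alpha> < \<beta>" "\<beta> \<le> b" and ne: "a < \<alpha> \<or> \<beta> < b"
  shows "(\<integral>\<^sup>+x\<in>{\<alpha><..<\<beta>}. ennreal (1 / min (x - a) (b - x) powr s) \<partial>lborel) < ennreal (2 powr s * (\<beta> - \<alpha>) powr (1 - s) / (1 - s))"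
proof -
  let ?f = "\<lambda>x. ennreal (1 / min (x - a) (b - x) powr s) * indicator {\<alpha><..<\<beta>} x"
  let ?g = "\<lambda>x. ennreal (1 / min (x - \<alpha>) (\<beta> - x) powr s) * indicator {\<alpha><..<\<beta>} x"
  define c where "c = (\<alpha> + \<beta>) / 2"
  have g: "(\<integral>\<^sup>+x. ?g x \<partial>lborel) = ennreal (2 powr s * (\<beta> - \<alpha>) powr (1 - s) / (1 - s))"
    by (rule gap_weight[OF s less_imp_le[OF ab(2)]])
  have le: "?f x \<le> ?g x" for x
  proof (cases "x \<in> {\<alpha><..<\<beta>}")
    case True
    then have "1 / min (x - a) (b - x) powr s \<le> 1 / min (x - \<alpha>) (\<beta> - x) powr s"
      using ab s by (intro divide_left_mono powr_mono2 mult_pos_pos) auto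
    then show ?thesis using True by (simp add: ennreal_leI)
  qed simp
  have strict: "?f x < ?g x" if x: "x \<in> {\<alpha><..<\<beta>}" and lt: "min (x - \<alpha>) (\<beta> - x) < min (x - a) (b - x)" for x
  proof -
    have "min (x - \<alpha>) (\<beta> - x) powr s < min (x - a) (b - x) powr s"
      using x lt s by (intro powr_less_mono2) auto
    moreover have "0 < min (x - \<alpha>) (\<beta> - x) powr s" using x by auto
    ultimately have "1 / min (x - a) (b - x) powr s < 1 / min (x - \<alpha>) (\<beta> - x) powr s"
      by (intro divide_strict_left_mono mult_pos_pos) auto
    then show ?thesis using x by (simp add: ennreal_less_iff)
  qed
  \<comment> \<open>the half of \<open>(\<alpha>, \<beta>)\<close> next to an end that is not
    shared\<close>
  obtain u v where uv: "u < v" "\<And>x. x \<in> {u<..<v} \<Longrightarrow> x \<in> {\<alpha><..<\<beta>} \<and> min (x - \<alpha>) (\<beta> - x) < min (x - a) (b - x)"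
  proof (cases "a < \<alpha>")
    case True
    show ?thesis by (rule that[of \<alpha> c]) (use True ab in \<open>auto simp: c_def min_def field_simps\<close>)
  next
    case False
    show ?thesis by (rule that[of c \<beta>]) (use False ne ab in \<open>auto simp: c_def min_def field_simps\<close>)
  qed
  have "(\<integral>\<^sup>+x. ?f x \<partial>lborel) < (\<integral>\<^sup>+x. ?g x \<partial>lborel)"
  proof (rule nn_integral_less)
    have "(\<integral>\<^sup>+x. ?f x \<partial>lborel) \<le> (\<integral>\<^sup>+x. ?g x \<partial>lborel)" by (intro nn_integral_mono le)
    then show "(\<integral>\<^sup>+x. ?f x \<partial>lborel) \<noteq> \<infinity>" unfolding g by (auto simp: top_unique)
    show "AE x in lborel. ?f x \<le> ?g x" using le by simp
    show "\<not> (AE x in lborel. ?g x \<le> ?f x)"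
    proof
      assume "AE x in lborel. ?g x \<le> ?f x"
      then have "AE x in lborel. x \<notin> {u<..<v}"
        by eventually_elim (use strict uv(2) in \<open>force simp: not_le[symmetric]\<close>)
      then have "{u<..<v} \<in> null_sets lborel" by (subst AE_iff_null_sets) auto
      then have "emeasure lborel {u<..<v} = 0" by (rule null_setsD1)
      then show False using uv(1) by simp
    qed
  qed auto
  then show ?thesis unfolding g .
qed

context interval_union
begin

text \<open>The largest weight that the bathtub estimate permits for a set of measure \<open>m\<close> in \<open>\<Omega>\<close>, and the ratio
  of the perimeter of an interval of length \<open>m\<close> to it. The ratio does not depend on \<open>m\<close>.\<close>

definition weight_bound :: "real \<Rightarrow> real \<Rightarrow> real" where
  "weight_bound s m = (2 * real n) powr s * m powr (1 - s) / (1 - s)"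

definition sharp_ratio :: "real \<Rightarrow> real" where
  "sharp_ratio s = 4 / (s * (2 * real n) powr s)"

lemma weight_bound_nonneg: "s < 1 \<Longrightarrow> 0 \<le> weight_bound s m"
  by (simp add: weight_bound_def)

lemma weight_bound_mono: "s < 1 \<Longrightarrow> 0 \<le> m \<Longrightarrow> m \<le> m' \<Longrightarrow> weight_bound s m \<le> weight_bound s m'"
  unfolding weight_bound_def by (intro divide_right_mono mult_left_mono powr_mono2) auto

lemma weight_bound_scale: "0 \<le> c \<Longrightarrow> 0 \<le> m \<Longrightarrow> weight_bound s (c * m) = c powr (1 - s) * weight_bound s m"
  unfolding weight_bound_def by (simp add: powr_mult)

lemma sharp_ratio_pos: "0 < s \<Longrightarrow> 0 < sharp_ratio s"
  using n by (simp add: sharp_ratio_def)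

lemma sharp_ratio_mult: "0 < s \<Longrightarrow> s < 1 \<Longrightarrow> sharp_ratio s * weight_bound s m = 4 * m powr (1 - s) / (s * (1 - s))"
  using n by (simp add: sharp_ratio_def weight_bound_def)

lemma weight_le_bound:
  assumes s: "0 < s" "s < 1" and E: "E \<in> sets borel" "E \<subseteq> \<Omega>" and mE: "emeasure lborel E \<le> ennreal m" and m: "0 \<le> m"
  shows "weight_on s \<Omega> E \<le> ennreal (weight_bound s m)"
proof -
  obtain m' where m': "emeasure lborel E = ennreal m'" "0 \<le> m'"
    using mE by (cases "emeasure lborel E") (auto simp: top_unique)
  have "weight_on s \<Omega> E \<le> ennreal (weight_bound s m')"
    unfolding weight_bound_def
  proof (rule weight_on_bound[OF s _ open_\<Omega> frontier_nonempty E m'])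
    show "emeasure lborel {x \<in> E. infdist x (frontier \<Omega>) < t} \<le> ennreal (2 * real n * t)" if "0 < t" for t
      using E(2) by (intro order_trans[OF emeasure_mono near_frontier[OF that]]) auto
  qed (use n in auto)
  also have "\<dots> \<le> ennreal (weight_bound s m)"
    using mE m m' s by (intro ennreal_leI weight_bound_mono) auto
  finally show ?thesis .
qed

lemma near_optimal_set:
  assumes s: "0 < s" "s < 1" and le: "hardy_const s 1 \<Omega> \<le> ennreal (sharp_ratio s)" and \<epsilon>: "0 < \<epsilon>"
  obtains E m where "E \<in> sets borel" "E \<subseteq> \<Omega>" "emeasure lborel E = ennreal m" "0 < m"
    "gagliardo s 1 (indicator E) \<le> ennreal (sharp_ratio s + \<epsilon>) * weight_on s \<Omega> E"
proof -
  have "hardy_const s 1 \<Omega> < ennreal (sharp_ratio s + \<epsilon>)"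
    using le \<epsilon> sharp_ratio_pos[OF s(1)] by (intro le_less_trans[OF le]) (simp add: ennreal_less_iff)
  then obtain u where u: "u \<in> test_functions \<Omega>" "hardy_term s 1 \<Omega> u = 1" "gagliardo s 1 u < ennreal (sharp_ratio s + \<epsilon>)"
    unfolding hardy_const_def Inf_less_iff by (auto simp: hardy_term_def)
  have "\<exists>\<tau>\<ge>0. \<not> ennreal (sharp_ratio s + \<epsilon>) * weight_on s \<Omega> {x. \<tau> < \<bar>u x\<bar>} \<le> gagliardo s 1 (indicator {x. \<tau> < \<bar>u x\<bar>})"
  proof (rule ccontr)
    assume "\<not> ?thesis"
    then have lev: "ennreal (sharp_ratio s + \<epsilon>) * weight_on s \<Omega> {x. \<tau> < \<bar>u x\<bar>} \<le> gagliardo s 1 (indicator {x. \<tau> < \<bar>u x\<bar>})" if "0 \<le> \<tau>" for \<tau>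
      using that by blast
    have [measurable]: "u \<in> borel_measurable borel" by (rule test_function_borel[OF u(1)])
    have [measurable]: "(\<lambda>\<tau>. weight_on s \<Omega> {x. \<tau> < \<bar>u x\<bar>}) \<in> borel_measurable borel"
      unfolding weight_on_def by (rule measurable_weight_layer) auto
    have "ennreal (sharp_ratio s + \<epsilon>) = ennreal (sharp_ratio s + \<epsilon>) * hardy_term s 1 \<Omega> u" using u(2) by simp
    also have "\<dots> = (\<integral>\<^sup>+\<tau>. ennreal (sharp_ratio s + \<epsilon>) * (weight_on s \<Omega> {x. \<tau> < \<bar>u x\<bar>} * indicator {0..} \<tau>) \<partial>lborel)"
      unfolding hardy_term_coarea[OF u(1) \<Omega>_borel] by (subst nn_integral_cmult) auto
    also have "\<dots> \<le> (\<integral>\<^sup>+\<tau>\<in>{0..}. gagliardo s 1 (indicator {x. \<tau> < \<bar>u x\<bar>}) \<partial>lborel)"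
      by (intro nn_integral_mono) (auto simp: lev split: split_indicator)
    also have "\<dots> \<le> gagliardo s 1 u" by (rule gagliardo_levels_le[OF u(1) s(1)])
    finally show False using u(3) by simp
  qed
  then obtain \<tau> where \<tau>: "0 \<le> \<tau>" "gagliardo s 1 (indicator {x. \<tau> < \<bar>u x\<bar>}) < ennreal (sharp_ratio s + \<epsilon>) * weight_on s \<Omega> {x. \<tau> < \<bar>u x\<bar>}"
    by (auto simp: not_le)
  note E = level_set_test[OF u(1) \<tau>(1)]
  obtain m where m: "0 \<le> m" "emeasure lborel {x. \<tau> < \<bar>u x\<bar>} = ennreal m" using E(3) by blast
  have "m \<noteq> 0"
  proof
    assume "m = 0"
    then have "weight_on s \<Omega> {x. \<tau> < \<bar>u x\<bar>} \<le> ennreal (weight_bound s 0)"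
      using m by (intro weight_le_bound[OF s E(1,2)]) auto
    then show False using \<tau>(2) by (simp add: weight_bound_def)
  qed
  then show ?thesis using E(1,2) m \<tau>(2) by (intro that[of "{x. \<tau> < \<bar>u x\<bar>}" m]) auto
qed

text \<open>Let \<open>x\<close> and \<open>y\<close> cut off the mass \<open>\<kappa> * m\<close> of \<open>E\<close> on either side. If they were further apart than
  \<open>(1 + \<eta>) * m\<close>, the pairs formed by the two parts cut off would contribute to the deficit at all
  radii between \<open>m\<close> and \<open>(1 + \<eta>) * m\<close>. That contribution scales like \<open>m powr (1 - s)\<close>, as does the
  slack left by near-optimality, so \<open>m\<close> cancels in the smallness condition on \<open>\<epsilon>\<close>.\<close>

lemma almost_interval:
  assumes s: "0 < s" "s < 1" and E[measurable]: "E \<in> sets borel" and E\<Omega>: "E \<subseteq> \<Omega>"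
    and mE: "emeasure lborel E = ennreal m" and m: "0 < m" and \<epsilon>: "0 < \<epsilon>"
    and opt: "gagliardo s 1 (indicator E) \<le> ennreal (sharp_ratio s + \<epsilon>) * weight_on s \<Omega> E"
    and \<kappa>: "0 < \<kappa>" "\<kappa> < 1 / 2" and \<eta>: "0 < \<eta>"
    and small: "\<epsilon> * (2 * real n) powr s / (1 - s) < 2 * (1 + s) * (1 + \<eta>) powr (- 2 - s) * \<kappa>\<^sup>2 * \<eta>"
    and B: "\<Omega> \<subseteq> {- B<..<B}"
  obtains x y where "x < y" "- B \<le> x" "y \<le> B" "y - x \<le> (1 + \<eta>) * m" "emeasure lborel (E - {x<..<y}) \<le> ennreal (2 * \<kappa> * m)"
proof -
  have m0: "0 \<le> m" using m by simp
  note MB = mass_below_mono[OF E mE m0] mass_below_above[OF E mE m0]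
  have fin: "emeasure lborel S = ennreal (measure lborel S)" if "S \<subseteq> E" "S \<in> sets borel" for S
    using emeasure_mono[OF that(1), of lborel] mE by (intro emeasure_eq_ennreal_measure) (auto simp: top_unique)
  obtain x where x: "mass_below E x = \<kappa> * m" using mass_below_attains[OF E mE, of "\<kappa> * m"] \<kappa> m by auto
  obtain y where y: "mass_below E y = (1 - \<kappa>) * m" using mass_below_attains[OF E mE, of "(1 - \<kappa>) * m"] \<kappa> m by auto
  have "mass_below E x < mass_below E y" using \<kappa> m by (simp add: x y)
  then have xy: "x < y" using MB(1)[of y x] by (cases "x < y") auto
  have lo: "emeasure lborel (E \<inter> {..x}) = ennreal (\<kappa> * m)" using fin[of "E \<inter> {..x}"] x by (simp add: mass_below_def)
  have hi: "emeasure lborel (E \<inter> {y<..}) = ennreal (\<kappa> * m)" using fin[of "E \<inter> {y<..}"] MB(2)[of y] y by (simp add: algebra_simps)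
  have "- B \<le> x"
  proof (rule ccontr)
    assume "\<not> - B \<le> x"
    then have "E \<inter> {..x} = {}" using E\<Omega> B by force
    then show False using lo \<kappa> m by simp
  qed
  moreover have "y \<le> B"
  proof (rule ccontr)
    assume "\<not> y \<le> B"
    then have "E \<inter> {y<..} = {}" using E\<Omega> B by force
    then show False using hi \<kappa> m by simp
  qed
  moreover have "emeasure lborel (E - {x<..<y}) \<le> ennreal (2 * \<kappa> * m)"
  proof -
    have "emeasure lborel (E - {x<..<y}) \<le> emeasure lborel ((E \<inter> {..x}) \<union> ((E \<inter> {y<..}) \<union> {y}))"
      by (intro emeasure_mono) auto
    also have "\<dots> \<le> emeasure lborel (E \<inter> {..x}) + emeasure lborel ((E \<inter> {y<..}) \<union> {y})"
      by (rule emeasure_subadditive) auto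
    also have "emeasure lborel ((E \<inter> {y<..}) \<union> {y}) \<le> emeasure lborel (E \<inter> {y<..}) + emeasure lborel {y}"
      by (rule emeasure_subadditive) auto
    finally have "emeasure lborel (E - {x<..<y}) \<le> ennreal (\<kappa> * m) + ennreal (\<kappa> * m)"
      using lo hi by (simp add: add_left_mono)
    also have "\<dots> = ennreal (2 * \<kappa> * m)" using \<kappa> m by (subst ennreal_plus[symmetric]) auto
    finally show ?thesis .
  qed
  moreover have "y - x \<le> (1 + \<eta>) * m"
  proof (rule ccontr)
    assume far: "\<not> y - x \<le> (1 + \<eta>) * m"
    let ?k = "\<lambda>r. ennreal ((1 + s) * r powr (- 2 - s))"
    let ?c = "(1 + s) * ((1 + \<eta>) * m) powr (- 2 - s) * (\<kappa> * m)\<^sup>2"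
    have apart: "ennreal ((\<kappa> * m)\<^sup>2) \<le> pairs_apart r E E" if r: "r \<le> (1 + \<eta>) * m" for r
    proof -
      have "ennreal ((\<kappa> * m)\<^sup>2) = (\<integral>\<^sup>+u. ennreal (\<kappa> * m) * indicator (E \<inter> {..x}) u \<partial>lborel)"
        using \<kappa> m by (simp add: nn_integral_cmult lo power2_eq_square ennreal_mult)
      also have "\<dots> \<le> (\<integral>\<^sup>+u\<in>E. emeasure lborel (E - {u - r<..<u + r}) \<partial>lborel)"
      proof (intro nn_integral_mono)
        fix u
        have "emeasure lborel (E \<inter> {y<..}) \<le> emeasure lborel (E - {u - r<..<u + r})" if "u \<le> x"
          using that far r by (intro emeasure_mono) auto
        then show "ennreal (\<kappa> * m) * indicator (E \<inter> {..x}) u \<le> emeasure lborel (E - {u - r<..<u + r}) * indicator E u"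
          using hi by (auto split: split_indicator)
      qed
      also have "\<dots> = pairs_apart r E E" by (rule pairs_apart_eq_emeasure[symmetric]) auto
      finally show ?thesis .
    qed
    have "ennreal (2 * (?c * (\<eta> * m))) = 2 * (\<integral>\<^sup>+r. ennreal ?c * indicator {m<..(1 + \<eta>) * m} r \<partial>lborel)"
    proof -
      have "(1 + \<eta>) * m - m = \<eta> * m" "m \<le> (1 + \<eta>) * m" using \<eta> m by (auto simp: algebra_simps)
      then have "(\<integral>\<^sup>+r. ennreal ?c * indicator {m<..(1 + \<eta>) * m} r \<partial>lborel) = ennreal ?c * ennreal (\<eta> * m)"
        by (simp add: nn_integral_cmult)
      moreover have "ennreal (2 * (?c * (\<eta> * m))) = ennreal 2 * (ennreal ?c * ennreal (\<eta> * m))"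
      proof -
        have "ennreal (2 * (a * b)) = ennreal 2 * (ennreal a * ennreal b)" if "0 \<le> a" "0 \<le> b" for a b
          using that by (simp only: ennreal_mult mult_nonneg_nonneg zero_le_numeral)
        moreover have "0 \<le> ?c" "0 \<le> \<eta> * m" using s \<eta> m by simp_all
        ultimately show ?thesis by blast
      qed
      ultimately show ?thesis by simp
    qed
    also have "\<dots> \<le> 2 * (\<integral>\<^sup>+r\<in>{m<..}. ?k r * pairs_apart r E E \<partial>lborel)"
    proof (intro mult_left_mono nn_integral_mono)
      fix r :: real
      show "ennreal ?c * indicator {m<..(1 + \<eta>) * m} r \<le> ?k r * pairs_apart r E E * indicator {m<..} r"
      proof (cases "m < r \<and> r \<le> (1 + \<eta>) * m")
        case True
        have "((1 + \<eta>) * m) powr (- 2 - s) \<le> r powr (- 2 - s)"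
          using True m s by (intro powr_mono2') auto
        then have "ennreal ?c \<le> ennreal ((1 + s) * r powr (- 2 - s) * (\<kappa> * m)\<^sup>2)"
          using s by (intro ennreal_leI mult_right_mono mult_left_mono) auto
        also have "\<dots> = ?k r * ennreal ((\<kappa> * m)\<^sup>2)" using s by (intro ennreal_mult) auto
        also have "\<dots> \<le> ?k r * pairs_apart r E E" using True by (intro mult_left_mono apart) auto
        finally show ?thesis using True by simp
      qed auto
    qed simp
    finally have "ennreal (4 * m powr (1 - s) / (s * (1 - s))) + ennreal (2 * (?c * (\<eta> * m))) \<le> gagliardo s 1 (indicator E)"
      using perimeter_deficit[OF E mE m0 s] by (meson add_left_mono order_trans)
    also have "\<dots> \<le> ennreal (sharp_ratio s + \<epsilon>) * ennreal (weight_bound s m)"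
      using mE m0 by (intro order_trans[OF opt] mult_left_mono weight_le_bound[OF s E E\<Omega>]) auto
    also have "\<dots> = ennreal (sharp_ratio s * weight_bound s m + \<epsilon> * weight_bound s m)"
      using sharp_ratio_pos[OF s(1)] weight_bound_nonneg[OF s(2), of m] \<epsilon> by (subst ennreal_mult[symmetric]) (auto simp: distrib_right)
    finally have "ennreal (4 * m powr (1 - s) / (s * (1 - s)) + 2 * (?c * (\<eta> * m))) \<le> ennreal (4 * m powr (1 - s) / (s * (1 - s)) + \<epsilon> * weight_bound s m)"
      using s \<eta> m by (simp add: sharp_ratio_mult[OF s] ennreal_plus)
    then have "2 * (?c * (\<eta> * m)) \<le> \<epsilon> * weight_bound s m"
      using s m \<epsilon> weight_bound_nonneg[OF s(2), of m] by (subst (asm) ennreal_le_iff) auto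
    also have "\<epsilon> * weight_bound s m = (\<epsilon> * (2 * real n) powr s / (1 - s)) * m powr (1 - s)" by (simp add: weight_bound_def)
    also have "\<dots> < (2 * (1 + s) * (1 + \<eta>) powr (- 2 - s) * \<kappa>\<^sup>2 * \<eta>) * m powr (1 - s)"
      using small m by (intro mult_strict_right_mono) auto
    also have "\<dots> = 2 * (?c * (\<eta> * m))"
    proof -
      have "m powr (1 - s) = m powr (- 2 - s + 2 + 1)" by simp
      also have "\<dots> = m powr (- 2 - s) * m\<^sup>2 * m" using m by (simp only: powr_add powr_one powr_numeral)
      finally have e: "m powr (1 - s) = m powr (- 2 - s) * m\<^sup>2 * m" .
      show ?thesis unfolding e using \<eta> m by (simp only: powr_mult) (simp add: power_mult_distrib mult_ac)
    qed
    finally show False by simp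
  qed
  ultimately show ?thesis using xy by (intro that) auto
qed


text \<open>Replacing a nearly optimal set by the interval that almost contains it loses little weight, since
  even the part outside obeys the bathtub estimate, and increases the length only slightly.\<close>

lemma near_optimal_interval:
  assumes s: "0 < s" "s < 1" and le: "hardy_const s 1 \<Omega> \<le> ennreal (sharp_ratio s)"
    and B: "\<Omega> \<subseteq> {- B<..<B}" and \<theta>: "0 < \<theta>" "\<theta> < 1"
  obtains x y where "x < y" "- B \<le> x" "y \<le> B" "ennreal (\<theta> * weight_bound s (y - x)) \<le> weight_on s \<Omega> (\<Omega> \<inter> {x<..<y})"
proof -
  have "((\<lambda>t. (1 - t - (2 * t) powr (1 - s)) / (1 + t) powr (1 - s)) \<longlongrightarrow> (1 - 0 - (2 * 0) powr (1 - s)) / (1 + 0) powr (1 - s)) (at_right 0)"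
    using s by (intro tendsto_divide tendsto_diff tendsto_powr2 tendsto_mult tendsto_add tendsto_const tendsto_ident_at)
      (auto simp: eventually_at_filter)
  then have lim: "((\<lambda>t. (1 - t - (2 * t) powr (1 - s)) / (1 + t) powr (1 - s)) \<longlongrightarrow> 1) (at_right 0)" by simp
  have "eventually (\<lambda>t. \<theta> < (1 - t - (2 * t) powr (1 - s)) / (1 + t) powr (1 - s)) (at_right 0)"
    by (rule order_tendstoD(1)[OF lim \<theta>(2)])
  moreover have "eventually (\<lambda>t. t \<in> {0<..<1/2}) (at_right (0::real))"
    by (rule eventually_at_right_real) simp
  ultimately have "eventually (\<lambda>t. \<theta> < (1 - t - (2 * t) powr (1 - s)) / (1 + t) powr (1 - s) \<and> t \<in> {0<..<1/2}) (at_right 0)"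
    by (rule eventually_conj)
  then obtain t where t: "0 < t" "t < 1 / 2" "\<theta> < (1 - t - (2 * t) powr (1 - s)) / (1 + t) powr (1 - s)"
    using eventually_happens[of _ "at_right (0::real)"] by (auto simp: trivial_limit_at_right_real)
  define R where "R = 2 * (1 + s) * (1 + t) powr (- 2 - s) * t\<^sup>2 * t"
  define D where "D = (2 * real n) powr s / (1 - s)"
  have R: "0 < R" using s t by (simp add: R_def)
  have D: "0 < D" using s n by (simp add: D_def)
  \<comment> \<open>the first bound makes the near-optimal ratio at most \<open>1 + t\<close>
    times the sharp one, the second is the smallness needed for \<open>\<kappa> = \<eta> =
    t\<close>\<close>
  define \<epsilon> where "\<epsilon> = min (sharp_ratio s * t) (R / (2 * D))"
  have \<epsilon>: "0 < \<epsilon>" using sharp_ratio_pos[OF s(1)] t R D by (simp add: \<epsilon>_def)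
  have small: "\<epsilon> * (2 * real n) powr s / (1 - s) < 2 * (1 + s) * (1 + t) powr (- 2 - s) * t\<^sup>2 * t"
  proof -
    have "\<epsilon> * D \<le> R / (2 * D) * D" using D by (intro mult_right_mono) (auto simp: \<epsilon>_def)
    also have "\<dots> < R" using D R by simp
    finally show ?thesis by (simp add: D_def R_def)
  qed
  obtain E m where E: "E \<in> sets borel" "E \<subseteq> \<Omega>" "emeasure lborel E = ennreal m" "0 < m"
    "gagliardo s 1 (indicator E) \<le> ennreal (sharp_ratio s + \<epsilon>) * weight_on s \<Omega> E"
    using near_optimal_set[OF s le \<epsilon>] by blast
  obtain x y where xy: "x < y" "- B \<le> x" "y \<le> B" "y - x \<le> (1 + t) * m" "emeasure lborel (E - {x<..<y}) \<le> ennreal (2 * t * m)"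
    using almost_interval[OF s E(1,2,3,4) \<epsilon> E(5) t(1,2,1) small B] by blast
  have fin: "weight_on s \<Omega> S < \<infinity>" if "S \<in> sets borel" "S \<subseteq> \<Omega>" for S
  proof -
    have "emeasure lborel S \<le> ennreal (\<Sum>k\<in>{1..n}. hi k - lo k)"
      unfolding emeasure_\<Omega>[symmetric] using that by (intro emeasure_mono) auto
    from weight_le_bound[OF s that this] show ?thesis
      using lo_less_hi by (force intro: le_less_trans sum_nonneg less_imp_le)
  qed
  obtain W where W: "weight_on s \<Omega> E = ennreal W" "0 \<le> W"
    using fin[OF E(1,2)] by (cases "weight_on s \<Omega> E") auto
  have J: "\<Omega> \<inter> {x<..<y} \<in> sets borel" by simp
  obtain V where V: "weight_on s \<Omega> (\<Omega> \<inter> {x<..<y}) = ennreal V" "0 \<le> V"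
    using fin[OF J] by (cases "weight_on s \<Omega> (\<Omega> \<inter> {x<..<y})") auto
  have Gm: "0 \<le> weight_bound s m" by (rule weight_bound_nonneg[OF s(2)])
  have "ennreal (sharp_ratio s * weight_bound s m) \<le> gagliardo s 1 (indicator E)"
    unfolding sharp_ratio_mult[OF s] by (rule perimeter_ge[OF s E(1,3)]) (use E(4) in simp)
  also have "\<dots> \<le> ennreal ((sharp_ratio s + \<epsilon>) * W)"
    using E(5) W \<epsilon> sharp_ratio_pos[OF s(1)] by (simp add: ennreal_mult)
  finally have "sharp_ratio s * weight_bound s m \<le> (sharp_ratio s + \<epsilon>) * W" using W \<epsilon> sharp_ratio_pos[OF s(1)] by (subst (asm) ennreal_le_iff) auto
  also have "\<dots> \<le> (sharp_ratio s + sharp_ratio s * t) * W" using W(2) by (intro mult_right_mono) (auto simp: \<epsilon>_def)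
  also have "\<dots> = sharp_ratio s * ((1 + t) * W)" by (simp add: algebra_simps)
  finally have GW: "weight_bound s m \<le> (1 + t) * W" using sharp_ratio_pos[OF s(1)] by simp
  have "(1 - t) * weight_bound s m \<le> (1 - t) * ((1 + t) * W)" using GW t by (intro mult_left_mono) auto
  also have "\<dots> = W - t\<^sup>2 * W" by (simp add: algebra_simps power2_eq_square)
  also have "\<dots> \<le> W" using W by simp
  finally have low: "(1 - t) * weight_bound s m \<le> W" .
  have "weight_on s \<Omega> E \<le> weight_on s \<Omega> ((\<Omega> \<inter> {x<..<y}) \<union> (E - {x<..<y}))"
    using E(2) by (intro weight_on_mono) auto
  also have "\<dots> \<le> weight_on s \<Omega> (\<Omega> \<inter> {x<..<y}) + weight_on s \<Omega> (E - {x<..<y})"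
    using E(1) by (intro weight_on_Un) auto
  also have "\<dots> \<le> ennreal V + ennreal (weight_bound s (2 * t * m))"
    unfolding V using E t xy(5) by (intro add_left_mono weight_le_bound[OF s]) auto
  also have "weight_bound s (2 * t * m) = (2 * t) powr (1 - s) * weight_bound s m" using t E(4) by (intro weight_bound_scale) auto
  finally have "W \<le> V + (2 * t) powr (1 - s) * weight_bound s m"
    unfolding W using V(2) Gm by (simp add: ennreal_plus[symmetric] del: ennreal_plus)
  with low have "(1 - t - (2 * t) powr (1 - s)) * weight_bound s m \<le> V" by (simp add: algebra_simps)
  moreover have "\<theta> * (1 + t) powr (1 - s) * weight_bound s m \<le> (1 - t - (2 * t) powr (1 - s)) * weight_bound s m"
    using t Gm by (intro mult_right_mono) (auto simp: field_simps)
  moreover have "\<theta> * weight_bound s (y - x) \<le> \<theta> * weight_bound s ((1 + t) * m)"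
    using xy(1,4) \<theta> s by (intro mult_left_mono weight_bound_mono) auto
  moreover have "weight_bound s ((1 + t) * m) = (1 + t) powr (1 - s) * weight_bound s m" using t E(4) by (intro weight_bound_scale) auto
  ultimately have "\<theta> * weight_bound s (y - x) \<le> V" by (simp add: mult.assoc)
  then show ?thesis using xy V by (intro that[of x y]) (auto intro: ennreal_leI)
qed

text \<open>A short interval is near at most one boundary point, so the bathtub estimate holds with constant 2
  instead of \<open>2 * n\<close>. For \<open>n \<ge> 2\<close> this prevents nearly optimal intervals from shrinking to a
  point.\<close>

lemma weight_short_interval:
  assumes s: "0 < s" "s < 1"
  obtains \<delta> where "0 < \<delta>" "\<And>x y. x < y \<Longrightarrow> y - x < \<delta> \<Longrightarrow>
     weight_on s \<Omega> (\<Omega> \<inter> {x<..<y}) \<le> ennreal (2 powr s * (y - x) powr (1 - s) / (1 - s))"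
proof -
  obtain d where d: "0 < d" "\<And>e e'. e \<in> frontier \<Omega> \<Longrightarrow> e' \<in> frontier \<Omega> \<Longrightarrow> \<bar>e - e'\<bar> < d \<Longrightarrow> e = e'"
  proof -
    \<comment> \<open>a finite set is separated; 1 is only there to make the minimum exist\<close>
    define D where "D = insert 1 ((\<lambda>(e, e'). \<bar>e - e'\<bar>) ` (frontier \<Omega> \<times> frontier \<Omega>) - {0})"
    have fin: "finite D" unfolding D_def using finite_frontier by auto
    have "0 < Min D" using fin by (subst Min_gr_iff) (auto simp: D_def)
    moreover have "e = e'" if "e \<in> frontier \<Omega>" "e' \<in> frontier \<Omega>" "\<bar>e - e'\<bar> < Min D" for e e'
    proof (rule ccontr)
      assume "e \<noteq> e'"
      then have "\<bar>e - e'\<bar> \<in> D" using that(1,2) by (force simp: D_def)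
      then have "Min D \<le> \<bar>e - e'\<bar>" using fin by (intro Min_le)
      then show False using that(3) by simp
    qed
    ultimately show ?thesis by (rule that)
  qed
  have "weight_on s \<Omega> (\<Omega> \<inter> {x<..<y}) \<le> ennreal (2 powr s * (y - x) powr (1 - s) / (1 - s))"
    if xy: "x < y" "y - x < d / 3" for x y
  proof -
    let ?E = "\<Omega> \<inter> {x<..<y}"
    have mle: "emeasure lborel ?E \<le> ennreal (y - x)"
      using emeasure_mono[of ?E "{x<..<y}" lborel] xy by simp
    then obtain m where m: "emeasure lborel ?E = ennreal m" "0 \<le> m"
      by (cases "emeasure lborel ?E") (auto simp: top_unique)
    have "weight_on s \<Omega> ?E \<le> ennreal (2 powr s * m powr (1 - s) / (1 - s))"
    proof (rule weight_on_bound[OF s _ open_\<Omega> frontier_nonempty _ _ m])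
      fix t :: real assume t: "0 < t"
      show "emeasure lborel {z \<in> ?E. infdist z (frontier \<Omega>) < t} \<le> ennreal (2 * t)"
      proof (cases "t < y - x \<and> {z \<in> ?E. infdist z (frontier \<Omega>) < t} \<noteq> {}")
        case True
        then obtain z where "z \<in> {z \<in> ?E. infdist z (frontier \<Omega>) < t}" by (metis ex_in_conv)
        then have z: "z \<in> ?E" "infdist z (frontier \<Omega>) < t" by simp_all
        have near: "\<exists>e\<in>frontier \<Omega>. \<bar>w - e\<bar> < t" if "infdist w (frontier \<Omega>) < t" for w
          using infdist_attains_inf[OF frontier_closed frontier_nonempty, of w] that by (metis dist_real_def)
        obtain e where e: "e \<in> frontier \<Omega>" "\<bar>z - e\<bar> < t" using near[OF z(2)] by blast
        have "{z \<in> ?E. infdist z (frontier \<Omega>) < t} \<subseteq> {e - t<..<e + t}"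
        proof
          fix w assume w: "w \<in> {z \<in> ?E. infdist z (frontier \<Omega>) < t}"
          then have "infdist w (frontier \<Omega>) < t" by simp
          then obtain e' where e': "e' \<in> frontier \<Omega>" "\<bar>w - e'\<bar> < t" using near by meson
          have "\<bar>w - z\<bar> < y - x" using w z by auto
          then have "\<bar>e' - e\<bar> < d" using e e' True xy by linarith
          then have "e' = e" by (rule d(2)[OF e'(1) e(1)])
          then show "w \<in> {e - t<..<e + t}" using e'(2) by auto
        qed
        from emeasure_mono[OF this, of lborel] show ?thesis using t by simp
      next
        case False
        then consider "y - x \<le> t" | "{z \<in> ?E. infdist z (frontier \<Omega>) < t} = {}" by force
        then show ?thesis
        proof cases
          case 1
          have "emeasure lborel {z \<in> ?E. infdist z (frontier \<Omega>) < t} \<le> emeasure lborel {x<..<y}" by (intro emeasure_mono) auto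
          also have "\<dots> \<le> ennreal (2 * t)" using xy 1 t by (simp add: ennreal_leI)
          finally show ?thesis .
        next
          case 2
          show ?thesis unfolding 2 by simp
        qed
      qed
    qed auto
    also have "\<dots> \<le> ennreal (2 powr s * (y - x) powr (1 - s) / (1 - s))"
      using mle m xy s by (intro ennreal_leI divide_right_mono mult_left_mono powr_mono2) auto
    finally show ?thesis .
  qed
  then show ?thesis using d(1) by (intro that[of "d / 3"]) auto
qed

text \<open>The ends of nearly optimal intervals have a convergent subsequence. The weight depends continuously
  on the ends because the weight of the differences obeys the bathtub estimate.\<close>

lemma optimal_interval_exists:
  assumes s: "0 < s" "s < 1" and le: "hardy_const s 1 \<Omega> \<le> ennreal (sharp_ratio s)" and n2: "2 \<le> n"
  obtains x y where "x < y" "ennreal (weight_bound s (y - x)) \<le> weight_on s \<Omega> (\<Omega> \<inter> {x<..<y})"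
proof -
  obtain B where B: "\<Omega> \<subseteq> {- B<..<B}"
  proof -
    obtain b where "\<And>x. x \<in> \<Omega> \<Longrightarrow> \<bar>x\<bar> \<le> b" using bounded_\<Omega> by (auto simp: bounded_iff)
    then show ?thesis by (intro that[of "b + 1"]) force
  qed
  define \<theta> where "\<theta> j = 1 - 1 / real (Suc (Suc j))" for j
  have \<theta>: "0 < \<theta> j" "\<theta> j < 1" for j by (auto simp: \<theta>_def field_simps)
  have \<theta>1: "\<theta> \<longlonglongrightarrow> 1"
  proof -
    have "(\<lambda>j. 1 - 1 / real (Suc (Suc j))) \<longlonglongrightarrow> 1 - 0"
      by (intro tendsto_diff tendsto_const LIMSEQ_Suc[OF LIMSEQ_Suc[OF lim_1_over_n]])
    then show ?thesis by (simp add: \<theta>_def[abs_def])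
  qed
  have "\<exists>z. fst z < snd z \<and> - B \<le> fst z \<and> snd z \<le> B \<and> ennreal (\<theta> j * weight_bound s (snd z - fst z)) \<le> weight_on s \<Omega> (\<Omega> \<inter> {fst z<..<snd z})" for j
    using near_optimal_interval[OF s le B \<theta>[of j]] by (metis fst_conv snd_conv)
  then obtain z where z: "\<And>j. fst (z j) < snd (z j)" "\<And>j. - B \<le> fst (z j)" "\<And>j. snd (z j) \<le> B"
    "\<And>j. ennreal (\<theta> j * weight_bound s (snd (z j) - fst (z j))) \<le> weight_on s \<Omega> (\<Omega> \<inter> {fst (z j)<..<snd (z j)})"
    by metis
  have "seq_compact ({- B..B} \<times> {- B..B})" by (intro compact_imp_seq_compact compact_Times) auto
  moreover have "z j \<in> {- B..B} \<times> {- B..B}" for j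
    using z(1,2,3)[of j] by (cases "z j") auto
  ultimately obtain w f where f: "strict_mono f" "(z \<circ> f) \<longlonglongrightarrow> w"
    unfolding seq_compact_def by metis
  define a b where "a j = fst (z (f j))" and "b j = snd (z (f j))" for j
  define x y where "x = fst w" and "y = snd w"
  have a: "a \<longlonglongrightarrow> x" and b: "b \<longlonglongrightarrow> y"
    using tendsto_fst[OF f(2)] tendsto_snd[OF f(2)] by (auto simp: a_def[abs_def] b_def[abs_def] x_def y_def o_def)
  have ab: "a j < b j" for j using z(1) by (simp add: a_def b_def)
  define \<phi> where "\<phi> j = \<theta> (f j)" for j
  have \<phi>: "\<phi> \<longlonglongrightarrow> 1" using LIMSEQ_subseq_LIMSEQ[OF \<theta>1 f(1)] by (simp add: \<phi>_def[abs_def] o_def)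
  have opt: "ennreal (\<phi> j * weight_bound s (b j - a j)) \<le> weight_on s \<Omega> (\<Omega> \<inter> {a j<..<b j})" for j
    using z(4)[of "f j"] by (simp add: a_def b_def \<phi>_def)
  have xy: "x \<le> y" using a b ab by (intro LIMSEQ_le) (auto intro: less_imp_le)
  have "x \<noteq> y"
  proof
    assume eq: "x = y"
    obtain \<delta> where \<delta>: "0 < \<delta>" "\<And>x y. x < y \<Longrightarrow> y - x < \<delta> \<Longrightarrow>
       weight_on s \<Omega> (\<Omega> \<inter> {x<..<y}) \<le> ennreal (2 powr s * (y - x) powr (1 - s) / (1 - s))"
      using weight_short_interval[OF s] by blast
    have "(\<lambda>j. b j - a j) \<longlonglongrightarrow> y - x" by (intro tendsto_intros a b)
    then have ev1: "eventually (\<lambda>j. b j - a j < \<delta>) sequentially" using order_tendstoD(2)[of _ "y - x" _ \<delta>] \<delta>(1) eq by simp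
    have "1 < real n powr s" using n2 s by (intro gr_one_powr) auto
    then have "1 / real n powr s < 1" by (subst divide_less_eq_1_pos) linarith+
    then have ev2: "eventually (\<lambda>j. 1 / real n powr s < \<phi> j) sequentially" using order_tendstoD(1)[OF \<phi>] by simp
    from eventually_conj[OF ev1 ev2] obtain j where j: "b j - a j < \<delta>" "1 / real n powr s < \<phi> j"
      by (auto simp: eventually_sequentially)
    define c where "c = 2 powr s * (b j - a j) powr (1 - s) / (1 - s)"
    have c: "0 < c" using ab[of j] s by (simp add: c_def)
    have Gc: "weight_bound s (b j - a j) = real n powr s * c" using n by (simp add: weight_bound_def c_def powr_mult)
    have "ennreal (\<phi> j * weight_bound s (b j - a j)) \<le> ennreal c"
      unfolding c_def by (rule order_trans[OF opt \<delta>(2)[OF ab j(1)]])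
    then have "\<phi> j * (real n powr s * c) \<le> c" using c unfolding Gc by (simp add: ennreal_le_iff)
    moreover have "1 * c < (\<phi> j * real n powr s) * c"
      using j(2) c n by (intro mult_strict_right_mono) (auto simp: divide_less_eq)
    ultimately show False by (simp add: mult.assoc)
  qed
  then have lt: "x < y" using xy by simp
  have "ennreal (weight_bound s (y - x)) \<le> weight_on s \<Omega> (\<Omega> \<inter> {x<..<y})"
  proof -
    have bound: "ennreal (\<phi> j * weight_bound s (b j - a j)) \<le> weight_on s \<Omega> (\<Omega> \<inter> {x<..<y}) + (ennreal (weight_bound s \<bar>a j - x\<bar>) + ennreal (weight_bound s \<bar>b j - y\<bar>))" for j
    proof -
      let ?A = "\<Omega> \<inter> {min (a j) x..max (a j) x}" and ?B = "\<Omega> \<inter> {min (b j) y..max (b j) y}"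
      have "weight_on s \<Omega> (\<Omega> \<inter> {a j<..<b j}) \<le> weight_on s \<Omega> ((\<Omega> \<inter> {x<..<y}) \<union> (?A \<union> ?B))"
        by (intro weight_on_mono) auto
      also have "\<dots> \<le> weight_on s \<Omega> (\<Omega> \<inter> {x<..<y}) + weight_on s \<Omega> (?A \<union> ?B)" by (intro weight_on_Un) auto
      also have "\<dots> \<le> weight_on s \<Omega> (\<Omega> \<inter> {x<..<y}) + (weight_on s \<Omega> ?A + weight_on s \<Omega> ?B)"
        by (intro add_left_mono weight_on_Un) auto
      also have "\<dots> \<le> weight_on s \<Omega> (\<Omega> \<inter> {x<..<y}) + (ennreal (weight_bound s \<bar>a j - x\<bar>) + ennreal (weight_bound s \<bar>b j - y\<bar>))"
      proof (intro add_left_mono add_mono weight_le_bound[OF s])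
        show "emeasure lborel ?A \<le> ennreal \<bar>a j - x\<bar>"
          by (rule order_trans[OF emeasure_mono[of _ "{min (a j) x..max (a j) x}"]]) (auto simp: min_def max_def)
        show "emeasure lborel ?B \<le> ennreal \<bar>b j - y\<bar>"
          by (rule order_trans[OF emeasure_mono[of _ "{min (b j) y..max (b j) y}"]]) (auto simp: min_def max_def)
      qed auto
      finally show ?thesis using opt[of j] by (rule order_trans[rotated])
    qed
    have G_lim: "(\<lambda>j. weight_bound s (u j)) \<longlonglongrightarrow> weight_bound s c" if "u \<longlonglongrightarrow> c" "\<And>j. 0 \<le> u j" for u c
      unfolding weight_bound_def using s that by (intro tendsto_divide tendsto_mult tendsto_const tendsto_powr2) auto
    have "(\<lambda>j. \<phi> j * weight_bound s (b j - a j)) \<longlonglongrightarrow> 1 * weight_bound s (y - x)"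
      by (intro tendsto_mult \<phi> G_lim tendsto_diff a b) (use ab in \<open>auto intro: less_imp_le\<close>)
    then have L: "(\<lambda>j. ennreal (\<phi> j * weight_bound s (b j - a j))) \<longlonglongrightarrow> ennreal (1 * weight_bound s (y - x))" by (rule tendsto_ennrealI)
    have "(\<lambda>j. weight_bound s \<bar>a j - x\<bar>) \<longlonglongrightarrow> weight_bound s 0" "(\<lambda>j. weight_bound s \<bar>b j - y\<bar>) \<longlonglongrightarrow> weight_bound s 0"
      using a b by (auto intro!: G_lim tendsto_rabs_zero LIM_zero)
    then have R: "(\<lambda>j. weight_on s \<Omega> (\<Omega> \<inter> {x<..<y}) + (ennreal (weight_bound s \<bar>a j - x\<bar>) + ennreal (weight_bound s \<bar>b j - y\<bar>)))
      \<longlonglongrightarrow> weight_on s \<Omega> (\<Omega> \<inter> {x<..<y}) + (ennreal (weight_bound s 0) + ennreal (weight_bound s 0))"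
      by (intro tendsto_add tendsto_const tendsto_ennrealI)
    have "ennreal (1 * weight_bound s (y - x)) \<le> weight_on s \<Omega> (\<Omega> \<inter> {x<..<y}) + (ennreal (weight_bound s 0) + ennreal (weight_bound s 0))"
      by (rule LIMSEQ_le[OF L R]) (use bound in blast)
    then show ?thesis using s by (simp add: weight_bound_def)
  qed
  with lt show ?thesis by (rule that)
qed

text \<open>Let \<open>h i\<close> be the length of the part of the interval inside the \<open>i\<close>-th piece. That part has weight at
  most \<open>c * h i powr (1 - s)\<close>, with equality only if it is the whole piece. Bounding this by the tangent
  at \<open>\<tau> = (y - x) / n\<close>, which is strict unless \<open>h i = \<tau>\<close>, and using that the \<open>h i\<close> add up to at most
  \<open>n * \<tau>\<close>, gives exactly the optimal weight. So no estimate may be strict.\<close>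

lemma optimal_interval_rigid:
  assumes s: "0 < s" "s < 1" and xy: "x < y" and opt: "ennreal (weight_bound s (y - x)) \<le> weight_on s \<Omega> (\<Omega> \<inter> {x<..<y})"
    and k: "k \<in> {1..n}"
  shows "hi k - lo k = (y - x) / real n"
proof (rule ccontr)
  assume ne: "hi k - lo k \<noteq> (y - x) / real n"
  define \<tau> where "\<tau> = (y - x) / real n"
  define c where "c = 2 powr s / (1 - s)"
  have \<tau>: "0 < \<tau>" using xy n by (simp add: \<tau>_def)
  have c: "0 < c" using s by (simp add: c_def)
  define \<alpha> \<beta> where "\<alpha> i = max (lo i) x" and "\<beta> i = min (hi i) y" for i
  define h where "h i = max 0 (\<beta> i - \<alpha> i)" for i
  define T where "T v = \<tau> powr (1 - s) + (1 - s) * \<tau> powr - s * (v - \<tau>)" for v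
  have piece: "{x<..<y} \<inter> I i = {\<alpha> i<..<\<beta> i}" if "i \<in> {1..n}" for i
    using I_eq[OF that] by (auto simp: \<alpha>_def \<beta>_def)
  have mpiece: "emeasure lborel ({x<..<y} \<inter> I i) = ennreal (h i)" if "i \<in> {1..n}" for i
    unfolding piece[OF that] h_def by (cases "\<alpha> i \<le> \<beta> i") auto
  have w: "weight_on s \<Omega> ({x<..<y} \<inter> I i) = (\<integral>\<^sup>+z\<in>{\<alpha> i<..<\<beta> i}. ennreal (1 / min (z - lo i) (hi i - z) powr s) \<partial>lborel)"
    if i: "i \<in> {1..n}" for i
    unfolding weight_on_def piece[OF i, symmetric]
    by (intro nn_integral_cong) (auto simp: infdist_piece[OF i] split: split_indicator)
  have wle: "weight_on s \<Omega> ({x<..<y} \<inter> I i) \<le> ennreal (c * h i powr (1 - s))" if i: "i \<in> {1..n}" for i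
  proof (cases "\<alpha> i < \<beta> i")
    case True
    have "weight_on s \<Omega> ({x<..<y} \<inter> I i) \<le> ennreal (2 powr s * (\<beta> i - \<alpha> i) powr (1 - s) / (1 - s))"
    proof (cases "lo i < \<alpha> i \<or> \<beta> i < hi i")
      case True
      show ?thesis unfolding w[OF i]
        by (rule less_imp_le[OF gap_weight_strict[OF s _ \<open>\<alpha> i < \<beta> i\<close> _ True]]) (auto simp: \<alpha>_def \<beta>_def)
    next
      case False
      then have "\<alpha> i = lo i" "\<beta> i = hi i" by (auto simp: \<alpha>_def \<beta>_def)
      then show ?thesis unfolding w[OF i] using gap_weight[OF s less_imp_le[OF lo_less_hi[OF i]]] by simp
    qed
    then show ?thesis using True by (simp add: c_def h_def)
  next
    case False
    then show ?thesis unfolding piece[OF i] by (simp add: weight_on_def)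
  qed
  have tang: "h i powr (1 - s) \<le> T (h i)" for i
    using powr_below_tangent[OF s \<tau>, of "h i"] by (cases "h i = \<tau>") (auto simp: T_def h_def)
  have wT: "weight_on s \<Omega> ({x<..<y} \<inter> I i) \<le> ennreal (c * T (h i))" if "i \<in> {1..n}" for i
    using wle[OF that] by (rule order_trans) (intro ennreal_leI mult_left_mono tang less_imp_le[OF c])
  have T0: "0 \<le> T (h i)" for i using tang[of i] by (rule order_trans[rotated]) simp
  have strict: "weight_on s \<Omega> ({x<..<y} \<inter> I k) < ennreal (c * T (h k))"
  proof (cases "h k = \<tau>")
    case False
    then have "h k powr (1 - s) < T (h k)" unfolding T_def by (intro powr_below_tangent s \<tau>) (auto simp: h_def)
    then have "c * h k powr (1 - s) < c * T (h k)" using c by simp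
    then have "ennreal (c * h k powr (1 - s)) < ennreal (c * T (h k))" using c by (subst ennreal_less_iff) auto
    with wle[OF k] show ?thesis by (rule le_less_trans)
  next
    case True
    then have ab: "\<alpha> k < \<beta> k" "\<beta> k - \<alpha> k = \<tau>" using \<tau> by (auto simp: h_def)
    have "lo k < \<alpha> k \<or> \<beta> k < hi k"
    proof (rule ccontr)
      assume "\<not> ?thesis"
      then have "\<alpha> k = lo k" "\<beta> k = hi k" by (auto simp: \<alpha>_def \<beta>_def)
      then show False using ab(2) ne by (simp add: \<tau>_def)
    qed
    then have "weight_on s \<Omega> ({x<..<y} \<inter> I k) < ennreal (2 powr s * (\<beta> k - \<alpha> k) powr (1 - s) / (1 - s))"
      unfolding w[OF k] by (intro gap_weight_strict[OF s _ ab(1)]) (auto simp: \<alpha>_def \<beta>_def)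
    also have "\<dots> = ennreal (c * T (h k))" using True ab(2) by (simp add: T_def c_def)
    finally show ?thesis .
  qed
  have hsum: "(\<Sum>i\<in>{1..n}. h i) \<le> y - x"
  proof -
    have "ennreal (\<Sum>i\<in>{1..n}. h i) = (\<Sum>i\<in>{1..n}. emeasure lborel ({x<..<y} \<inter> I i))"
      by (subst sum_ennreal[symmetric]) (auto simp: mpiece h_def)
    also have "\<dots> = emeasure lborel (\<Union>i\<in>{1..n}. {x<..<y} \<inter> I i)"
    proof (rule sum_emeasure)
      show "(\<lambda>i. {x<..<y} \<inter> I i) ` {1..n} \<subseteq> sets lborel" using pieces by auto
      show "disjoint_family_on (\<lambda>i. {x<..<y} \<inter> I i) {1..n}" using disj unfolding disjoint_family_on_def by blast
    qed simp
    also have "\<dots> \<le> emeasure lborel {x<..<y}" by (intro emeasure_mono) auto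
    finally show ?thesis using xy by simp
  qed
  have "weight_on s \<Omega> (\<Omega> \<inter> {x<..<y}) = (\<Sum>i\<in>{1..n}. weight_on s \<Omega> ({x<..<y} \<inter> I i))"
  proof (subst weight_on_pieces)
    show "(\<Sum>i = 1..n. weight_on s \<Omega> (\<Omega> \<inter> {x<..<y} \<inter> I i)) = (\<Sum>i\<in>{1..n}. weight_on s \<Omega> ({x<..<y} \<inter> I i))"
      by (intro sum.cong refl arg_cong[where f="weight_on s \<Omega>"]) (auto simp: \<Omega>_def)
  qed auto
  also have "\<dots> = weight_on s \<Omega> ({x<..<y} \<inter> I k) + (\<Sum>i\<in>{1..n} - {k}. weight_on s \<Omega> ({x<..<y} \<inter> I i))"
    using k by (intro sum.remove) auto
  also have "\<dots> \<le> weight_on s \<Omega> ({x<..<y} \<inter> I k) + (\<Sum>i\<in>{1..n} - {k}. ennreal (c * T (h i)))"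
    by (intro add_left_mono sum_mono wT) auto
  also have "\<dots> < ennreal (c * T (h k)) + (\<Sum>i\<in>{1..n} - {k}. ennreal (c * T (h i)))"
    using strict by (simp add: add.commute[of _ "\<Sum>i\<in>{1..n} - {k}. ennreal (c * T (h i))"] ennreal_add_left_cancel_less)
  also have "\<dots> = (\<Sum>i\<in>{1..n}. ennreal (c * T (h i)))" using k by (intro sum.remove[symmetric]) auto
  also have "\<dots> = ennreal (\<Sum>i\<in>{1..n}. c * T (h i))" using c T0 by (intro sum_ennreal) auto
  also have "(\<Sum>i\<in>{1..n}. c * T (h i)) \<le> weight_bound s (y - x)"
  proof -
    have "(\<Sum>i\<in>{1..n}. T (h i)) = real n * \<tau> powr (1 - s) + (1 - s) * \<tau> powr - s * ((\<Sum>i\<in>{1..n}. h i) - real n * \<tau>)"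
      by (simp add: T_def sum.distrib sum_distrib_left[symmetric] sum_subtractf)
    also have "\<dots> \<le> real n * \<tau> powr (1 - s)"
    proof -
      have "(\<Sum>i\<in>{1..n}. h i) - real n * \<tau> \<le> 0" using hsum n by (simp add: \<tau>_def)
      then have "(1 - s) * \<tau> powr - s * ((\<Sum>i\<in>{1..n}. h i) - real n * \<tau>) \<le> 0"
        using s by (intro mult_nonneg_nonpos) auto
      then show ?thesis by simp
    qed
    finally have "c * (\<Sum>i\<in>{1..n}. T (h i)) \<le> c * (real n * \<tau> powr (1 - s))" using c by (intro mult_left_mono) auto
    also have "\<dots> = weight_bound s (real n * \<tau>)"
    proof -
      have "(real n * \<tau>) powr (1 - s) = real n / real n powr s * \<tau> powr (1 - s)" using n \<tau> by (simp add: powr_mult powr_diff)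
      moreover have "(2 * real n) powr s = 2 powr s * real n powr s" using n by (simp add: powr_mult)
      ultimately show ?thesis using n by (simp add: weight_bound_def c_def)
    qed
    also have "real n * \<tau> = y - x" using n by (simp add: \<tau>_def)
    finally show ?thesis by (simp add: sum_distrib_left)
  qed
  finally have "weight_on s \<Omega> (\<Omega> \<inter> {x<..<y}) < ennreal (weight_bound s (y - x))" by (simp add: ennreal_leI less_le_trans)
  then show False using opt by simp
qed

end

section \<open>The main result\<close>

lemma (in interval_union) hardy_const_lower_pieces:
  assumes "0 < s" "s < 1" "1 \<le> p" "s * p < 1"
  shows "hardy_const s p (UNIV - {0}) / ennreal (real n powr (s * p)) \<le> hardy_const s p \<Omega>"
  by (rule hardy_const_lower[OF assms open_\<Omega> frontier_nonempty _ near_frontier]) (use n in auto)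

lemma (in interval_union) hardy_const_1_eq_iff:
  assumes s: "0 < s" "s < 1" and J: "equivalent_to_interval \<Omega>"
  shows "hardy_const s 1 \<Omega> = hardy_const s 1 (UNIV - {0}) / ennreal (real n powr (s * 1)) \<longleftrightarrow>
    (\<forall>j\<in>{1..n}. \<forall>k\<in>{1..n}. emeasure lborel (I j) = emeasure lborel (I k))"
proof -
  have "4 / (s * 2 powr s) / real n powr s = sharp_ratio s"
    using n by (simp add: sharp_ratio_def powr_mult)
  then have sharp: "hardy_const s 1 (UNIV - {0}) / ennreal (real n powr (s * 1)) = ennreal (sharp_ratio s)"
    using s n by (simp add: hardy_const_1_punctured divide_ennreal)
  have lower: "ennreal (sharp_ratio s) \<le> hardy_const s 1 \<Omega>"
    using hardy_const_lower_pieces[of s 1] s unfolding sharp by simp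
  show ?thesis
  proof
    assume eq: "hardy_const s 1 \<Omega> = hardy_const s 1 (UNIV - {0}) / ennreal (real n powr (s * 1))"
    show "\<forall>j\<in>{1..n}. \<forall>k\<in>{1..n}. emeasure lborel (I j) = emeasure lborel (I k)"
    proof (cases "n = 1")
      case False
      then have n2: "2 \<le> n" using n by simp
      have "hardy_const s 1 \<Omega> \<le> ennreal (sharp_ratio s)" using eq unfolding sharp by simp
      then obtain x y where "x < y" "ennreal (weight_bound s (y - x)) \<le> weight_on s \<Omega> (\<Omega> \<inter> {x<..<y})"
        using optimal_interval_exists[OF s _ n2] by blast
      then have "hi k - lo k = (y - x) / real n" if "k \<in> {1..n}" for k
        using optimal_interval_rigid[OF s] that by blast
      then show ?thesis using emeasure_piece by metis
    qed simp
  next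
    assume same: "\<forall>j\<in>{1..n}. \<forall>k\<in>{1..n}. emeasure lborel (I j) = emeasure lborel (I k)"
    have "hi k - lo k = hi 1 - lo 1" if k: "k \<in> {1..n}" for k
    proof -
      have one: "1 \<in> {1..n}" using n by simp
      have "ennreal (hi k - lo k) = ennreal (hi 1 - lo 1)"
        using same k one emeasure_piece by metis
      then show ?thesis using lo_less_hi[OF k] lo_less_hi[OF one] by (subst (asm) ennreal_inj) auto
    qed
    then have "hardy_const s 1 \<Omega> \<le> ennreal (sharp_ratio s)"
      unfolding sharp_ratio_def by (rule hardy_const_1_equal_lengths[OF s J])
    with lower show "hardy_const s 1 \<Omega> = hardy_const s 1 (UNIV - {0}) / ennreal (real n powr (s * 1))"
      unfolding sharp by simp
  qed
qed

theorem theorem1p6: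
  fixes s p :: real
  assumes "0 < s" and "s < 1" and "1 \<le> p" and "s * p < 1"
  shows
    "(\<forall>(n :: nat) (I :: nat \<Rightarrow> real set) (\<Omega> :: real set).
        1 \<le> n \<and>
        (\<forall>k\<in>{1..n}. I k \<noteq> {} \<and> open (I k) \<and> is_interval (I k) \<and> bounded (I k)) \<and>
        disjoint_family_on I {1..n} \<and>
        \<Omega> = (\<Union>k\<in>{1..n}. I k) \<and> \<Omega> \<noteq> UNIV \<longrightarrow>
          hardy_const s p \<Omega> \<ge> hardy_const s p (UNIV - {0}) / ennreal (real n powr (s * p)) \<and>
          (p = 1 \<and> equivalent_to_interval \<Omega> \<longrightarrow>
            (hardy_const s p \<Omega> = hardy_const s p (UNIV - {0}) / ennreal (real n powr (s * p)) \<longleftrightarrow>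
              (\<forall>j\<in>{1..n}. \<forall>k\<in>{1..n}. emeasure lborel (I j) = emeasure lborel (I k))))) \<and>
     (\<forall>R\<ge>1. hardy_const s p ({-R<..<R} - \<int>) \<le>
        ennreal (R powr (1 - s * p) / of_int \<lfloor>R\<rfloor> * (4 powr (1 - s * p) / (s * p)))) \<and>
     hardy_const s p (UNIV - \<int>) = 0"
proof (intro conjI allI impI)
  fix n :: nat and I :: "nat \<Rightarrow> real set" and \<Omega> :: "real set"
  assume *: "1 \<le> n \<and>
        (\<forall>k\<in>{1..n}. I k \<noteq> {} \<and> open (I k) \<and> is_interval (I k) \<and> bounded (I k)) \<and>
        disjoint_family_on I {1..n} \<and>
        \<Omega> = (\<Union>k\<in>{1..n}. I k) \<and> \<Omega> \<noteq> UNIV"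
  interpret interval_union n I \<Omega>
    by unfold_locales (use * in auto)
  show "hardy_const s p \<Omega> \<ge> hardy_const s p (UNIV - {0}) / ennreal (real n powr (s * p))"
    by (rule hardy_const_lower_pieces[OF assms])
  assume "p = 1 \<and> equivalent_to_interval \<Omega>"
  then show "hardy_const s p \<Omega> = hardy_const s p (UNIV - {0}) / ennreal (real n powr (s * p)) \<longleftrightarrow>
      (\<forall>j\<in>{1..n}. \<forall>k\<in>{1..n}. emeasure lborel (I j) = emeasure lborel (I k))"
    using hardy_const_1_eq_iff[OF assms(1,2)] by simp
next
  fix R :: real
  assume "1 \<le> R"
  then show "hardy_const s p ({-R<..<R} - \<int>) \<le>
      ennreal (R powr (1 - s * p) / of_int \<lfloor>R\<rfloor> * (4 powr (1 - s * p) / (s * p)))"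
    by (intro hardy_const_integers_removed assms) (auto simp: open_Diff)
next
  show "hardy_const s p (UNIV - \<int>) = 0"
    by (rule hardy_const_integers_complement[OF assms])
qed

end
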